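(* Let $P',P''$ be $4$-polytopes. Then there are adapter $4$-polytopes $P'_\vartriangle$ and $P''_\vartriangle$ satisfying $$|f_i(P'_\vartriangle)-f_i(P')|\le 6\,f_i(P')^{2/3}+16,\qquad |f_i(P''_\vartriangle)-f_i(P'')|\le 6\,f_i(P'')^{2/3}+16\qquad(0\le i\le 3),$$ and a $4$-polytope $Q:=P'_\vartriangle\# P''_\vartriangle$ (a connected sum of them) such that $$|f_i(Q)-(f_i(P')+f_i(P''))|<12\,f_i(Q)^{2/3}+33\qquad\text{for all } i,\ 0\le i\le 3.$$
   Context: A $d$-polytope is a $d$-dimensional convex polytope, and $f_i(P)$ is the number of its $i$-dimensional faces. A vertex of a $d$-polytope is simple if it lies in exactly $d$ facets (equivalently, exactly $d$ edges); a simplex facet is a facet that is a $(d-1)$-simplex. An adapter $d$-polytope is a $d$-polytope that has a simple vertex $v$ contained in $d$ simplex facets and an additional simplex facet that does not contain $v$. If $P$ is a $d$-polytope with a simple vertex $v$ and $Q$ is a $d$-polytope with a simplex facet $F$, a connected sum $P\#Q$ is formed as follows: cut off $v$ from $P$ by a hyperplane separating $v$ strictly from all other vertices, which creates a new simplex facet $G$ with $d$ new vertices in the truncated polytope $\bar P$; then, after applying a projective transformation $\pi$ (admissible, i.e. not sending any point of the polytope to infinity) if necessary, glue so that $\pi(Q)\cap\bar P=\pi(F)=G$, the union $\bar P\cup\pi(Q)$ is convex, and all proper faces of $G$ are faces of the union; $P\#Q$ is this union. (It depends on choices, but its $f$-vector is always $f(P)+f(Q)-(1,0,\dots,0,1)$.)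 *)

theory Defs
  imports "HOL-Analysis.Analysis"
begin

text \<open>The ambient space is any Euclidean space; a polytope need not be full-dimensional in it.\<close>

definition d_polytope :: "nat \<Rightarrow> 'a::euclidean_space set \<Rightarrow> bool" where
  "d_polytope d P \<longleftrightarrow> polytope P \<and> aff_dim P = int d"

definition f_num :: "nat \<Rightarrow> 'a::euclidean_space set \<Rightarrow> nat" where
  "f_num i P = card {F. F face_of P \<and> aff_dim F = int i}"

definition simple_vertex :: "nat \<Rightarrow> 'a::euclidean_space set \<Rightarrow> 'a \<Rightarrow> bool" where
  "simple_vertex d P v \<longleftrightarrow> v extreme_point_of P \<and> card {F. F facet_of P \<and> v \<in> F} = d"

definition simplex_facet :: "nat \<Rightarrow> 'a::euclidean_space set \<Rightarrow> 'a set \<Rightarrow> bool" where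
  "simplex_facet d P F \<longleftrightarrow> F facet_of P \<and> (int d - 1) simplex F"

definition adapter_polytope :: "nat \<Rightarrow> 'a::euclidean_space set \<Rightarrow> bool" where
  "adapter_polytope d P \<longleftrightarrow> d_polytope d P \<and>
     (\<exists>v. simple_vertex d P v \<and>
          card {F. simplex_facet d P F \<and> v \<in> F} = d \<and>
          (\<exists>F. simplex_facet d P F \<and> v \<notin> F))"

text \<open>A projective transformation is given in homogeneous coordinates by a linear automorphism
  \<open>L\<close> of \<open>'a \<times> real\<close>: a point \<open>x\<close> is lifted to \<open>(x, 1)\<close>, and the image
  \<open>L (x, 1)\<close> is dehomogenised. Points where the last coordinate of the image vanishes are sent
  to infinity; there \<open>projective_map\<close> carries no meaning.\<close>

definition projective_map ::
  "('a::euclidean_space \<times> real \<Rightarrow> 'a \<times> real) \<Rightarrow> 'a \<Rightarrow> 'a" where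
  "projective_map L x = fst (L (x, 1)) /\<^sub>R snd (L (x, 1))"

definition admissible_projective ::
  "('a::euclidean_space \<times> real \<Rightarrow> 'a \<times> real) \<Rightarrow> 'a set \<Rightarrow> bool" where
  "admissible_projective L S \<longleftrightarrow> linear L \<and> bij L \<and> (\<forall>x\<in>S. snd (L (x, 1)) \<noteq> 0)"

text \<open>Connected sums depend on choices (of \<open>v\<close>, the truncating hyperplane, the simplex facet
  \<open>F\<close> and the projective transformation), so \<open>R\<close> being a connected sum of \<open>P\<close> and
  \<open>Q\<close> is a relation. The hyperplane is \<open>{x. a \<bullet> x = b}\<close>, and \<open>Pbar\<close> is the
  truncated polytope with new facet \<open>G\<close>.\<close>

definition is_connected_sum ::
  "nat \<Rightarrow> 'a::euclidean_space set \<Rightarrow> 'a set \<Rightarrow> 'a set \<Rightarrow> bool" where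
  "is_connected_sum d P Q R \<longleftrightarrow> d_polytope d P \<and> d_polytope d Q \<and>
     (\<exists>v a b F L Pbar G piQ.
        simple_vertex d P v \<and>
        a \<bullet> v > b \<and> (\<forall>w. w extreme_point_of P \<and> w \<noteq> v \<longrightarrow> a \<bullet> w < b) \<and>
        Pbar = P \<inter> {x. a \<bullet> x \<le> b} \<and>
        G = P \<inter> {x. a \<bullet> x = b} \<and>
        simplex_facet d Q F \<and>
        admissible_projective L Q \<and>
        piQ = projective_map L ` Q \<and>
        piQ \<inter> Pbar = G \<and>
        projective_map L ` F = G \<and>
        convex (Pbar \<union> piQ) \<and>
        (\<forall>H. H face_of G \<and> H \<noteq> G \<longrightarrow> H face_of (Pbar \<union> piQ)) \<and>
        R = Pbar \<union> piQ)"

end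

theory Submission
  imports Defs
begin

text \<open>Two distinct facets of a 4-polytope meet in dimension at most 2, and a 2-face lies in only two
  facets, so the vertex-facet incidence graph contains no \<open>K\<^sub>3\<^sub>,\<^sub>3\<close>. By the
  Kovari-Sos-Turan count there is a facet with few vertices (if \<open>f\<^sub>0 \<le> f\<^sub>3\<close>) or a
  vertex in few facets (otherwise), where few means at most \<open>4/3 n\<^sup>2\<^sup>/\<^sup>3 + 1\<close> with
  \<open>n = min f\<^sub>0 f\<^sub>3\<close>. In the second case truncate that vertex; in both cases one gets a facet \<open>F\<close>
  all of whose face numbers are linear in this bound, by Euler's inequality for 3-polytopes.

  Three stackings now make an adapter: an apex \<open>x\<close> over \<open>F\<close>, an apex \<open>y\<close> over the
  pyramid on \<open>x\<close> and a polygon \<open>g\<close> of \<open>F\<close> with at most five edges, and an apex \<open>z\<close> over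
  one of the resulting simplex facets, spanned by an edge of \<open>g\<close> together with \<open>x\<close> and \<open>y\<close>.
  Then \<open>z\<close> is simple with only simplex facets around it, and another edge of \<open>g\<close> gives a
  simplex facet avoiding \<open>z\<close>.

  For the connected sum, map the simplex facet of the second adapter affinely onto the cut \<open>G\<close> of the
  first and then pull everything else projectively towards an interior point \<open>w\<close> of the removed cap.
  The image minus \<open>G\<close> ends up in the interior of the first adapter, which makes the union convex
  and keeps the proper faces of \<open>G\<close> as faces.\<close>

section \<open>Faces, slices and ridges\<close>

text \<open>Three stackings are needed because each one removes a dimension of unknown shape. Facets
  of a pyramid are pyramids over facets of its base. So \<open>F\<close>, an arbitrary 3-polytope,
  is followed by a pyramid over a polygon and then by two apices over an edge, which is a
  tetrahedron. Only \<open>F\<close> can be large; a polygon with at most five edges keeps the later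
  costs constant.

  Let \<open>k\<close> be the number of vertices of \<open>F\<close> or, after truncation, of its
  2-faces. Euler's inequality is symmetric in these two numbers: it bounds the edges of
  \<open>F\<close> by \<open>3k - 6\<close> and the other number by \<open>2k - 4\<close>. With
  \<open>s = n^(2/3)\<close> and \<open>k <= 4/3 s + 1\<close> the tightest case is the cost
  \<open>4k + 10 <= 16/3 s + 14\<close> for 2-faces after truncation, which fits the constants 6 and
  16. The edges cost \<open>5k\<close> there, and \<open>20/3 s\<close> exceeds \<open>6 s\<close>;
  but \<open>f_1 >= 2 f_3\<close> yields \<open>f_1^(2/3) >= 3/2 s\<close>, which compensates.

  Every face number strictly grows on the way to the adapter. This absorbs the vertex and the facet
  lost in the connected sum and lets its face numbers dominate those of the two given
  polytopes.\<close>

definition ifaces :: "nat \<Rightarrow> 'a::euclidean_space set \<Rightarrow> 'a set set" where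
  "ifaces i P = {F. F face_of P \<and> aff_dim F = int i}"

lemma f_num_eq_card: "f_num i P = card (ifaces i P)"
  by (simp add: f_num_def ifaces_def)

lemma finite_ifaces: "polytope P \<Longrightarrow> finite (ifaces i P)"
  unfolding ifaces_def using finite_polytope_faces by (metis (no_types, lifting) mem_Collect_eq rev_finite_subset subsetI)

text \<open>A face of least dimension through \<open>z\<close> works: if \<open>z\<close> were on
  its relative boundary, one of its facets would be a smaller face through \<open>z\<close>.\<close>

lemma exists_face_rel_interior:
  fixes S :: "'a::euclidean_space set"
  assumes "polytope S" "z \<in> S"
  obtains K where "K face_of S" "z \<in> rel_interior K"
proof -
  have "S face_of S \<and> z \<in> S"
    using assms by (simp add: face_of_refl polytope_imp_convex)
  \<comment> \<open>The shift by one turns dimensions, which start at -1 for the empty set, into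
    natural numbers without collapsing the two lowest values.\<close>
  then obtain K where K: "K face_of S" "z \<in> K"
    and least: "\<And>T. T face_of S \<and> z \<in> T \<Longrightarrow> nat (aff_dim K + 1) \<le> nat (aff_dim T + 1)"
    using ex_has_least_nat[of "\<lambda>K. K face_of S \<and> z \<in> K" S "\<lambda>K. nat (aff_dim K + 1)"] by blast
  have "z \<in> rel_interior K"
  proof (rule ccontr)
    assume "z \<notin> rel_interior K"
    moreover have "polyhedron K"
      using K assms face_of_polytope_polytope polytope_imp_polyhedron by blast
    ultimately obtain F where "F facet_of K" "z \<in> F"
      using K rel_boundary_of_polyhedron by blast
    then have "F face_of S" "aff_dim F = aff_dim K - 1" "F \<noteq> {}"
      using K facet_of_def face_of_trans by blast+
    then show False
      using least[of F] \<open>z \<in> F\<close> aff_dim_geq[of F] by (auto simp: aff_dim_empty)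
  qed
  with K show thesis using that by blast
qed

text \<open>Near a relative interior point \<open>K\<close> fills its affine hull, so the slice
  spans the same flat as the slice of the affine hull, where the dimension drops by exactly
  one.\<close>

lemma aff_dim_Int_hyperplane:
  fixes K :: "'a::euclidean_space set"
  assumes "convex K" "rel_interior K \<inter> {x. a \<bullet> x = b} \<noteq> {}" "\<not> K \<subseteq> {x. a \<bullet> x = b}"
  shows "aff_dim (K \<inter> {x. a \<bullet> x = b}) = aff_dim K - 1"
proof -
  let ?H = "{x. a \<bullet> x = b}"
  obtain U where U: "open U" "rel_interior K = affine hull K \<inter> U"
    using openin_rel_interior[of K] by (auto simp: openin_open)
  have "affine hull ((affine hull K \<inter> ?H) \<inter> U) = affine hull (affine hull K \<inter> ?H)"
    using assms U by (intro affine_hull_affine_Int_open) (auto intro: affine_Int affine_hyperplane)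
  then have 1: "aff_dim (rel_interior K \<inter> ?H) = aff_dim (affine hull K \<inter> ?H)"
  proof -
    have "rel_interior K \<inter> ?H = (affine hull K \<inter> ?H) \<inter> U" using U by blast
    then show ?thesis
      using aff_dim_affine_hull2[OF \<open>affine hull ((affine hull K \<inter> ?H) \<inter> U) = affine hull (affine hull K \<inter> ?H)\<close>] by simp
  qed
  have 2: "aff_dim (affine hull K \<inter> ?H) = aff_dim K - 1"
    using assms rel_interior_subset[of K] hull_subset[of K affine]
    by (subst aff_dim_affine_Int_hyperplane) auto
  have "aff_dim (rel_interior K \<inter> ?H) \<le> aff_dim (K \<inter> ?H)"
    using rel_interior_subset[of K] by (intro aff_dim_subset) auto
  moreover have "aff_dim (K \<inter> ?H) \<le> aff_dim (affine hull K \<inter> ?H)"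
    using hull_subset[of K affine] by (intro aff_dim_subset) auto
  ultimately show ?thesis using 1 2 by linarith
qed

text \<open>The relative interior is dense in \<open>K\<close>, so it cannot stay strictly on one
  side, and it is connected.\<close>

lemma rel_interior_meets_hyperplane:
  fixes K :: "'a::euclidean_space set"
  assumes "convex K" "x \<in> K" "y \<in> K" "a \<bullet> x < b" "b < a \<bullet> y"
  shows "rel_interior K \<inter> {x. a \<bullet> x = b} \<noteq> {}"
proof -
  have cl: "closure (rel_interior K) = closure K"
    by (simp add: assms convex_closure_rel_interior)
  have "\<not> rel_interior K \<subseteq> {x. a \<bullet> x \<le> b}"
    using closure_minimal[OF _ closed_halfspace_le, of "rel_interior K" a b] cl
      closure_subset[of K] assms by fastforce
  moreover have "\<not> rel_interior K \<subseteq> {x. a \<bullet> x \<ge> b}"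
    using closure_minimal[OF _ closed_halfspace_ge, of "rel_interior K" b a] cl
      closure_subset[of K] assms by fastforce
  ultimately obtain x' y' where "x' \<in> rel_interior K" "y' \<in> rel_interior K" "a \<bullet> x' \<le> b" "b \<le> a \<bullet> y'"
    by fastforce
  then show ?thesis
    using connected_ivt_hyperplane[of "rel_interior K" x' y' a b]
    by (metis (mono_tags, lifting) IntI assms(1) convex_connected convex_rel_interior emptyE mem_Collect_eq)
qed

section \<open>Ridges and the two facets through them\<close>

lemma face_of_eq_aff_dim:
  fixes P :: "'a::euclidean_space set"
  assumes "convex P" "F face_of P" "F' face_of P" "F \<subseteq> F'" "aff_dim F = aff_dim F'"
  shows "F = F'"
proof (rule ccontr)
  assume "F \<noteq> F'"
  moreover have "F face_of F'" using assms face_of_face by blast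
  ultimately show False
    using face_of_aff_dim_lt[of F' F] assms face_of_imp_convex[of F' P] by simp
qed

text \<open>Modulo the affine hull of the ridge, points \<open>p\<^sub>i\<close> in the relative interiors of three facets live in a plane
  and are linearly dependent; the three supporting functionals force contradictory signs on the
  coefficients.\<close>

lemma ridge_le_two_facets:
  fixes P :: "'a::euclidean_space set"
  assumes P: "polytope P" and R: "R face_of P" "R \<noteq> {}" "aff_dim R = aff_dim P - 2"
  shows "card {F. F facet_of P \<and> R \<subseteq> F} \<le> 2"
proof (rule ccontr)
  let ?\<F> = "{F. F facet_of P \<and> R \<subseteq> F}"
  assume "\<not> card ?\<F> \<le> 2"
  then have "3 \<le> card ?\<F>" by linarith
  then obtain \<G> where "\<G> \<subseteq> ?\<F>" "card \<G> = 3"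
    by (rule obtain_subset_with_card_n)
  moreover from \<open>card \<G> = 3\<close> obtain F1 F2 F3 where "\<G> = {F1, F2, F3}" "F1 \<noteq> F2" "F1 \<noteq> F3" "F2 \<noteq> F3"
    by (auto simp: card_3_iff)
  ultimately have F: "F1 \<in> ?\<F>" "F2 \<in> ?\<F>" "F3 \<in> ?\<F>" "F1 \<noteq> F2" "F1 \<noteq> F3" "F2 \<noteq> F3"
    by blast+
  have cP: "convex P" using P polytope_imp_convex by blast
  have ex: "\<exists>a b p. P \<subseteq> {x. a \<bullet> x \<le> b} \<and> F = P \<inter> {x. a \<bullet> x = b} \<and> p \<in> rel_interior F \<and> p \<in> F" if F: "F \<in> ?\<F>" for F
  proof -
    obtain a b where "P \<subseteq> {x. a \<bullet> x \<le> b}" "F = P \<inter> {x. a \<bullet> x = b}"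
      using facet_of_polyhedron[OF polytope_imp_polyhedron[OF P]] F by blast
    moreover obtain p where "p \<in> rel_interior F"
      using F rel_interior_eq_empty[of F] face_of_imp_convex[of F P] by (auto simp: facet_of_def)
    ultimately show ?thesis using rel_interior_subset by blast
  qed
  have notin: "p \<notin> F'" if "p \<in> rel_interior F" "F \<in> ?\<F>" "F' \<in> ?\<F>" "F \<noteq> F'" for p F F'
  proof
    assume "p \<in> F'"
    then have "F \<subseteq> F'"
      using subset_of_face_of[of F' P F] that facet_of_imp_subset[of F P] by (auto simp: facet_of_def)
    then show False
      using face_of_eq_aff_dim[OF cP, of F F'] that by (auto simp: facet_of_def)
  qed
  from ex[OF F(1)] obtain a1 b1 p1 where 1: "P \<subseteq> {x. a1 \<bullet> x \<le> b1}" "F1 = P \<inter> {x. a1 \<bullet> x = b1}" "p1 \<in> rel_interior F1" "p1 \<in> F1" by blast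
  from ex[OF F(2)] obtain a2 b2 p2 where 2: "P \<subseteq> {x. a2 \<bullet> x \<le> b2}" "F2 = P \<inter> {x. a2 \<bullet> x = b2}" "p2 \<in> rel_interior F2" "p2 \<in> F2" by blast
  from ex[OF F(3)] obtain a3 b3 p3 where 3: "P \<subseteq> {x. a3 \<bullet> x \<le> b3}" "F3 = P \<inter> {x. a3 \<bullet> x = b3}" "p3 \<in> rel_interior F3" "p3 \<in> F3" by blast
  obtain r where r: "r \<in> R" using R by blast
  have rP: "r \<in> P" using r R face_of_imp_subset by blast
  have rF: "a1 \<bullet> r = b1" "a2 \<bullet> r = b2" "a3 \<bullet> r = b3"
    using r F 1 2 3 by auto
  have out: "p1 \<notin> F2" "p1 \<notin> F3" "p2 \<notin> F1" "p2 \<notin> F3" "p3 \<notin> F1" "p3 \<notin> F2"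
    using notin[OF 1(3) F(1) F(2) F(4)] notin[OF 1(3) F(1) F(3) F(5)] notin[OF 2(3) F(2) F(1) F(4)[symmetric]]
      notin[OF 2(3) F(2) F(3) F(6)] notin[OF 3(3) F(3) F(1) F(5)[symmetric]] notin[OF 3(3) F(3) F(2) F(6)[symmetric]] by simp_all
  have pP: "p1 \<in> P" "p2 \<in> P" "p3 \<in> P" using 1 2 3 by auto
  have s1: "a1 \<bullet> (p1 - r) = 0" "a1 \<bullet> (p2 - r) < 0" "a1 \<bullet> (p3 - r) < 0"
    using pP 1 out rF by (auto simp: inner_diff_right order.strict_iff_order)
  have s2: "a2 \<bullet> (p1 - r) < 0" "a2 \<bullet> (p2 - r) = 0" "a2 \<bullet> (p3 - r) < 0"
    using pP 2 out rF by (auto simp: inner_diff_right order.strict_iff_order)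
  have s3: "a3 \<bullet> (p1 - r) < 0" "a3 \<bullet> (p2 - r) < 0" "a3 \<bullet> (p3 - r) = 0"
    using pP 3 out rF by (auto simp: inner_diff_right order.strict_iff_order)
  define B where "B = (\<lambda>x. x - r) ` R"
  have ker: "a \<bullet> x = 0" if "x \<in> span B" "R \<subseteq> {x. a \<bullet> x = b}" for a b x
  proof -
    have "subspace {x. a \<bullet> x = 0}" by (rule subspace_hyperplane)
    moreover have "B \<subseteq> {x. a \<bullet> x = 0}"
    proof
      fix y assume "y \<in> B"
      then obtain z where "z \<in> R" "y = z - r" unfolding B_def by blast
      moreover have "a \<bullet> z = b" "a \<bullet> r = b" using that r \<open>z \<in> R\<close> by blast+
      ultimately show "y \<in> {x. a \<bullet> x = 0}" by (simp add: inner_diff_right)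
    qed
    ultimately show ?thesis using that span_minimal by blast
  qed
  have k: "x \<in> span B \<Longrightarrow> a1 \<bullet> x = 0 \<and> a2 \<bullet> x = 0 \<and> a3 \<bullet> x = 0" for x
  proof -
    assume x: "x \<in> span B"
    have "R \<subseteq> {x. a1 \<bullet> x = b1}" "R \<subseteq> {x. a2 \<bullet> x = b2}" "R \<subseteq> {x. a3 \<bullet> x = b3}"
      using F 1(2) 2(2) 3(2) by auto
    then show ?thesis using ker x by blast
  qed
  have dB: "int (dim B) = aff_dim R"
    using aff_dim_eq_dim_subtract[of r R] r by (simp add: B_def hull_inc)
  have dP: "int (dim ((\<lambda>x. x - r) ` P)) = aff_dim P"
    using aff_dim_eq_dim_subtract[of r P] rP by (simp add: hull_inc)
  \<comment> \<open>Translated by \<open>-r\<close>, all of \<open>P\<close> spans only two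
    dimensions more than the ridge does. Hence one of the three added vectors depends on the others
    modulo \<open>span B\<close>.\<close>
  have "insert (p3 - r) (insert (p2 - r) (insert (p1 - r) B)) \<subseteq> (\<lambda>x. x - r) ` P"
    using pP R face_of_imp_subset B_def by blast
  then have "dim (insert (p3 - r) (insert (p2 - r) (insert (p1 - r) B))) \<le> dim ((\<lambda>x. x - r) ` P)"
    by (rule dim_subset)
  then consider "p1 - r \<in> span B" | "p2 - r \<in> span (insert (p1 - r) B)"
    | "p3 - r \<in> span (insert (p2 - r) (insert (p1 - r) B))"
    using dB dP R(3) by (auto simp: dim_insert split: if_splits)
  then show False
  proof cases
    case 1
    then show False using k s2 by fastforce
  next
    case 2
    then obtain c where "p2 - r - c *\<^sub>R (p1 - r) \<in> span B"
      by (auto simp: span_insert)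
    then have "a1 \<bullet> (p2 - r - c *\<^sub>R (p1 - r)) = 0" using k by blast
    then show False using s1 by (simp add: inner_diff_right)
  next
    case 3
    then obtain c d where cd: "p3 - r - c *\<^sub>R (p2 - r) - d *\<^sub>R (p1 - r) \<in> span B"
      by (auto simp: span_insert)
    have e: "a \<bullet> (p3 - r - c *\<^sub>R (p2 - r) - d *\<^sub>R (p1 - r)) = a \<bullet> (p3 - r) - c * (a \<bullet> (p2 - r)) - d * (a \<bullet> (p1 - r))" for a
      by (simp add: inner_diff_right)
    have "a1 \<bullet> (p3 - r) = c * (a1 \<bullet> (p2 - r))" "a2 \<bullet> (p3 - r) = d * (a2 \<bullet> (p1 - r))"
       "c * (a3 \<bullet> (p2 - r)) + d * (a3 \<bullet> (p1 - r)) = 0"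
      using k[OF cd] s1 s2 s3 e by (simp_all)
    then have "c > 0" "d > 0"
      using s1 s2 by (metis mult_less_0_iff not_less_iff_gr_or_eq)+
    then have "c * (a3 \<bullet> (p2 - r)) + d * (a3 \<bullet> (p1 - r)) < 0"
      using s3 by (simp add: add_neg_neg mult_pos_neg)
    then show False using \<open>c * (a3 \<bullet> (p2 - r)) + d * (a3 \<bullet> (p1 - r)) = 0\<close> by simp
  qed
qed

text \<open>A face is the intersection of the facets containing it. With no such facet this would be
  the whole space, with a single one the facet itself, and both have the wrong dimension.\<close>

lemma ridge_ge_two_facets:
  fixes P :: "'a::euclidean_space set"
  assumes P: "polytope P" and R: "R face_of P" "R \<noteq> {}" "aff_dim R = aff_dim P - 2"
  shows "2 \<le> card {F. F facet_of P \<and> R \<subseteq> F}"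
proof (rule ccontr)
  let ?\<F> = "{F. F facet_of P \<and> R \<subseteq> F}"
  assume "\<not> 2 \<le> card ?\<F>"
  moreover have fin: "finite ?\<F>"
    using finite_polytope_facets[OF P] by simp
  ultimately consider "?\<F> = {}" | F where "?\<F> = {F}"
    by (metis (no_types) card_0_eq card_1_singletonE less_2_cases not_less One_nat_def)
  moreover have eq: "R = \<Inter>?\<F>"
    using R by (intro face_of_polyhedron polytope_imp_polyhedron P) auto
  ultimately show False
  proof cases
    case 1
    then have "\<Inter>?\<F> = UNIV" by blast
    then have "R = UNIV" using eq by simp
    then show False using R aff_dim_subset[of P R] by auto
  next
    case 2
    then have "R = F" "F facet_of P" using eq by auto
    then show False using R by (auto simp: facet_of_def)
  qed
qed

lemma polytope_face_eq_hull_vertices: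
  fixes P :: "'a::euclidean_space set"
  assumes "polytope P" "K face_of P"
  shows "K = convex hull {w. w extreme_point_of P \<and> w \<in> K}"
proof -
  have "K = convex hull {w. w extreme_point_of K}"
    using assms face_of_polytope_polytope polytope_imp_compact polytope_imp_convex Krein_Milman_Minkowski by blast
  then show ?thesis by (simp add: extreme_point_of_face[OF assms(2)])
qed

lemma polytope_subset_halfspace_lt:
  fixes P :: "'a::euclidean_space set"
  assumes "polytope P" "K face_of P" "\<And>w. w extreme_point_of P \<Longrightarrow> w \<in> K \<Longrightarrow> a \<bullet> w < b"
  shows "K \<subseteq> {x. a \<bullet> x < b}"
proof -
  have "convex hull {w. w extreme_point_of P \<and> w \<in> K} \<subseteq> {x. a \<bullet> x < b}"
    using assms(3) by (intro hull_minimal convex_halfspace_lt) blast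
  then show ?thesis using polytope_face_eq_hull_vertices[OF assms(1,2)] by simp
qed

text \<open>A common relative interior point forces two faces to coincide, and such a point can be
  read off from the slice.\<close>

lemma slice_face_eqI:
  fixes P :: "'a::euclidean_space set"
  assumes "K face_of P" "K' face_of P" "rel_interior K \<inter> C \<noteq> {}"
    "rel_interior (K \<inter> C) = rel_interior K \<inter> C" "rel_interior (K' \<inter> C) = rel_interior K' \<inter> C"
    "K \<inter> C = K' \<inter> C"
  shows "K = K'"
proof -
  obtain z where "z \<in> rel_interior K" "z \<in> C" using assms(3) by blast
  then have "z \<in> rel_interior K \<inter> rel_interior K'" using assms(4-6) by auto
  then show ?thesis using face_of_eq[OF assms(1,2)] by blast
qed

section \<open>Truncating a vertex\<close>

text \<open>Serves both for truncating a vertex that lies in few facets and for the cut that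
  prepares a connected sum.\<close>

locale vertex_cut =
  fixes P :: "'a::euclidean_space set" and v a :: 'a and b :: real
  assumes poly: "polytope P" and vP: "v extreme_point_of P"
    and av: "b < a \<bullet> v"
    and others: "\<And>w. w extreme_point_of P \<Longrightarrow> w \<noteq> v \<Longrightarrow> a \<bullet> w < b"
begin

abbreviation "H \<equiv> {x. a \<bullet> x = b}"
abbreviation "Hle \<equiv> {x. a \<bullet> x \<le> b}"

lemma convP: "convex P" using poly polytope_imp_convex by blast

lemma face_below:
  assumes "K face_of P" "v \<notin> K"
  shows "K \<subseteq> {x. a \<bullet> x < b}"
proof (rule polytope_subset_halfspace_lt[OF poly assms(1)])
  fix w assume "w extreme_point_of P" "w \<in> K"
  then show "a \<bullet> w < b" using others assms(2) by (cases "w = v") auto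
qed

lemma face_has_below:
  assumes "K face_of P" "K \<noteq> {}" "K \<noteq> {v}"
  shows "\<exists>w\<in>K. a \<bullet> w < b"
proof (rule ccontr)
  assume "\<not> ?thesis"
  then have "{w. w extreme_point_of P \<and> w \<in> K} \<subseteq> {v}" using others by auto
  then have "convex hull {w. w extreme_point_of P \<and> w \<in> K} \<subseteq> {v}"
    by (simp add: subset_hull)
  then show False
    using polytope_face_eq_hull_vertices[OF poly assms(1)] assms by auto
qed

lemma face_crosses:
  assumes "K face_of P" "v \<in> K" "K \<noteq> {v}"
  shows "rel_interior K \<inter> H \<noteq> {}" "aff_dim (K \<inter> H) = aff_dim K - 1"
    "rel_interior (K \<inter> H) = rel_interior K \<inter> H"
proof -
  obtain w where w: "w \<in> K" "a \<bullet> w < b" using face_has_below assms by blast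
  have cK: "convex K" using assms face_of_imp_convex by blast
  show *: "rel_interior K \<inter> H \<noteq> {}"
    using rel_interior_meets_hyperplane[OF cK w(1) assms(2) w(2) av] .
  show "aff_dim (K \<inter> H) = aff_dim K - 1"
    using aff_dim_Int_hyperplane[OF cK *] w by auto
  show "rel_interior (K \<inter> H) = rel_interior K \<inter> H"
    by (rule convex_affine_rel_interior_Int[OF cK affine_hyperplane *])
qed

text \<open>The slice is a vertex figure of \<open>v\<close>. For surjectivity take a relative
  interior point \<open>z\<close> of a face of the slice and the face \<open>K\<close> of
  \<open>P\<close> with \<open>z\<close> in its relative interior: \<open>K\<close> contains
  \<open>v\<close>, since faces avoiding \<open>v\<close> lie strictly below the hyperplane.\<close>

lemma slice_faces_bij:
  "bij_betw (\<lambda>K. K \<inter> H) {K. K \<in> ifaces (Suc i) P \<and> v \<in> K} (ifaces i (P \<inter> H))"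
proof (rule bij_betwI')
  have ne: "K \<noteq> {v}" if "K \<in> ifaces (Suc i) P" for K
    using that by (auto simp: ifaces_def)
  fix K K' assume "K \<in> {K. K \<in> ifaces (Suc i) P \<and> v \<in> K}" "K' \<in> {K. K \<in> ifaces (Suc i) P \<and> v \<in> K}"
  then have K: "K face_of P" "v \<in> K" "K \<noteq> {v}" "K' face_of P" "v \<in> K'" "K' \<noteq> {v}"
    using ne by (auto simp: ifaces_def)
  show "K \<inter> H = K' \<inter> H \<longleftrightarrow> K = K'"
    using slice_face_eqI[OF K(1,4) face_crosses(1,3)[OF K(1-3)] face_crosses(3)[OF K(4-6)]] by blast
next
  fix K assume K: "K \<in> {K. K \<in> ifaces (Suc i) P \<and> v \<in> K}"
  then have *: "K face_of P" "v \<in> K" "K \<noteq> {v}" "aff_dim K = int (Suc i)" by (auto simp: ifaces_def)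
  show "K \<inter> H \<in> ifaces i (P \<inter> H)"
    using face_of_slice[OF *(1) affine_imp_convex[OF affine_hyperplane]] face_crosses(2)[OF *(1-3)] *(4)
    by (simp add: ifaces_def)
next
  fix T assume T: "T \<in> ifaces i (P \<inter> H)"
  then have Tf: "T face_of (P \<inter> H)" and "T \<noteq> {}" by (auto simp: ifaces_def)
  then obtain z where z: "z \<in> rel_interior T"
    using face_of_imp_convex rel_interior_eq_empty by blast
  then have zP: "z \<in> P" "a \<bullet> z = b"
    using rel_interior_subset face_of_imp_subset[OF Tf] by blast+
  obtain K where K: "K face_of P" "z \<in> rel_interior K" using exists_face_rel_interior[OF poly zP(1)] .
  have zK: "z \<in> K" using K rel_interior_subset by blast
  have vK: "v \<in> K" using face_below[OF K(1)] zK zP by force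
  have Kv: "K \<noteq> {v}" using zK zP av by force
  have "K \<inter> H face_of (P \<inter> H)"
    using face_of_slice[OF K(1) affine_imp_convex[OF affine_hyperplane]] .
  moreover have "z \<in> rel_interior (K \<inter> H)"
    using face_crosses(3)[OF K(1) vK Kv] K zP by simp
  ultimately have "T = K \<inter> H" using face_of_eq[OF Tf] z by blast
  moreover have "K \<in> ifaces (Suc i) P"
    using \<open>T = K \<inter> H\<close> face_crosses(2)[OF K(1) vK Kv] T K by (simp add: ifaces_def)
  ultimately show "\<exists>K\<in>{K. K \<in> ifaces (Suc i) P \<and> v \<in> K}. T = K \<inter> H" using vK by blast
qed

lemma f_num_slice: "f_num i (P \<inter> H) = card {K. K \<in> ifaces (Suc i) P \<and> v \<in> K}"
  unfolding f_num_eq_card by (rule sym[OF bij_betw_same_card[OF slice_faces_bij]])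

lemma slice_face_of: "P \<inter> H face_of (P \<inter> Hle)"
proof -
  have "(P \<inter> Hle) \<inter> H face_of (P \<inter> Hle)"
    by (intro face_of_Int_supporting_hyperplane_le convex_Int convP convex_halfspace_le) auto
  moreover have "(P \<inter> Hle) \<inter> H = P \<inter> H" by auto
  ultimately show ?thesis by simp
qed

text \<open>Apart from \<open>{v}\<close>, every nonempty face has a point strictly below the
  hyperplane, so cutting does not change its affine hull. The last clause recovers a face from its
  truncation, which gives injectivity when faces are counted.\<close>

lemma trunc_face:
  assumes "K face_of P" "K \<noteq> {}" "K \<noteq> {v}"
  shows "K \<inter> Hle face_of (P \<inter> Hle)" "affine hull (K \<inter> Hle) = affine hull K" "\<not> K \<inter> Hle \<subseteq> H"
    "K = affine hull (K \<inter> Hle) \<inter> P"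
proof -
  have cK: "convex K" using assms face_of_imp_convex by blast
  obtain w where w: "w \<in> K" "a \<bullet> w < b" using face_has_below assms by blast
  show "K \<inter> Hle face_of (P \<inter> Hle)" using face_of_slice[OF assms(1) convex_halfspace_le] .
  have "a \<noteq> 0" using av w by force
  then show eq: "affine hull (K \<inter> Hle) = affine hull K"
    using w by (intro affine_hull_convex_Int_nonempty_interior cK) (auto simp: interior_halfspace_le)
  show "\<not> K \<inter> Hle \<subseteq> H" using w by force
  show "K = affine hull (K \<inter> Hle) \<inter> P"
    unfolding eq by (rule face_of_imp_eq_affine_Int[OF convP assms(1)])
qed

text \<open>A face of the truncated polytope that is not contained in the cut has a relative
  interior point strictly below the hyperplane. The face of \<open>P\<close> with this point in its
  relative interior is then the one whose truncation it is.\<close>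

lemma trunc_ifaces:
  "ifaces i (P \<inter> Hle) = ifaces i (P \<inter> H) \<union> (\<lambda>K. K \<inter> Hle) ` (ifaces i P - {{v}})"
  (is "?L = ?A \<union> ?B")
proof
  show "?A \<union> ?B \<subseteq> ?L"
  proof (intro Un_least subsetI)
    fix T assume "T \<in> ?A" then show "T \<in> ?L"
      using face_of_trans[OF _ slice_face_of] by (auto simp: ifaces_def)
  next
    fix T assume "T \<in> ?B"
    then obtain K where K: "K face_of P" "aff_dim K = int i" "K \<noteq> {v}" "T = K \<inter> Hle"
      by (auto simp: ifaces_def)
    then have "K \<noteq> {}" by auto
    then have "aff_dim T = int i" "T face_of (P \<inter> Hle)"
      using trunc_face(1)[OF K(1) _ K(3)] aff_dim_affine_hull2[OF trunc_face(2)[OF K(1) _ K(3)]] K by auto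
    then show "T \<in> ?L" by (simp add: ifaces_def)
  qed
  show "?L \<subseteq> ?A \<union> ?B"
  proof
    fix T assume T: "T \<in> ?L"
    then have Tf: "T face_of (P \<inter> Hle)" and "T \<noteq> {}" and dT: "aff_dim T = int i" by (auto simp: ifaces_def)
    show "T \<in> ?A \<union> ?B"
    proof (cases "T \<subseteq> H")
      case True
      then have "T \<subseteq> P \<inter> H" using face_of_imp_subset[OF Tf] by blast
      then have "T face_of (P \<inter> H)" by (intro face_of_subset[OF Tf]) auto
      then show ?thesis using dT by (simp add: ifaces_def)
    next
      case False
      obtain z where z: "z \<in> rel_interior T"
        using Tf \<open>T \<noteq> {}\<close> face_of_imp_convex rel_interior_eq_empty by blast
      then have zT: "z \<in> T" using rel_interior_subset by blast
      then have zP: "z \<in> P" "a \<bullet> z \<le> b" using face_of_imp_subset[OF Tf] by auto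
      have "a \<bullet> z \<noteq> b"
      proof
        assume "a \<bullet> z = b"
        then have "T \<subseteq> P \<inter> H"
          using subset_of_face_of[OF slice_face_of face_of_imp_subset[OF Tf]] z zP by blast
        then show False using False by blast
      qed
      then have azb: "a \<bullet> z < b" using zP by simp
      obtain K where K: "K face_of P" "z \<in> rel_interior K" using exists_face_rel_interior[OF poly zP(1)] .
      have zK: "z \<in> K" using K rel_interior_subset by blast
      have Kv: "K \<noteq> {v}" and Kne: "K \<noteq> {}" using zK azb av by auto
      have "z \<in> interior Hle"
        using azb interior_maximal[of "{x. a \<bullet> x < b}" Hle] open_halfspace_lt[of a b] by force
      then have zr: "z \<in> rel_interior Hle" using interior_subset_rel_interior by blast
      have "rel_interior (K \<inter> Hle) = rel_interior K \<inter> rel_interior Hle"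
        using K zr face_of_imp_convex[OF K(1)] by (intro convex_rel_interior_inter_two) (auto simp: convex_halfspace_le)
      then have "T = K \<inter> Hle"
        using face_of_eq[OF Tf trunc_face(1)[OF K(1) Kne Kv]] z K zr by blast
      moreover have "aff_dim K = int i"
        using trunc_face(2)[OF K(1) Kne Kv] dT \<open>T = K \<inter> Hle\<close> by (metis aff_dim_affine_hull)
      ultimately show ?thesis using K Kv by (auto simp: ifaces_def)
    qed
  qed
qed

lemma polytope_slice: "polytope (P \<inter> H)" "polytope (P \<inter> Hle)"
  by (rule polytope_Int_polyhedron[OF poly polyhedron_hyperplane],
      rule polytope_Int_polyhedron[OF poly polyhedron_halfspace_le])

text \<open>The extra 1 on the left stands for the vertex \<open>v\<close>, the only face that
  disappears.\<close>

lemma f_num_trunc: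
  "f_num i (P \<inter> Hle) + (if i = 0 then 1 else 0) = f_num i P + f_num i (P \<inter> H)"
proof -
  have inj: "inj_on (\<lambda>K. K \<inter> Hle) (ifaces i P - {{v}})"
  proof (rule inj_onI)
    fix K K' assume "K \<in> ifaces i P - {{v}}" "K' \<in> ifaces i P - {{v}}" and eq: "K \<inter> Hle = K' \<inter> Hle"
    then have "K face_of P" "K \<noteq> {}" "K \<noteq> {v}" "K' face_of P" "K' \<noteq> {}" "K' \<noteq> {v}" by (auto simp: ifaces_def)
    then show "K = K'" using trunc_face(4)[of K] trunc_face(4)[of K'] eq by simp
  qed
  have "ifaces i (P \<inter> H) \<inter> (\<lambda>K. K \<inter> Hle) ` (ifaces i P - {{v}}) = {}"
  proof (rule ccontr)
    assume "\<not> ?thesis"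
    then obtain K where K: "K \<in> ifaces i P" "K \<noteq> {v}" "K \<inter> Hle face_of (P \<inter> H)" by (auto simp: ifaces_def)
    then have "K face_of P" "K \<noteq> {}" by (auto simp: ifaces_def)
    then show False using trunc_face(3)[of K] K face_of_imp_subset by blast
  qed
  then have "f_num i (P \<inter> Hle) = f_num i (P \<inter> H) + card (ifaces i P - {{v}})"
    unfolding f_num_eq_card trunc_ifaces
    using finite_ifaces[OF polytope_slice(1)] finite_ifaces[OF poly] card_image[OF inj]
    by (subst card_Un_disjoint) auto
  moreover have "card (ifaces i P - {{v}}) + (if i = 0 then 1 else 0) = f_num i P"
  proof (cases "i = 0")
    case True
    then have "{v} \<in> ifaces i P" using vP by (simp add: ifaces_def face_of_singleton)
    then have "Suc (card (ifaces i P - {{v}})) = card (ifaces i P)"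
      using True finite_ifaces[OF poly] by (intro card_Suc_Diff1) auto
    then show ?thesis using True by (simp add: f_num_eq_card)
  next
    case False
    then have "{v} \<notin> ifaces i P" by (auto simp: ifaces_def)
    then show ?thesis using False by (simp add: f_num_eq_card)
  qed
  ultimately show ?thesis by simp
qed

lemma apex_mem: "v \<in> P" using vP by (simp add: extreme_point_of_def)

lemma dims:
  assumes "P \<noteq> {v}"
  shows "aff_dim (P \<inter> Hle) = aff_dim P" "aff_dim (P \<inter> H) = aff_dim P - 1"
proof -
  have "P face_of P" "P \<noteq> {}" using convP face_of_refl apex_mem by auto
  then show "aff_dim (P \<inter> Hle) = aff_dim P" using trunc_face(2) assms by (metis aff_dim_affine_hull)
  show "aff_dim (P \<inter> H) = aff_dim P - 1"
    using face_crosses(2)[OF \<open>P face_of P\<close> apex_mem assms] .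
qed

end

text \<open>Extremality keeps \<open>v\<close> out of the convex hull of the other vertices. The
  signs are reversed because the separation theorem puts \<open>v\<close> on the lower side.\<close>

lemma exists_vertex_cut:
  fixes P :: "'a::euclidean_space set"
  assumes "polytope P" "v extreme_point_of P"
  obtains a b where "vertex_cut P v a b"
proof -
  let ?E = "{w. w extreme_point_of P \<and> w \<noteq> v}"
  have fin: "finite {w. w extreme_point_of P}"
    using assms finite_polyhedron_extreme_points polytope_imp_polyhedron by blast
  have cP: "convex P" using assms polytope_imp_convex by blast
  have E: "finite ?E" by (rule finite_subset[OF _ fin]) auto
  have "?E \<subseteq> P - {v}" by (auto simp: extreme_point_of_def)
  moreover have "convex (P - {v})"
    using assms(2) extreme_point_of_stillconvex[OF cP] by blast
  ultimately have "convex hull ?E \<subseteq> P - {v}" by (rule hull_minimal)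
  then have "v \<notin> convex hull ?E" by blast
  moreover have "closed (convex hull ?E)" "convex (convex hull ?E)"
    using E by (auto simp: compact_convex_hull compact_imp_closed finite_imp_compact)
  ultimately obtain a b where ab: "a \<bullet> v < b" "\<And>x. x \<in> convex hull ?E \<Longrightarrow> b < a \<bullet> x"
    using separating_hyperplane_closed_point[of "convex hull ?E" v] by metis
  have "vertex_cut P v (-a) (-b)"
  proof
    fix w assume "w extreme_point_of P" "w \<noteq> v"
    then have "w \<in> convex hull ?E" by (intro hull_inc) auto
    then show "- a \<bullet> w < - b" using ab by auto
  qed (use assms ab in auto)
  then show thesis using that by blast
qed

section \<open>Gluing along a common facet\<close>

text \<open>Only a segment that crosses the hyperplane could violate the face property. If it meets
  \<open>T\<close>, its crossing point lies in \<open>T\<close> and in the slice. Their intersection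
  is a proper face of the slice, hence a face of \<open>R\<close>, and this forces the far end point
  into the hyperplane.\<close>

lemma glue_side:
  fixes R :: "'a::euclidean_space set"
  assumes R: "convex R" and x: "x \<in> R" "a \<bullet> x < b" and y: "y \<in> R" "b < a \<bullet> y"
    and proper: "\<And>K. K face_of (R \<inter> {x. a \<bullet> x = b}) \<Longrightarrow> K \<noteq> R \<inter> {x. a \<bullet> x = b} \<Longrightarrow> K face_of R"
    and T: "T face_of (R \<inter> {x. a \<bullet> x \<le> b})" "T \<noteq> R \<inter> {x. a \<bullet> x \<le> b}" "T \<noteq> R \<inter> {x. a \<bullet> x = b}"
  shows "T face_of R"
proof -
  let ?A = "R \<inter> {x. a \<bullet> x \<le> b}" and ?G = "R \<inter> {x. a \<bullet> x = b}"
  have "a \<noteq> 0" using x y by force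
  have dA: "aff_dim ?A = aff_dim R"
    using x \<open>a \<noteq> 0\<close> by (intro aff_dim_convex_Int_nonempty_interior R) (auto simp: interior_halfspace_le)
  have dG: "aff_dim ?G = aff_dim R - 1"
    using aff_dim_Int_hyperplane[OF R rel_interior_meets_hyperplane[OF R x(1) y(1) x(2) y(2)]] x by auto
  have cA: "convex ?A" by (intro convex_Int R convex_halfspace_le)
  have GA: "?G face_of ?A"
  proof -
    have "?A \<inter> {x. a \<bullet> x = b} face_of ?A"
      by (intro face_of_Int_supporting_hyperplane_le cA) auto
    moreover have "?A \<inter> {x. a \<bullet> x = b} = ?G" by auto
    ultimately show ?thesis by simp
  qed
  \<comment> \<open>Otherwise the dimension of \<open>T\<close> would lie strictly between that of
    the slice and that of the half, which differ by one.\<close>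
  have KG: "T \<inter> ?G \<noteq> ?G"
  proof
    assume "T \<inter> ?G = ?G"
    then have "?G face_of T" using GA face_of_face[OF T(1)] by blast
    then have "aff_dim ?G < aff_dim T" using face_of_aff_dim_lt T face_of_imp_convex by metis
    moreover have "aff_dim T < aff_dim ?A" using face_of_aff_dim_lt[OF cA T(1,2)] .
    ultimately show False using dA dG by linarith
  qed
  have TGf: "T \<inter> ?G face_of ?G"
    using face_of_Int[OF T(1) GA] by (rule face_of_subset) auto
  then have KR: "T \<inter> ?G face_of R" using proper KG by blast
  have key: "u \<in> ?A \<and> w \<in> ?A" if uw: "u \<in> R" "w \<in> R" "z \<in> T" "z \<in> open_segment u w" for u w z
  proof (rule ccontr)
    assume n: "\<not> ?thesis"
    have za: "a \<bullet> z \<le> b" using that T(1) face_of_imp_subset by blast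
    obtain t where t: "0 < t" "t < 1" "z = (1 - t) *\<^sub>R u + t *\<^sub>R w"
      using uw(4) by (auto simp: in_segment)
    have az: "a \<bullet> z = (1 - t) * (a \<bullet> u) + t * (a \<bullet> w)"
      by (simp add: t inner_add_right)
    have aux: False if u: "u \<in> R" "a \<bullet> u \<le> b" and w: "w \<in> R" "b < a \<bullet> w" and z: "z \<in> open_segment u w" for u w
    proof -
      have "z \<in> R" using uw(3) T(1) face_of_imp_subset by blast
      show False
      proof (cases "a \<bullet> z = b")
        case True
        then have "z \<in> T \<inter> ?G" using uw(3) \<open>z \<in> R\<close> by blast
        then have "w \<in> T \<inter> ?G" using face_ofD[OF KR z] u w by blast
        then show False using w by simp
      next
        case False
        then have zb: "a \<bullet> z < b" using za by simp
        obtain c where c: "c \<in> closed_segment z w" "a \<bullet> c = b"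
          using connected_ivt_hyperplane[of "closed_segment z w" z w a b] zb w by auto
        have cR: "c \<in> R" using c \<open>z \<in> R\<close> w R closed_segment_subset by blast
        have "c \<noteq> z" "c \<noteq> w" using c zb w by auto
        then have "c \<in> open_segment z w" using c by (simp add: open_segment_def)
        obtain s where s: "0 < s" "s < 1" "z = (1 - s) *\<^sub>R u + s *\<^sub>R w" "u \<noteq> w"
          using z by (auto simp: in_segment)
        obtain r where r: "0 < r" "r < 1" "c = (1 - r) *\<^sub>R z + r *\<^sub>R w"
          using \<open>c \<in> open_segment z w\<close> by (auto simp: in_segment)
        \<comment> \<open>The position of \<open>c\<close> on the segment from \<open>u\<close> to
          \<open>w\<close>, so that \<open>1 - q = (1 - s) * (1 - r)\<close>. Since
          \<open>s < q\<close>, the point \<open>z\<close> lies between \<open>u\<close> and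
          \<open>c\<close>, at parameter \<open>s / q\<close>.\<close>
        define q where "q = s + r - s * r"
        have ceq: "c = (1 - q) *\<^sub>R u + q *\<^sub>R w"
          by (simp add: r(3) s(3) q_def algebra_simps)
        have q1: "1 - q = (1 - s) * (1 - r)" by (simp add: q_def algebra_simps)
        then have "q < 1" using s r by (metis diff_gt_0_iff_gt mult_pos_pos)
        have "s < q" using s r by (simp add: q_def algebra_simps)
        then have "c \<in> open_segment u w"
          using s ceq \<open>q < 1\<close> unfolding in_segment by (intro conjI exI[of _ q]) auto
        have zc: "z = (1 - s / q) *\<^sub>R u + (s / q) *\<^sub>R c"
        proof -
          have "(1 - s / q) *\<^sub>R u + (s / q) *\<^sub>R c = (1 - s / q + (s / q) * (1 - q)) *\<^sub>R u + (s / q * q) *\<^sub>R w"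
            by (simp add: ceq scaleR_add_right scaleR_add_left)
          moreover have "1 - s / q + (s / q) * (1 - q) = 1 - s" "s / q * q = s"
            using \<open>s < q\<close> s by (auto simp: field_simps)
          ultimately show ?thesis using s(3) by simp
        qed
        have "u \<noteq> c"
          using s \<open>s < q\<close> ceq by (metis \<open>c \<in> open_segment u w\<close> open_segment_def Diff_iff insertI1)
        then have "z \<in> open_segment u c"
          using zc s \<open>s < q\<close> unfolding in_segment by (intro conjI exI[of _ "s / q"]) auto
        then have "c \<in> T"
          using face_ofD[OF T(1)] u c cR uw(3) by blast
        then have "c \<in> T \<inter> ?G" using cR c by blast
        then have "w \<in> T \<inter> ?G"
          using face_ofD[OF KR \<open>c \<in> open_segment u w\<close>] u w by blast
        then show False using w by simp
      qed
    qed
    show False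
    proof (cases "a \<bullet> u \<le> b")
      case True
      then have "b < a \<bullet> w" using n uw(1,2) by auto
      then show False using aux[OF uw(1) True uw(2) _ uw(4)] by simp
    next
      case False
      show False
      proof (cases "a \<bullet> w \<le> b")
        case True
        then show False using aux[OF uw(2) True uw(1)] uw(4) False by (simp add: open_segment_commute)
      next
        case w: False
        have "(1 - t) * (a \<bullet> u) > (1 - t) * b" "t * (a \<bullet> w) > t * b"
          using t False w by auto
        then have "(1 - t) * (a \<bullet> u) + t * (a \<bullet> w) > (1 - t) * b + t * b" by linarith
        then have "(1 - t) * (a \<bullet> u) + t * (a \<bullet> w) > b" by (simp add: algebra_simps)
        then show False using az za by linarith
      qed
    qed
  qed
  show ?thesis
    unfolding face_of_def
  proof (intro conjI ballI impI)
    show "T \<subseteq> R" using T(1) face_of_imp_subset by blast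
    show "convex T" using T(1) face_of_imp_convex by blast
    fix u w z assume *: "u \<in> R" "w \<in> R" "z \<in> T" "z \<in> open_segment u w"
    then have "u \<in> T \<and> w \<in> T" using face_ofD[OF T(1) *(4)] key[OF *] by blast
    then show "u \<in> T" "w \<in> T" by blast+
  qed
qed

text \<open>One setting for stacking and for connected sums: the union comes first, and both pieces
  and their common facet are recovered as its slices.\<close>

locale glued =
  fixes R :: "'a::euclidean_space set" and a x0 y0 :: 'a and b :: real
  assumes poly: "polytope R" and x0: "x0 \<in> R" "a \<bullet> x0 < b" and y0: "y0 \<in> R" "b < a \<bullet> y0"
    and proper: "\<And>K. K face_of (R \<inter> {x. a \<bullet> x = b}) \<Longrightarrow> K \<noteq> R \<inter> {x. a \<bullet> x = b} \<Longrightarrow> K face_of R"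
begin

abbreviation "A \<equiv> R \<inter> {x. a \<bullet> x \<le> b}"
abbreviation "B \<equiv> R \<inter> {x. a \<bullet> x \<ge> b}"
abbreviation "G \<equiv> R \<inter> {x. a \<bullet> x = b}"

lemma convR: "convex R" using poly polytope_imp_convex by blast

lemma a_nz: "a \<noteq> 0" using x0 y0 by force

lemma dims: "aff_dim A = aff_dim R" "aff_dim B = aff_dim R" "aff_dim G = aff_dim R - 1"
proof -
  show "aff_dim A = aff_dim R"
    using x0 a_nz by (intro aff_dim_convex_Int_nonempty_interior convR) (auto simp: interior_halfspace_le)
  show "aff_dim B = aff_dim R"
    using y0 a_nz by (intro aff_dim_convex_Int_nonempty_interior convR) (auto simp: interior_halfspace_ge)
  show "aff_dim G = aff_dim R - 1"
    using aff_dim_Int_hyperplane[OF convR rel_interior_meets_hyperplane[OF convR x0(1) y0(1) x0(2) y0(2)]] x0 by auto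
qed

lemma G_face: "G face_of A" "G face_of B"
proof -
  have "A \<inter> {x. a \<bullet> x = b} face_of A"
    by (intro face_of_Int_supporting_hyperplane_le convex_Int convR convex_halfspace_le) auto
  moreover have "A \<inter> {x. a \<bullet> x = b} = G" by auto
  ultimately show "G face_of A" by simp
  have "B \<inter> {x. a \<bullet> x = b} face_of B"
    by (intro face_of_Int_supporting_hyperplane_ge convex_Int convR convex_halfspace_ge) auto
  moreover have "B \<inter> {x. a \<bullet> x = b} = G" by auto
  ultimately show "G face_of B" by simp
qed

lemma face_of_A:
  assumes "T face_of A" "T \<noteq> A" "T \<noteq> G"
  shows "T face_of R"
proof (rule glue_side[where a=a and b=b and x=x0 and y=y0])
  show "K face_of R" if "K face_of G" "K \<noteq> G" for K by (rule proper[OF that])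
qed (rule convR x0 y0 assms)+

lemma face_of_B: "T face_of B \<Longrightarrow> T \<noteq> B \<Longrightarrow> T \<noteq> G \<Longrightarrow> T face_of R"
  using glue_side[OF convR y0(1) _ x0(1), of "-a" "-b" T] y0 x0 proper by simp

text \<open>A proper face cannot cross the hyperplane. The crossing point would lie in
  \<open>T \<inter> G\<close>, a proper face of \<open>G\<close> because \<open>G\<close> meets the
  relative interior of \<open>R\<close>. Hence \<open>T \<inter> G\<close> is a face of
  \<open>R\<close> and pulls the end points into the hyperplane.\<close>

lemma face_of_side:
  assumes "T face_of R" "T \<noteq> R"
  shows "T \<noteq> G \<and> (T face_of A \<and> T \<noteq> A \<or> T face_of B \<and> T \<noteq> B)"
proof -
  have TR: "T \<subseteq> R" using assms face_of_imp_subset by blast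
  have rG: "rel_interior R \<inter> G \<noteq> {}"
    using rel_interior_meets_hyperplane[OF convR x0(1) y0(1) x0(2) y0(2)] rel_interior_subset[of R] by blast
  have nG: "\<not> G \<subseteq> T"
    using face_of_disjoint_rel_interior[OF assms] rG by blast
  have dT: "aff_dim T < aff_dim R" using face_of_aff_dim_lt[OF convR assms] .
  show ?thesis
  proof (cases "T \<subseteq> A \<or> T \<subseteq> B")
    case True
    then show ?thesis
      using face_of_subset[OF assms(1), of A] face_of_subset[OF assms(1), of B] nG dT dims by auto
  next
    case False
    then obtain u w where u: "u \<in> T" "b < a \<bullet> u" and w: "w \<in> T" "a \<bullet> w < b"
      using TR by fastforce
    have cT: "convex T" using assms face_of_imp_convex by blast
    obtain z where z: "z \<in> closed_segment w u" "a \<bullet> z = b"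
      using connected_ivt_hyperplane[of "closed_segment w u" w u a b] u w by auto
    then have zT: "z \<in> T" using cT u w closed_segment_subset by blast
    have "z \<in> open_segment w u" using z u w by (auto simp: open_segment_def)
    have "T \<inter> G = T \<inter> {x. a \<bullet> x = b}" using TR by blast
    then have "T \<inter> G face_of G"
      using face_of_slice[OF assms(1) affine_imp_convex[OF affine_hyperplane], of a b] by simp
    moreover have "T \<inter> G \<noteq> G" using nG by blast
    ultimately have "T \<inter> G face_of R" by (rule proper)
    then have "u \<in> T \<inter> G"
      using face_ofD[OF _ \<open>z \<in> open_segment w u\<close>] u w TR zT z by blast
    then show ?thesis using u by simp
  qed
qed

lemma ifaces_eq:
  assumes "int i < aff_dim R"
  shows "ifaces i R = (ifaces i A - {G}) \<union> (ifaces i B - {G})"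
proof (intro equalityI subsetI)
  fix T assume "T \<in> ifaces i R"
  then have "T face_of R" "T \<noteq> R" "aff_dim T = int i" using assms by (auto simp: ifaces_def)
  then show "T \<in> (ifaces i A - {G}) \<union> (ifaces i B - {G})" using face_of_side[of T] by (auto simp: ifaces_def)
next
  fix T assume "T \<in> (ifaces i A - {G}) \<union> (ifaces i B - {G})"
  then have T: "aff_dim T = int i" "T \<noteq> G" "T face_of A \<or> T face_of B" by (auto simp: ifaces_def)
  then have "T \<noteq> A" "T \<noteq> B" using dims assms by auto
  then show "T \<in> ifaces i R" using T face_of_A face_of_B by (auto simp: ifaces_def)
qed

lemma ifaces_Int: "ifaces i A \<inter> ifaces i B = ifaces i G"
proof (intro equalityI subsetI)
  fix T assume "T \<in> ifaces i A \<inter> ifaces i B"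
  then have T: "T face_of A" "T face_of B" "aff_dim T = int i" by (auto simp: ifaces_def)
  then have "T \<subseteq> G" using face_of_imp_subset[OF T(1)] face_of_imp_subset[OF T(2)] by force
  then have "T face_of G" by (intro face_of_subset[OF T(1)]) auto
  then show "T \<in> ifaces i G" using T by (simp add: ifaces_def)
next
  fix T assume "T \<in> ifaces i G"
  then show "T \<in> ifaces i A \<inter> ifaces i B"
    using face_of_trans[OF _ G_face(1)] face_of_trans[OF _ G_face(2)] by (auto simp: ifaces_def)
qed

lemma polytopes: "polytope A" "polytope B" "polytope G"
proof -
  show "polytope A" by (rule polytope_Int_polyhedron[OF poly polyhedron_halfspace_le])
  show "polytope B" by (rule polytope_Int_polyhedron[OF poly polyhedron_halfspace_ge])
  show "polytope G" by (rule polytope_Int_polyhedron[OF poly polyhedron_hyperplane])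
qed

lemma f_num_glue:
  assumes "int i < aff_dim R - 1"
  shows "f_num i R + f_num i G = f_num i A + f_num i B"
proof -
  have "G \<notin> ifaces i A" "G \<notin> ifaces i B" using assms dims by (auto simp: ifaces_def)
  then have "ifaces i R = ifaces i A \<union> ifaces i B" using ifaces_eq[of i] assms by auto
  then show ?thesis
    unfolding f_num_eq_card using card_Un_Int[OF finite_ifaces[OF polytopes(1)] finite_ifaces[OF polytopes(2)], of i i] ifaces_Int[of i]
    by simp
qed

text \<open>In facet dimension the common facet \<open>G\<close> is counted once on each side and is
  no face of the union, hence the 2.\<close>

lemma f_num_glue_facets:
  assumes "int i = aff_dim R - 1"
  shows "f_num i R + 2 = f_num i A + f_num i B"
proof -
  have i: "int i < aff_dim R" using assms by simp
  have G: "G \<in> ifaces i A" "G \<in> ifaces i B" using assms dims G_face by (auto simp: ifaces_def)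
  have "ifaces i G \<subseteq> {G}"
  proof
    fix T assume "T \<in> ifaces i G"
    then have "T face_of G" "aff_dim T = aff_dim G" using assms dims by (auto simp: ifaces_def)
    then show "T \<in> {G}" using face_of_aff_dim_lt[of G T] polytopes polytope_imp_convex by fastforce
  qed
  then have dis: "(ifaces i A - {G}) \<inter> (ifaces i B - {G}) = {}" using ifaces_Int[of i] by blast
  have "f_num i R = card (ifaces i A - {G}) + card (ifaces i B - {G})"
    unfolding f_num_eq_card ifaces_eq[OF i]
    by (intro card_Un_disjoint dis finite_Diff finite_ifaces polytopes)
  moreover have "Suc (card (ifaces i A - {G})) = card (ifaces i A)" "Suc (card (ifaces i B - {G})) = card (ifaces i B)"
    by (intro card_Suc_Diff1 finite_ifaces polytopes G)+
  ultimately show ?thesis unfolding f_num_eq_card by simp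
qed

end

text \<open>A segment from one piece to the other crosses the hyperplane inside \<open>W\<close>,
  hence in a point that both pieces share, and there it splits into two segments within convex
  sets.\<close>

lemma convex_cap_Un:
  fixes W :: "'a::euclidean_space set"
  assumes W: "convex W" and B: "convex B" "B \<subseteq> {x. a \<bullet> x \<ge> b}" "B \<inter> {x. a \<bullet> x = b} = W \<inter> {x. a \<bullet> x = b}" "B \<subseteq> W"
  shows "convex ((W \<inter> {x. a \<bullet> x \<le> b}) \<union> B)"
proof -
  let ?A = "W \<inter> {x. a \<bullet> x \<le> b}"
  have cA: "convex ?A" by (intro convex_Int W convex_halfspace_le)
  have mixed: "closed_segment x y \<subseteq> ?A \<union> B" if x: "x \<in> ?A" and y: "y \<in> B" for x y
  proof -
    obtain c where c: "c \<in> closed_segment x y" "a \<bullet> c = b"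
      using connected_ivt_hyperplane[of "closed_segment x y" x y a b] x y B by auto
    have "c \<in> W" using c x y B W closed_segment_subset by blast
    then have "c \<in> ?A" "c \<in> B" using c B by auto
    then have "closed_segment x c \<subseteq> ?A" "closed_segment c y \<subseteq> B"
      using closed_segment_subset[OF x _ cA, of c] closed_segment_subset[OF _ y B(1), of c] by blast+
    then show ?thesis using Un_closed_segment[OF c(1)] by blast
  qed
  show ?thesis
    unfolding convex_contains_segment
  proof (intro ballI)
    fix x y assume "x \<in> ?A \<union> B" "y \<in> ?A \<union> B"
    then consider "x \<in> ?A" "y \<in> ?A" | "x \<in> B" "y \<in> B" | "x \<in> ?A" "y \<in> B" | "x \<in> B" "y \<in> ?A" by blast
    then show "closed_segment x y \<subseteq> ?A \<union> B"
    proof cases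
      case 1 then show ?thesis using closed_segment_subset[OF _ _ cA] by blast
    next
      case 2 then show ?thesis using closed_segment_subset[OF _ _ B(1)] by blast
    next
      case 3 then show ?thesis by (rule mixed)
    next
      case 4 then show ?thesis using mixed[of y x] by (simp add: closed_segment_commute)
    qed
  qed
qed

text \<open>A segment through a proper face of the slice cannot start in \<open>B\<close> off the hyperplane: its
  points would be interior to \<open>W\<close>, whereas the slice's proper faces lie on the boundary of \<open>W\<close>.\<close>

lemma proper_face_cap_Un:
  fixes W :: "'a::euclidean_space set"
  assumes W: "convex W" and B: "B \<subseteq> {x. a \<bullet> x \<ge> b}"
    and int: "B - {x. a \<bullet> x = b} \<subseteq> interior W" "g \<in> interior W" "a \<bullet> g = b" "B \<subseteq> W"
    and K: "K face_of (W \<inter> {x. a \<bullet> x = b})" "K \<noteq> W \<inter> {x. a \<bullet> x = b}"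
  shows "K face_of ((W \<inter> {x. a \<bullet> x \<le> b}) \<union> B)"
proof -
  let ?A = "W \<inter> {x. a \<bullet> x \<le> b}" and ?G = "W \<inter> {x. a \<bullet> x = b}"
  have "rel_interior ?G = interior W \<inter> {x. a \<bullet> x = b}"
    using int by (intro rel_interior_convex_Int_affine W affine_hyperplane) auto
  then have Kint: "K \<inter> interior W = {}"
    using face_of_disjoint_rel_interior[OF K] face_of_imp_subset[OF K(1)] by blast
  have GA: "?G face_of ?A"
  proof -
    have "?A \<inter> {x. a \<bullet> x = b} face_of ?A"
      by (intro face_of_Int_supporting_hyperplane_le convex_Int W convex_halfspace_le) auto
    moreover have "?A \<inter> {x. a \<bullet> x = b} = ?G" by auto
    ultimately show ?thesis by simp
  qed
  have KA: "K face_of ?A" using face_of_trans[OF K(1) GA] .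
  have inA: "u \<in> ?A" if "u \<in> ?A \<union> B" "w \<in> ?A \<union> B" "z \<in> K" "z \<in> open_segment u w" for u w z
  proof (rule ccontr)
    assume "u \<notin> ?A"
    then have "u \<in> interior W" using that int by auto
    moreover have "w \<in> closure W" using that int closure_subset by blast
    ultimately have "z \<in> interior W"
      using in_interior_closure_convex_segment[OF W, of u w] that by blast
    then show False using Kint that by blast
  qed
  show ?thesis
    unfolding face_of_def
  proof (intro conjI ballI impI)
    show "K \<subseteq> ?A \<union> B" using face_of_imp_subset[OF KA] by blast
    show "convex K" using face_of_imp_convex[OF KA] .
    fix u w z assume *: "u \<in> ?A \<union> B" "w \<in> ?A \<union> B" "z \<in> K" "z \<in> open_segment u w"
    then have "u \<in> ?A" "w \<in> ?A" using inA[OF *] inA[OF *(2,1,3)] open_segment_commute by metis+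
    then show "u \<in> K" "w \<in> K" using face_ofD[OF KA *(4)] * by blast+
  qed
qed

section \<open>Pyramids and stacking\<close>

lemma pyramid_above:
  fixes K :: "'a::euclidean_space set"
  assumes K: "convex K" "K \<subseteq> {y. a \<bullet> y = b}" and x: "b < a \<bullet> x"
  shows "convex hull (insert x K) \<subseteq> {y. a \<bullet> y \<ge> b}"
    and "convex hull (insert x K) \<inter> {y. a \<bullet> y = b} = K"
proof -
  show "convex hull (insert x K) \<subseteq> {y. a \<bullet> y \<ge> b}"
    using K x by (intro hull_minimal convex_halfspace_ge) auto
  show "convex hull (insert x K) \<inter> {y. a \<bullet> y = b} = K"
  proof (intro equalityI subsetI)
    fix z assume z: "z \<in> convex hull (insert x K) \<inter> {y. a \<bullet> y = b}"
    then have K0: "K \<noteq> {}" using x by auto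
    then obtain u y where zu: "0 \<le> u" "u \<le> 1" "y \<in> K" "z = (1 - u) *\<^sub>R x + u *\<^sub>R y"
      using z by (auto simp: convex_hull_insert_alt hull_same[of convex K] K(1))
    have "a \<bullet> z = (1 - u) * (a \<bullet> x) + u * b" using zu K(2) by (auto simp: inner_add_right)
    then have "(1 - u) * (a \<bullet> x - b) = 0" using z by (simp add: algebra_simps)
    then have "u = 1" using x by simp
    then show "z \<in> K" using zu by simp
  next
    fix z assume "z \<in> K"
    then show "z \<in> convex hull (insert x K) \<inter> {y. a \<bullet> y = b}" using K hull_inc[of z "insert x K"] by auto
  qed
qed

lemma polytope_pyramid: "polytope F \<Longrightarrow> polytope (convex hull (insert x F))"
proof -
  assume "polytope F"
  then obtain V where "finite V" "F = convex hull V" by (auto simp: polytope_def)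
  then have "convex hull (insert x F) = convex hull (insert x V)" using hull_insert[of convex x V] by simp
  then show ?thesis using \<open>finite V\<close> polytope_convex_hull[of "insert x V"] by simp
qed

lemma polytope_Un_convex:
  assumes "polytope A" "polytope B" "convex (A \<union> B)"
  shows "polytope (A \<union> B)"
proof -
  obtain V W where V: "finite V" "A = convex hull V" and W: "finite W" "B = convex hull W"
    using assms by (auto simp: polytope_def)
  have "A \<union> B = convex hull (V \<union> W)"
  proof
    show "A \<union> B \<subseteq> convex hull (V \<union> W)"
      unfolding V W by (intro Un_least hull_mono) auto
    show "convex hull (V \<union> W) \<subseteq> A \<union> B"
      using hull_subset[of V convex] hull_subset[of W convex] assms(3) V W by (intro hull_minimal) auto
  qed
  then show ?thesis using V W polytope_convex_hull[of "V \<union> W"] by simp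
qed

lemma pyramid_face_iff:
  fixes F :: "'a::euclidean_space set"
  assumes F: "polytope F" and x: "x \<notin> affine hull F"
  shows "T face_of (convex hull (insert x F)) \<longleftrightarrow>
    T face_of F \<or> (\<exists>K. K face_of F \<and> T = convex hull (insert x K))"
proof -
  obtain S where S: "finite S" "F = convex hull S" using F by (auto simp: polytope_def)
  have "x \<notin> affine hull S" using x S by simp
  from face_of_convex_hull_insert_eq[OF S(1) this, of T] show ?thesis
    using S(2) hull_insert[of convex x S] by simp
qed

lemma aff_dim_pyramid:
  fixes F :: "'a::euclidean_space set"
  assumes "x \<notin> affine hull F" "K \<subseteq> F"
  shows "aff_dim (convex hull (insert x K)) = aff_dim K + 1"
proof -
  have "x \<notin> affine hull K" using assms hull_mono by blast
  then show ?thesis by (simp add: aff_dim_convex_hull aff_dim_insert)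
qed

text \<open>If a point of the intersection gave the apex positive weight, solving for the apex would
  put it into the affine hull of the base. This makes the passage from base face to pyramid
  injective.\<close>

lemma pyramid_Int_affine_hull:
  fixes F :: "'a::euclidean_space set"
  assumes "x \<notin> affine hull F" "K \<subseteq> F" "convex K"
  shows "convex hull (insert x K) \<inter> affine hull F = K"
proof (intro equalityI subsetI)
  fix z assume z: "z \<in> convex hull (insert x K) \<inter> affine hull F"
  show "z \<in> K"
  proof (cases "K = {}")
    case True then show ?thesis using z assms by auto
  next
    case False
    then obtain u y where zu: "0 \<le> u" "u \<le> 1" "y \<in> K" "z = (1 - u) *\<^sub>R x + u *\<^sub>R y"
      using z by (auto simp: convex_hull_insert_alt hull_same[of convex K] assms(3))
    have y: "y \<in> affine hull F" using zu(3) assms(2) by (auto intro: hull_inc)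
    show ?thesis
    proof (cases "u = 1")
      case True then show ?thesis using zu by simp
    next
      case False
      have "x = (1 / (1 - u)) *\<^sub>R z + (- u / (1 - u)) *\<^sub>R y"
      proof -
        have "(1 / (1 - u)) *\<^sub>R z = x + (u / (1 - u)) *\<^sub>R y"
          using False zu(4) by (simp add: scaleR_add_right)
        then show ?thesis by simp
      qed
      moreover have "1 / (1 - u) + (- u / (1 - u)) = 1" using False by (simp add: field_simps)
      ultimately have "x \<in> affine hull F"
        using mem_affine[OF affine_affine_hull, of z F y "1 / (1 - u)" "- u / (1 - u)"] z y by auto
      then show ?thesis using assms by blast
    qed
  qed
next
  fix z assume "z \<in> K"
  then show "z \<in> convex hull (insert x K) \<inter> affine hull F"
    using hull_inc[of z "insert x K" convex] hull_inc[of z F affine] assms by auto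
qed

lemma ifaces_pyramid:
  fixes F :: "'a::euclidean_space set"
  assumes F: "polytope F" and x: "x \<notin> affine hull F"
  shows "ifaces 0 (convex hull (insert x F)) = insert {x} (ifaces 0 F)"
    and "ifaces (Suc i) (convex hull (insert x F)) = ifaces (Suc i) F \<union> (\<lambda>K. convex hull (insert x K)) ` ifaces i F"
proof -
  have dim: "aff_dim (convex hull (insert x K)) = aff_dim K + 1" if "K face_of F" for K
    using aff_dim_pyramid[OF x face_of_imp_subset[OF that]] .
  show "ifaces 0 (convex hull (insert x F)) = insert {x} (ifaces 0 F)"
  proof (intro equalityI subsetI)
    fix T assume T: "T \<in> ifaces 0 (convex hull (insert x F))"
    show "T \<in> insert {x} (ifaces 0 F)"
    proof (cases "T face_of F")
      case True then show ?thesis using T by (simp add: ifaces_def)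
    next
      case False
      then obtain K where K: "K face_of F" "T = convex hull (insert x K)"
        using T pyramid_face_iff[OF F x] by (auto simp: ifaces_def)
      \<comment> \<open>The apex arises as the pyramid over the empty face.\<close>
      then have "aff_dim K = -1" using dim T by (auto simp: ifaces_def)
      then have "K = {}" using aff_dim_empty by blast
      then show ?thesis using K by simp
    qed
  next
    fix T assume "T \<in> insert {x} (ifaces 0 F)"
    then show "T \<in> ifaces 0 (convex hull (insert x F))"
      using pyramid_face_iff[OF F x, of T] empty_face_of[of F] by (auto simp: ifaces_def)
  qed
  show "ifaces (Suc i) (convex hull (insert x F)) = ifaces (Suc i) F \<union> (\<lambda>K. convex hull (insert x K)) ` ifaces i F"
    (is "?L = ?R")
  proof (intro equalityI subsetI)
    fix T assume T: "T \<in> ?L"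
    show "T \<in> ?R"
    proof (cases "T face_of F")
      case True then show ?thesis using T by (simp add: ifaces_def)
    next
      case False
      then obtain K where K: "K face_of F" "T = convex hull (insert x K)"
        using T pyramid_face_iff[OF F x] by (auto simp: ifaces_def)
      then have "aff_dim K = int i" using dim T by (auto simp: ifaces_def)
      then show ?thesis using K by (auto simp: ifaces_def)
    qed
  next
    fix T assume "T \<in> ?R"
    then show "T \<in> ?L"
      using pyramid_face_iff[OF F x, of T] dim by (auto simp: ifaces_def)
  qed
qed

lemma f_num_pyramid:
  fixes F :: "'a::euclidean_space set"
  assumes F: "polytope F" and x: "x \<notin> affine hull F"
  shows "f_num 0 (convex hull (insert x F)) = f_num 0 F + 1"
    and "f_num (Suc i) (convex hull (insert x F)) = f_num (Suc i) F + f_num i F"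
proof -
  have xF: "x \<notin> F" using x hull_inc by metis
  then have "{x} \<notin> ifaces 0 F" using face_of_imp_subset by (auto simp: ifaces_def)
  then show "f_num 0 (convex hull (insert x F)) = f_num 0 F + 1"
    unfolding f_num_eq_card ifaces_pyramid(1)[OF F x] using finite_ifaces[OF F] by simp
  have "inj_on (\<lambda>K. convex hull (insert x K)) (ifaces i F)"
  proof (rule inj_onI)
    fix K K' assume "K \<in> ifaces i F" "K' \<in> ifaces i F" and eq: "convex hull (insert x K) = convex hull (insert x K')"
    then have K: "K face_of F" "K' face_of F" by (auto simp: ifaces_def)
    have 1: "convex hull (insert x K) \<inter> affine hull F = K"
      by (rule pyramid_Int_affine_hull[OF x face_of_imp_subset[OF K(1)] face_of_imp_convex[OF K(1)]])
    have 2: "convex hull (insert x K') \<inter> affine hull F = K'"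
      by (rule pyramid_Int_affine_hull[OF x face_of_imp_subset[OF K(2)] face_of_imp_convex[OF K(2)]])
    show "K = K'" using 1 unfolding eq 2 by (rule sym)
  qed
  moreover have "ifaces (Suc i) F \<inter> (\<lambda>K. convex hull (insert x K)) ` ifaces i F = {}"
  proof -
    have "x \<in> convex hull (insert x K)" for K by (simp add: hull_inc)
    moreover have "x \<notin> T" if "T \<in> ifaces (Suc i) F" for T
      using that xF face_of_imp_subset by (auto simp: ifaces_def)
    ultimately show ?thesis by blast
  qed
  ultimately show "f_num (Suc i) (convex hull (insert x F)) = f_num (Suc i) F + f_num i F"
    unfolding f_num_eq_card ifaces_pyramid(2)[OF F x] using finite_ifaces[OF F]
    by (simp add: card_Un_disjoint card_image)
qed

text \<open>The last two assumptions take the place of the usual condition that the apex is beyond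
  \<open>F\<close> and beneath all other facets; they are exactly what gluing along \<open>F\<close>
  requires.\<close>

locale stacked =
  fixes P F :: "'a::euclidean_space set" and x a :: 'a and b :: real
  assumes poly: "polytope P" and facet: "F facet_of P"
    and below: "P \<subseteq> {y. a \<bullet> y \<le> b}" and F_eq: "F = P \<inter> {y. a \<bullet> y = b}" and above: "b < a \<bullet> x"
    and convex_Un: "convex (P \<union> convex hull (insert x F))"
    and proper: "\<And>K. K face_of F \<Longrightarrow> K \<noteq> F \<Longrightarrow> K face_of (P \<union> convex hull (insert x F))"
begin

definition "pyr = convex hull (insert x F)"
definition "R = P \<union> pyr"

lemma polyF: "polytope F" using poly facet face_of_polytope_polytope facet_of_imp_face_of by blast

lemma convF: "convex F" using polyF polytope_imp_convex by blast

lemma F_sub: "F \<subseteq> {y. a \<bullet> y = b}" using F_eq by blast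

lemma x_notin: "x \<notin> affine hull F"
proof -
  have "affine hull F \<subseteq> {y. a \<bullet> y = b}" using F_sub by (intro hull_minimal affine_hyperplane)
  then show ?thesis using above by force
qed

lemma x_notin_P: "x \<notin> P" using below above by force

lemma polyR: "polytope R"
  unfolding R_def pyr_def by (rule polytope_Un_convex[OF poly polytope_pyramid[OF polyF] convex_Un])

lemma R_slices: "R \<inter> {y. a \<bullet> y \<le> b} = P" "R \<inter> {y. a \<bullet> y \<ge> b} = pyr" "R \<inter> {y. a \<bullet> y = b} = F"
proof -
  have 1: "pyr \<subseteq> {y. a \<bullet> y \<ge> b}" "pyr \<inter> {y. a \<bullet> y = b} = F"
    using pyramid_above[OF convF F_sub above] by (simp_all add: pyr_def)
  have F: "F \<subseteq> pyr" unfolding pyr_def using hull_subset[of "insert x F" convex] by blast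
  have "pyr \<inter> {y. a \<bullet> y \<le> b} \<subseteq> F"
  proof
    fix y assume "y \<in> pyr \<inter> {y. a \<bullet> y \<le> b}"
    then have "y \<in> pyr \<inter> {y. a \<bullet> y = b}" using 1(1) by force
    then show "y \<in> F" using 1 by simp
  qed
  then show "R \<inter> {y. a \<bullet> y \<le> b} = P" using below F_eq unfolding R_def by blast
  have "P \<inter> {y. a \<bullet> y \<ge> b} \<subseteq> F" using below F_eq by force
  then show "R \<inter> {y. a \<bullet> y \<ge> b} = pyr" using 1(1) F unfolding R_def by blast
  show "R \<inter> {y. a \<bullet> y = b} = F" using 1 F_eq unfolding R_def by blast
qed

lemma glued_R: "\<exists>x0. glued R a x0 x b"
proof -
  have "F \<noteq> P" using facet by auto
  then obtain x0 where "x0 \<in> P" "a \<bullet> x0 < b" using below F_eq by force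
  then have "glued R a x0 x b"
    using polyR above proper hull_inc[of x "insert x F" convex]
    by unfold_locales (auto simp: R_slices(3), auto simp: R_def pyr_def)
  then show ?thesis by blast
qed

lemma aff_dim_R: "aff_dim R = aff_dim P"
proof -
  obtain x0 where "glued R a x0 x b" using glued_R by blast
  then show ?thesis using glued.dims(1)[of R a x0 x b] R_slices by simp
qed

lemma aff_dim_F: "aff_dim F = aff_dim P - 1" using facet by (simp add: facet_of_def)

text \<open>In facet dimension gluing loses \<open>F\<close> twice, once as facet of
  \<open>P\<close> and once as base of the pyramid; the base is also the one face that the pyramid
  has besides those over facets of \<open>F\<close>. The net loss is one.\<close>

lemma f_num_R:
  assumes "2 \<le> aff_dim P"
  shows "f_num 0 R = f_num 0 P + 1"
    and "int (Suc i) < aff_dim P - 1 \<Longrightarrow> f_num (Suc i) R = f_num (Suc i) P + f_num i F"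
    and "int (Suc i) = aff_dim P - 1 \<Longrightarrow> f_num (Suc i) R + 1 = f_num (Suc i) P + f_num i F"
proof -
  obtain x0 where gl: "glued R a x0 x b" using glued_R by blast
  note py = f_num_pyramid[OF polyF x_notin, folded pyr_def]
  have 1: "int i < aff_dim P - 1 \<Longrightarrow> f_num i R + f_num i F = f_num i P + f_num i pyr" for i
    using glued.f_num_glue[OF gl, of i] R_slices aff_dim_R by simp
  have 2: "int i = aff_dim P - 1 \<Longrightarrow> f_num i R + 2 = f_num i P + f_num i pyr" for i
    using glued.f_num_glue_facets[OF gl, of i] R_slices aff_dim_R by simp
  show "f_num 0 R = f_num 0 P + 1" using 1[of 0] py(1) assms by simp
  show "f_num (Suc i) R = f_num (Suc i) P + f_num i F" if "int (Suc i) < aff_dim P - 1"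
    using 1[OF that] py(2)[of i] by simp
  show "f_num (Suc i) R + 1 = f_num (Suc i) P + f_num i F" if i: "int (Suc i) = aff_dim P - 1"
  proof -
    have "ifaces (Suc i) F = {F}"
    proof (intro equalityI subsetI)
      fix T assume "T \<in> ifaces (Suc i) F"
      then have "T face_of F" "aff_dim T = aff_dim F" using i aff_dim_F by (auto simp: ifaces_def)
      then show "T \<in> {F}" using face_of_aff_dim_lt[OF convF, of T] by auto
    next
      fix T assume "T \<in> {F}"
      then show "T \<in> ifaces (Suc i) F" using i aff_dim_F convF by (auto simp: ifaces_def face_of_refl)
    qed
    then have "f_num (Suc i) F = 1" by (simp add: f_num_eq_card)
    then show ?thesis using 2[OF i] py(2)[of i] by simp
  qed
qed

lemma facet_R_iff:
  assumes "2 \<le> aff_dim P"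
  shows "T facet_of R \<longleftrightarrow> (T facet_of P \<and> T \<noteq> F) \<or> (\<exists>K. K facet_of F \<and> T = convex hull (insert x K))"
proof -
  obtain x0 where gl: "glued R a x0 x b" using glued_R by blast
  define i where "i = nat (aff_dim P - 2)"
  have i: "int (Suc i) = aff_dim P - 1" using assms by (simp add: i_def)
  have fac: "T facet_of P \<longleftrightarrow> T \<in> ifaces (Suc i) P" for T
    using i by (auto simp: facet_of_def ifaces_def)
  have facR: "T facet_of R \<longleftrightarrow> T \<in> ifaces (Suc i) R" for T
    using i aff_dim_R by (auto simp: facet_of_def ifaces_def)
  have facF: "T facet_of F \<longleftrightarrow> T \<in> ifaces i F" for T
    using i aff_dim_F by (auto simp: facet_of_def ifaces_def)
  have "ifaces (Suc i) R = (ifaces (Suc i) P - {F}) \<union> (ifaces (Suc i) pyr - {F})"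
    using glued.ifaces_eq[OF gl, of "Suc i"] R_slices i aff_dim_R by simp
  moreover have "ifaces (Suc i) pyr - {F} = (\<lambda>K. convex hull (insert x K)) ` ifaces i F"
  proof -
    have "T = F" if "T \<in> ifaces (Suc i) F" for T
      using that face_of_aff_dim_lt[OF convF, of T] i aff_dim_F by (auto simp: ifaces_def)
    moreover have "convex hull (insert x K) \<noteq> F" for K
      using hull_inc[of x "insert x K" convex] x_notin_P F_eq by auto
    ultimately show ?thesis
      using ifaces_pyramid(2)[OF polyF x_notin, of i] unfolding pyr_def by blast
  qed
  ultimately have "T \<in> ifaces (Suc i) R \<longleftrightarrow> (T \<in> ifaces (Suc i) P \<and> T \<noteq> F) \<or>
      (\<exists>K. K \<in> ifaces i F \<and> T = convex hull (insert x K))"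
    by blast
  then show ?thesis unfolding fac facR facF .
qed

lemma apex_extreme: "x extreme_point_of R"
proof -
  obtain x0 where gl: "glued R a x0 x b" using glued_R by blast
  have "{x} face_of pyr" unfolding pyr_def
    using pyramid_face_iff[OF polyF x_notin, of "{x}"] empty_face_of[of F] by auto
  moreover have "pyr \<noteq> {x}" "F \<noteq> {x}"
  proof -
    show "F \<noteq> {x}" using x_notin by (auto simp: hull_inc)
    have "F \<subseteq> pyr" unfolding pyr_def using hull_subset[of "insert x F" convex] by blast
    moreover have "F \<noteq> {}" using facet by (auto simp: facet_of_def)
    moreover have "x \<notin> F" using x_notin by (auto simp: hull_inc)
    ultimately show "pyr \<noteq> {x}" by auto
  qed
  ultimately have "{x} face_of R"
    using glued.face_of_B[OF gl, of "{x}"] R_slices by auto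
  then show ?thesis by (simp add: face_of_singleton)
qed

end

text \<open>Drop the halfspace \<open>h\<close> belonging to \<open>F\<close> from an irredundant description of \<open>P\<close>.
  The remaining intersection \<open>W\<close> has a point \<open>y\<close> outside \<open>h\<close>, and the apex is taken on the segment
  from the interior of \<open>P\<close> to \<open>y\<close>, beyond \<open>F\<close>.\<close>

lemma exists_stacked:
  fixes P F :: "'a::euclidean_space set"
  assumes P: "polytope P" and dim: "aff_dim P = int DIM('a)" and F: "F facet_of P"
  obtains x a b where "stacked P F x a b"
proof -
  have hull: "affine hull P = UNIV" using dim aff_dim_eq_full by blast
  obtain \<H> where fin: "finite \<H>" and PH: "P = affine hull P \<inter> \<Inter>\<H>"
    and ab: "\<forall>h\<in>\<H>. \<exists>a b. a \<noteq> 0 \<and> h = {x. a \<bullet> x \<le> b}"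
    and min: "\<forall>\<H>'. \<H>' \<subset> \<H> \<longrightarrow> P \<subset> affine hull P \<inter> \<Inter>\<H>'"
    using polytope_imp_polyhedron[OF P] unfolding polyhedron_Int_affine_minimal by blast
  obtain A B where AB: "\<And>h. h \<in> \<H> \<Longrightarrow> A h \<noteq> 0 \<and> h = {x. A h \<bullet> x \<le> B h}"
    using ab by metis
  have "\<exists>h. h \<in> \<H> \<and> F = P \<inter> {x. A h \<bullet> x = B h}"
    using facet_of_polyhedron_explicit[OF fin PH AB, of F] min F by blast
  then obtain h where h: "h \<in> \<H>" "F = P \<inter> {x. A h \<bullet> x = B h}" by blast
  define a b W where "a = A h" and "b = B h" and "W = \<Inter>(\<H> - {h})"
  have ab0: "a \<noteq> 0" "h = {x. a \<bullet> x \<le> b}" using AB[OF h(1)] by (auto simp: a_def b_def)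
  have PW: "P = W \<inter> {x. a \<bullet> x \<le> b}"
  proof -
    have "\<Inter>\<H> = W \<inter> h" unfolding W_def using h(1) by blast
    then show ?thesis using PH hull ab0 by simp
  qed
  have convW: "convex W"
    unfolding W_def
  proof (rule convex_Inter)
    fix s assume "s \<in> \<H> - {h}"
    then have "s = {x. A s \<bullet> x \<le> B s}" using AB by blast
    then show "convex s" using convex_halfspace_le by metis
  qed
  have "\<H> - {h} \<subset> \<H>" using h(1) by blast
  then have "P \<subset> affine hull P \<inter> \<Inter>(\<H> - {h})" using min by simp
  then have "P \<subset> W" unfolding W_def hull by simp
  then obtain y where y: "y \<in> W" "y \<notin> P" by blast
  then have ay: "b < a \<bullet> y" using PW by auto
  have "interior P \<noteq> {}"
    using rel_interior_interior[OF hull] rel_interior_eq_empty[OF polytope_imp_convex[OF P]] dim by auto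
  then obtain c where c: "c \<in> interior P" by blast
  have cP: "c \<in> P" using c interior_subset by blast
  have "a \<bullet> c < b"
    using c interior_mono[of P "{x. a \<bullet> x \<le> b}"] PW ab0(1) by (auto simp: interior_halfspace_le)
  then obtain r where r: "r \<in> closed_segment c y" "a \<bullet> r = b"
    using connected_ivt_hyperplane[of "closed_segment c y" c y a b] ay by auto
  have seg: "open_segment c y \<subseteq> interior W"
    using in_interior_closure_convex_segment[OF convW, of c y] c interior_mono[of P W] PW y closure_subset by blast
  have "r \<noteq> c" "r \<noteq> y" using r ay \<open>a \<bullet> c < b\<close> by auto
  then have rW: "r \<in> interior W" using seg r by (auto simp: open_segment_def)
  \<comment> \<open>All points strictly between \<open>r\<close> and \<open>y\<close> lie beyond the
    hyperplane of \<open>F\<close> and still in the interior of \<open>W\<close>; the midpoint is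
    one of them.\<close>
  define x where "x = midpoint r y"
  have "open_segment r y \<subseteq> interior W"
    using in_interior_closure_convex_segment[OF convW rW, of y] y closure_subset[of W] by blast
  then have xW: "x \<in> interior W"
    using \<open>r \<noteq> y\<close> midpoint_in_open_segment[of r y] unfolding x_def by blast
  have ax: "b < a \<bullet> x" unfolding x_def midpoint_def using r ay by (simp add: inner_add_right)
  have FW: "F = W \<inter> {x. a \<bullet> x = b}" using h(2) PW unfolding a_def b_def by auto
  have convF: "convex F" using FW convW by (simp add: convex_Int convex_hyperplane)
  have F0: "F \<noteq> {}" using F by (auto simp: facet_of_def)
  let ?B = "convex hull (insert x F)"
  have B: "?B \<subseteq> {y. a \<bullet> y \<ge> b}" "?B \<inter> {y. a \<bullet> y = b} = F"
    by (rule pyramid_above[OF convF _ ax]; use FW in blast)+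
  have BW: "?B \<subseteq> W" using xW FW convW interior_subset by (intro hull_minimal) auto
  have Bint: "?B - {y. a \<bullet> y = b} \<subseteq> interior W"
  proof
    fix z assume z: "z \<in> ?B - {y. a \<bullet> y = b}"
    then obtain f where f: "f \<in> F" "z \<in> closed_segment x f"
      using F0 by (auto simp: convex_hull_insert_segments hull_same[of convex F] convF)
    have "z \<noteq> f" using z f FW by auto
    moreover have "open_segment x f \<subseteq> interior W"
      using in_interior_closure_convex_segment[OF convW xW] f FW closure_subset by blast
    ultimately show "z \<in> interior W" using f xW by (auto simp: open_segment_def)
  qed
  have "stacked P F x a b"
  proof
    show "P \<subseteq> {y. a \<bullet> y \<le> b}" "F = P \<inter> {y. a \<bullet> y = b}" using PW h(2) unfolding a_def b_def by blast+
    show "convex (P \<union> ?B)"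
      using convex_cap_Un[OF convW convex_convex_hull B(1) _ BW] B(2) FW PW by simp
    fix K assume "K face_of F" "K \<noteq> F"
    then show "K face_of P \<union> ?B"
      using proper_face_cap_Un[OF convW B(1) Bint rW r(2) BW, of K] FW PW by simp
  qed (use P F ax in auto)
  then show thesis using that by blast
qed

section \<open>Euler's inequality for 3-polytopes\<close>

lemma sum_card_incidences:
  assumes "finite X" "finite Y"
  shows "(\<Sum>x\<in>X. card {y \<in> Y. R x y}) = (\<Sum>y\<in>Y. card {x \<in> X. R x y})"
proof -
  have "(\<Sum>x\<in>X. card {y \<in> Y. R x y}) = (\<Sum>x\<in>X. \<Sum>y\<in>Y. if R x y then 1 else 0)"
    using assms by (simp add: sum.If_cases Int_def)
  also have "\<dots> = (\<Sum>y\<in>Y. \<Sum>x\<in>X. if R x y then 1 else 0)" by (rule sum.swap)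
  also have "\<dots> = (\<Sum>y\<in>Y. card {x \<in> X. R x y})"
    using assms by (simp add: sum.If_cases Int_def)
  finally show ?thesis .
qed

lemma double_count_le:
  assumes "finite X" "finite Y"
    and "\<And>x. x \<in> X \<Longrightarrow> p \<le> card {y \<in> Y. R x y}" and "\<And>y. y \<in> Y \<Longrightarrow> card {x \<in> X. R x y} \<le> q"
  shows "p * card X \<le> q * card Y"
proof -
  have "p * card X \<le> (\<Sum>x\<in>X. card {y \<in> Y. R x y})"
    using sum_mono[of X "\<lambda>_. p"] assms(3) by (simp add: mult.commute)
  also have "\<dots> = (\<Sum>y\<in>Y. card {x \<in> X. R x y})" by (rule sum_card_incidences[OF assms(1,2)])
  also have "\<dots> \<le> q * card Y"
    using sum_mono[of Y _ "\<lambda>_. q"] assms(4) by (simp add: mult.commute)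
  finally show ?thesis .
qed

section \<open>Vertices, edges and ridges: incidence counts\<close>

lemma ifaces_of_face:
  assumes "F face_of P"
  shows "ifaces i F = {K \<in> ifaces i P. K \<subseteq> F}"
  unfolding ifaces_def face_of_face[OF assms] by blast

lemma ifaces_0: "ifaces 0 P = (\<lambda>v. {v}) ` {v. v extreme_point_of P}"
proof (intro equalityI subsetI)
  fix T assume "T \<in> ifaces 0 P"
  then obtain v where "T = {v}" "T face_of P" by (auto simp: ifaces_def aff_dim_eq_0)
  then show "T \<in> (\<lambda>v. {v}) ` {v. v extreme_point_of P}" using face_of_singleton by blast
next
  fix T assume "T \<in> (\<lambda>v. {v}) ` {v. v extreme_point_of P}"
  then obtain v where "T = {v}" "v extreme_point_of P" by blast
  then show "T \<in> ifaces 0 P" using face_of_singleton[of v P] by (simp add: ifaces_def)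
qed

lemma f_num_0: "f_num 0 P = card {v. v extreme_point_of P}"
  unfolding f_num_eq_card ifaces_0 by (rule card_image) (auto simp: inj_on_def)

lemma finite_vertices:
  fixes P :: "'a::euclidean_space set"
  assumes "polytope P"
  shows "finite {v. v extreme_point_of P}"
  by (rule finite_polyhedron_extreme_points[OF polytope_imp_polyhedron[OF assms]])

lemma f_num_0_ge:
  fixes P :: "'a::euclidean_space set"
  assumes "polytope P"
  shows "aff_dim P + 1 \<le> int (f_num 0 P)"
proof -
  have "P = convex hull {v. v extreme_point_of P}"
    using assms Krein_Milman_Minkowski polytope_imp_compact polytope_imp_convex by blast
  then have "aff_dim P = aff_dim {v. v extreme_point_of P}" by (metis aff_dim_convex_hull)
  then show ?thesis
    using aff_dim_le_card[OF finite_vertices[OF assms]] by (simp add: f_num_0)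
qed

lemma edge_vertices:
  fixes e :: "'a::euclidean_space set"
  assumes "polytope e" "aff_dim e = 1"
  shows "card {v. v extreme_point_of e} = 2"
proof -
  obtain n where "n simplex e" using polytope_lowdim_imp_simplex[OF assms(1)] assms(2) by auto
  then have "1 simplex e" using aff_dim_simplex[of n e] assms(2) by simp
  then obtain C where C: "\<not> affine_dependent C" "int (card C) = 1 + 1" "e = convex hull C"
    by (auto simp: simplex)
  then have "{v. v extreme_point_of e} = C"
    using extreme_point_of_convex_hull_affine_independent by blast
  then show ?thesis using C by simp
qed

text \<open>The edges at \<open>v\<close> are the vertices of its vertex figure, a polytope of one
  dimension less.\<close>

lemma vertex_edges_ge:
  fixes P :: "'a::euclidean_space set"
  assumes P: "polytope P" "1 \<le> aff_dim P" and v: "v extreme_point_of P"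
  shows "aff_dim P \<le> int (card {e \<in> ifaces 1 P. v \<in> e})"
proof -
  obtain a b where "vertex_cut P v a b" using exists_vertex_cut[OF P(1) v] .
  then interpret vertex_cut P v a b .
  have "P \<noteq> {v}" using P by auto
  then have "aff_dim (P \<inter> H) = aff_dim P - 1" by (rule dims)
  moreover have "f_num 0 (P \<inter> H) = card {e \<in> ifaces 1 P. v \<in> e}"
    using f_num_slice[of 0] by simp
  ultimately show ?thesis using f_num_0_ge[OF polytope_slice(1)] by simp
qed

lemma ridge_two_facets:
  fixes P :: "'a::euclidean_space set"
  assumes "polytope P" "int i = aff_dim P - 2" "R \<in> ifaces i P"
  shows "card {F \<in> ifaces (Suc i) P. R \<subseteq> F} = 2"
proof -
  have R: "R face_of P" "R \<noteq> {}" "aff_dim R = aff_dim P - 2"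
    using assms by (auto simp: ifaces_def)
  have "{F \<in> ifaces (Suc i) P. R \<subseteq> F} = {F. F facet_of P \<and> R \<subseteq> F}"
    using assms(2) by (auto simp: ifaces_def facet_of_def)
  then show ?thesis
    using ridge_le_two_facets[OF assms(1) R] ridge_ge_two_facets[OF assms(1) R] by simp
qed

text \<open>In a polygon the vertices are the ridges.\<close>

lemma polygon_vertex_edges:
  fixes P :: "'a::euclidean_space set"
  assumes "polytope P" "aff_dim P = 2" "v extreme_point_of P"
  shows "card {e \<in> ifaces 1 P. v \<in> e} = 2"
proof -
  have "{v} \<in> ifaces 0 P" using assms(3) by (simp add: ifaces_def face_of_singleton)
  then have "card {F \<in> ifaces (Suc 0) P. {v} \<subseteq> F} = 2"
    by (intro ridge_two_facets assms(1)) (simp add: assms(2))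
  then show ?thesis by simp
qed

lemma vertices_edges_le:
  fixes P :: "'a::euclidean_space set"
  assumes P: "polytope P" "1 \<le> aff_dim P"
  shows "nat (aff_dim P) * f_num 0 P \<le> 2 * f_num 1 P"
  unfolding f_num_0 f_num_eq_card[of 1]
proof (rule double_count_le[where R = "\<lambda>v e. v \<in> e"])
  fix v assume "v \<in> {v. v extreme_point_of P}"
  then show "nat (aff_dim P) \<le> card {e \<in> ifaces 1 P. v \<in> e}"
    using vertex_edges_ge[OF P, of v] by simp
next
  fix e assume e: "e \<in> ifaces 1 P"
  then have ef: "e face_of P" by (simp add: ifaces_def)
  then have "{v \<in> {v. v extreme_point_of P}. v \<in> e} = {v. v extreme_point_of e}"
    using extreme_point_of_face[OF ef] by auto
  then show "card {v \<in> {v. v extreme_point_of P}. v \<in> e} \<le> 2"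
    using edge_vertices[OF face_of_polytope_polytope[OF P(1) ef]] e by (simp add: ifaces_def)
qed (use finite_ifaces[OF P(1)] finite_vertices[OF P(1)] in auto)

lemma polygon_edges_ge:
  fixes g :: "'a::euclidean_space set"
  assumes "polytope g" "aff_dim g = 2"
  shows "3 \<le> f_num 1 g" "f_num 0 g \<le> f_num 1 g"
proof -
  show "f_num 0 g \<le> f_num 1 g" using vertices_edges_le[OF assms(1)] assms(2) by simp
  then show "3 \<le> f_num 1 g" using f_num_0_ge[OF assms(1)] assms(2) by linarith
qed

text \<open>Perturb \<open>c\<close> in the direction of the new vector \<open>d\<close>. Vectors
  orthogonal to \<open>d\<close> keep their inner product with \<open>c\<close>, and each of the
  others excludes a single value of the coefficient.\<close>

lemma exists_inner_nonzero:
  fixes D :: "'a::euclidean_space set"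
  assumes "finite D" "0 \<notin> D"
  shows "\<exists>c. \<forall>d\<in>D. c \<bullet> d \<noteq> 0"
  using assms
proof (induction D rule: finite_induct)
  case empty then show ?case by simp
next
  case (insert d D)
  then obtain c where c: "\<forall>e\<in>D. c \<bullet> e \<noteq> 0" by auto
  have "finite ((\<lambda>e. - (c \<bullet> e) / (d \<bullet> e)) ` insert d D)" using insert by simp
  then obtain t :: real where t: "t \<notin> (\<lambda>e. - (c \<bullet> e) / (d \<bullet> e)) ` insert d D"
    using ex_new_if_finite[OF infinite_UNIV_char_0] by blast
  have "(c + t *\<^sub>R d) \<bullet> e \<noteq> 0" if e: "e \<in> insert d D" for e
  proof (cases "d \<bullet> e = 0")
    case True
    then have "e \<noteq> d" using insert by auto
    then show ?thesis using c e True by (auto simp: inner_add_left)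
  next
    case False
    have "t \<noteq> - (c \<bullet> e) / (d \<bullet> e)" using t e by blast
    then show ?thesis using False by (simp add: inner_add_left field_simps)
  qed
  then show ?case by blast
qed

lemma exists_inner_inj_on:
  fixes V :: "'a::euclidean_space set"
  assumes "finite V"
  shows "\<exists>c. inj_on (\<lambda>v. c \<bullet> v) V"
proof -
  define D where "D = (\<lambda>(u, v). u - v) ` {(u, v) \<in> V \<times> V. u \<noteq> v}"
  have "finite D" using assms unfolding D_def by (auto intro: finite_subset[of _ "V \<times> V"])
  moreover have "0 \<notin> D" by (auto simp: D_def)
  ultimately obtain c where c: "\<forall>d\<in>D. c \<bullet> d \<noteq> 0" using exists_inner_nonzero by blast
  have "inj_on (\<lambda>v. c \<bullet> v) V"
  proof (rule inj_onI, rule ccontr)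
    fix u v assume "u \<in> V" "v \<in> V" "c \<bullet> u = c \<bullet> v" "u \<noteq> v"
    then have "u - v \<in> D" unfolding D_def by (force intro: image_eqI[of _ _ "(u, v)"])
    then show False using c \<open>c \<bullet> u = c \<bullet> v\<close> by (auto simp: inner_diff_right)
  qed
  then show ?thesis by blast
qed

text \<open>Sweep with a functional \<open>c\<close> that separates the vertices, and charge every edge and every 2-face to its
  top vertex \<open>v\<close>. Counting pairs of an edge with top \<open>v\<close> inside a 2-face gives twice the number of these edges;
  a 2-face with top \<open>v\<close> has at most two of them, and a 2-face crossing the level of \<open>v\<close> at most one. The
  crossing 2-faces cut out edges at \<open>v\<close> in a polygonal slice, so there are at most two.\<close>

locale swept_polytope =
  fixes P :: "'a::euclidean_space set" and c :: 'a
  assumes poly: "polytope P" and dim3: "aff_dim P = 3"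
    and inj: "inj_on (\<lambda>v. c \<bullet> v) {v. v extreme_point_of P}"
begin

definition "V = {v. v extreme_point_of P}"
definition "is_top K v \<longleftrightarrow> v \<in> V \<and> v \<in> K \<and> (\<forall>x\<in>K. c \<bullet> x \<le> c \<bullet> v)"

lemma finV: "finite V" unfolding V_def by (rule finite_vertices[OF poly])

lemma convP: "convex P" using poly polytope_imp_convex by blast

lemma top_unique:
  assumes "is_top K v" "is_top K w"
  shows "v = w"
proof (rule inj_onD[OF inj])
  have "c \<bullet> v \<le> c \<bullet> w" "c \<bullet> w \<le> c \<bullet> v" using assms by (auto simp: is_top_def)
  then show "c \<bullet> v = c \<bullet> w" by simp
qed (use assms in \<open>auto simp: is_top_def V_def\<close>)

lemma top_exists:
  assumes "K face_of P" "K \<noteq> {}"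
  obtains v where "is_top K v"
proof -
  have K: "K = convex hull {w. w extreme_point_of P \<and> w \<in> K}"
    by (rule polytope_face_eq_hull_vertices[OF poly assms(1)])
  let ?W = "{w \<in> V. w \<in> K}"
  have "?W \<noteq> {}"
  proof
    assume "?W = {}"
    then have "{w. w extreme_point_of P \<and> w \<in> K} = {}" by (auto simp: V_def)
    then show False using K assms(2) by (metis convex_hull_empty)
  qed
  then have W: "finite ?W" "?W \<noteq> {}" using finV by auto
  define v where "v = arg_min_on (\<lambda>v. - (c \<bullet> v)) ?W"
  have v: "v \<in> ?W" "\<And>w. w \<in> ?W \<Longrightarrow> c \<bullet> w \<le> c \<bullet> v"
    unfolding v_def using arg_min_if_finite[OF W, of "\<lambda>v. - (c \<bullet> v)"] by (auto simp: not_less)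
  have "convex hull ?W \<subseteq> {x. c \<bullet> x \<le> c \<bullet> v}"
    using v by (intro hull_minimal convex_halfspace_le) auto
  moreover have "?W = {w. w extreme_point_of P \<and> w \<in> K}" by (auto simp: V_def)
  ultimately have "K \<subseteq> {x. c \<bullet> x \<le> c \<bullet> v}" using K by simp
  then have "is_top K v" using v unfolding is_top_def by blast
  then show thesis using that by blast
qed

definition "down_edges v = {e \<in> ifaces 1 P. is_top e v}"
definition "top_polygons v = {g \<in> ifaces 2 P. is_top g v}"
definition "crossing_polygons v = {g \<in> ifaces 2 P. v \<in> g \<and> (\<exists>x\<in>g. c \<bullet> x < c \<bullet> v) \<and> (\<exists>x\<in>g. c \<bullet> v < c \<bullet> x)}"

lemma fin: "finite (down_edges v)" "finite (top_polygons v)" "finite (crossing_polygons v)"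
  unfolding down_edges_def top_polygons_def crossing_polygons_def using finite_ifaces[OF poly] by auto

lemma f_num_tops: "f_num i P = (\<Sum>v\<in>V. card {K \<in> ifaces i P. is_top K v})"
proof -
  have "(\<Sum>v\<in>V. card {K \<in> ifaces i P. is_top K v}) = (\<Sum>K\<in>ifaces i P. card {v \<in> V. is_top K v})"
    using sum_card_incidences[OF finV finite_ifaces[OF poly], where R = "\<lambda>v K. is_top K v"] by simp
  also have "\<dots> = (\<Sum>K\<in>ifaces i P. 1)"
  proof (rule sum.cong[OF refl])
    fix K assume "K \<in> ifaces i P"
    then have "K face_of P" "K \<noteq> {}" by (auto simp: ifaces_def)
    then obtain v where v: "is_top K v" using top_exists by blast
    then have "{v \<in> V. is_top K v} = {v}" using top_unique by (auto simp: is_top_def)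
    then show "card {v \<in> V. is_top K v} = 1" by simp
  qed
  finally show ?thesis by (simp add: f_num_eq_card)
qed

lemma down_edge_below:
  assumes "e \<in> down_edges v"
  obtains w where "w \<in> V" "w \<in> e" "c \<bullet> w < c \<bullet> v"
proof -
  have "e \<in> ifaces 1 P \<and> is_top e v" using assms unfolding down_edges_def by (rule CollectD)
  then have e: "e face_of P" "aff_dim e = 1" "is_top e v" unfolding ifaces_def by simp_all
  have "card {w. w extreme_point_of e} = 2"
    using edge_vertices[OF face_of_polytope_polytope[OF poly e(1)] e(2)] .
  then obtain w where "w extreme_point_of e" "w \<noteq> v"
    by (metis (mono_tags, lifting) card_2_iff' mem_Collect_eq)
  then have w: "w \<in> V" "w \<in> e" using extreme_point_of_face[OF e(1)] by (auto simp: V_def)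
  then have "c \<bullet> w \<noteq> c \<bullet> v"
    using inj e(3) \<open>w \<noteq> v\<close> by (auto simp: inj_on_def is_top_def V_def)
  then have "c \<bullet> w < c \<bullet> v" using e(3) w unfolding is_top_def by fastforce
  with w that show thesis by blast
qed

lemma top_polygon_edges_le:
  assumes "g \<in> top_polygons v"
  shows "card {e \<in> down_edges v. e \<subseteq> g} \<le> 2"
proof -
  have g: "g face_of P" "aff_dim g = 2" "is_top g v" using assms by (auto simp: top_polygons_def ifaces_def)
  have "v extreme_point_of g"
    using g(3) extreme_point_of_face[OF g(1)] by (auto simp: is_top_def V_def)
  then have "card {e \<in> ifaces 1 g. v \<in> e} = 2"
    by (rule polygon_vertex_edges[OF face_of_polytope_polytope[OF poly g(1)] g(2)])
  moreover have "{e \<in> down_edges v. e \<subseteq> g} \<subseteq> {e \<in> ifaces 1 g. v \<in> e}"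
    unfolding ifaces_of_face[OF g(1)] by (auto simp: down_edges_def is_top_def)
  moreover have "finite {e \<in> ifaces 1 g. v \<in> e}"
    using finite_ifaces[OF face_of_polytope_polytope[OF poly g(1)]] by simp
  ultimately show ?thesis using card_mono by metis
qed

text \<open>Cut \<open>g\<close> at the level of \<open>v\<close> and keep the lower part. In this
  polygon \<open>v\<close> is a vertex with two edges, and one of them is the cut itself, which has
  constant level and so is no edge going down from \<open>v\<close>.\<close>

lemma crossing_polygon_edges_le:
  assumes "g \<in> crossing_polygons v" "v \<in> V"
  shows "card {e \<in> down_edges v. e \<subseteq> g} \<le> 1"
proof -
  let ?H = "{x. c \<bullet> x = c \<bullet> v}" and ?L = "{x. c \<bullet> x \<le> c \<bullet> v}"
  obtain x y where g: "g face_of P" "aff_dim g = 2" "v \<in> g" "x \<in> g" "c \<bullet> x < c \<bullet> v" "y \<in> g" "c \<bullet> v < c \<bullet> y"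
    using assms by (auto simp: crossing_polygons_def ifaces_def)
  have pg: "polytope g" using face_of_polytope_polytope[OF poly g(1)] .
  then have cg: "convex g" by (rule polytope_imp_convex)
  have "c \<noteq> 0" using g by auto
  have pL: "polytope (g \<inter> ?L)" by (rule polytope_Int_polyhedron[OF pg polyhedron_halfspace_le])
  have dL: "aff_dim (g \<inter> ?L) = 2"
    unfolding g(2)[symmetric] using g(4,5) \<open>c \<noteq> 0\<close>
    by (intro aff_dim_convex_Int_nonempty_interior cg) (auto simp: interior_halfspace_le)
  have vg: "v extreme_point_of g"
    using assms(2) g extreme_point_of_face[OF g(1)] by (auto simp: V_def)
  have "{v} face_of g" using vg face_of_singleton by blast
  then have "{v} face_of (g \<inter> ?L)" by (rule face_of_subset) (use g in auto)
  then have two: "card {e \<in> ifaces 1 (g \<inter> ?L). v \<in> e} = 2"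
    using polygon_vertex_edges[OF pL dL] face_of_singleton by blast
  have s: "g \<inter> ?H \<in> {e \<in> ifaces 1 (g \<inter> ?L). v \<in> e}"
  proof -
    have "(g \<inter> ?L) \<inter> ?H face_of (g \<inter> ?L)"
      by (intro face_of_Int_supporting_hyperplane_le convex_Int cg convex_halfspace_le) auto
    moreover have "(g \<inter> ?L) \<inter> ?H = g \<inter> ?H" by auto
    moreover have "\<not> g \<subseteq> ?H" using g(4,5) by (metis (mono_tags, lifting) less_irrefl mem_Collect_eq subsetD)
    then have "aff_dim (g \<inter> ?H) = 1"
      using aff_dim_Int_hyperplane[OF cg rel_interior_meets_hyperplane[OF cg g(4,6,5,7)]] g by auto
    ultimately show ?thesis using g by (simp add: ifaces_def)
  qed
  have sub: "{e \<in> down_edges v. e \<subseteq> g} \<subseteq> {e \<in> ifaces 1 (g \<inter> ?L). v \<in> e} - {g \<inter> ?H}"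
  proof
    fix e assume "e \<in> {e \<in> down_edges v. e \<subseteq> g}"
    then have e: "e face_of P" "aff_dim e = 1" "is_top e v" "e \<subseteq> g" "e \<in> down_edges v" by (auto simp: down_edges_def ifaces_def)
    have "e face_of (g \<inter> ?L)"
      using e face_of_imp_subset[OF g(1)] by (intro face_of_subset[OF e(1)]) (auto simp: is_top_def)
    moreover have "e \<noteq> g \<inter> ?H" using down_edge_below[OF e(5)] by force
    ultimately show "e \<in> {e \<in> ifaces 1 (g \<inter> ?L). v \<in> e} - {g \<inter> ?H}"
      using e by (auto simp: ifaces_def is_top_def)
  qed
  have "finite {e \<in> ifaces 1 (g \<inter> ?L). v \<in> e}" using finite_ifaces[OF pL] by simp
  then have "card {e \<in> down_edges v. e \<subseteq> g} \<le> card ({e \<in> ifaces 1 (g \<inter> ?L). v \<in> e} - {g \<inter> ?H})"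
    using sub by (intro card_mono) auto
  also have "\<dots> = 1" using two s by simp
  finally show ?thesis .
qed

lemma card_crossing_polygons_le:
  assumes "v \<in> V"
  shows "card (crossing_polygons v) \<le> 2"
proof (cases "crossing_polygons v = {}")
  case True then show ?thesis by simp
next
  case False
  let ?H = "{x. c \<bullet> x = c \<bullet> v}"
  have M: "g face_of P \<and> aff_dim g = 2 \<and> v \<in> g \<and> rel_interior g \<inter> ?H \<noteq> {} \<and> \<not> g \<subseteq> ?H \<and> convex g" if gM: "g \<in> crossing_polygons v" for g
  proof -
    obtain x y where g: "g face_of P" "aff_dim g = 2" "v \<in> g" "x \<in> g" "c \<bullet> x < c \<bullet> v" "y \<in> g" "c \<bullet> v < c \<bullet> y"
      using gM by (auto simp: crossing_polygons_def ifaces_def)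
    have cg: "convex g" using face_of_imp_convex[OF g(1)] .
    show ?thesis using rel_interior_meets_hyperplane[OF cg g(4,6,5,7)] g cg by auto
  qed
  obtain x y where xy: "x \<in> P" "y \<in> P" "c \<bullet> x < c \<bullet> v" "c \<bullet> v < c \<bullet> y"
    using False face_of_imp_subset by (fastforce simp: crossing_polygons_def ifaces_def)
  have "\<not> P \<subseteq> ?H" using xy by (metis (mono_tags, lifting) less_irrefl mem_Collect_eq subsetD)
  then have dS: "aff_dim (P \<inter> ?H) = 2"
    using aff_dim_Int_hyperplane[OF convP rel_interior_meets_hyperplane[OF convP xy]] xy dim3 by auto
  have pS: "polytope (P \<inter> ?H)" by (rule polytope_Int_polyhedron[OF poly polyhedron_hyperplane])
  have "{v} face_of P" using assms face_of_singleton[of v P] by (simp add: V_def)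
  then have "{v} face_of (P \<inter> ?H)"
    by (rule face_of_subset) (use assms in \<open>auto simp: V_def extreme_point_of_def\<close>)
  then have two: "card {e \<in> ifaces 1 (P \<inter> ?H). v \<in> e} = 2"
    using polygon_vertex_edges[OF pS dS] face_of_singleton by blast
  have "inj_on (\<lambda>g. g \<inter> ?H) (crossing_polygons v)"
  proof (rule inj_onI)
    fix g g' assume "g \<in> crossing_polygons v" "g' \<in> crossing_polygons v" and eq: "g \<inter> ?H = g' \<inter> ?H"
    note g = M[OF this(1)] M[OF this(2)]
    have gf: "g face_of P" "convex g" "rel_interior g \<inter> ?H \<noteq> {}" using g(1) by blast+
    have g'f: "g' face_of P" "convex g'" "rel_interior g' \<inter> ?H \<noteq> {}" using g(2) by blast+
    show "g = g'"
      by (rule slice_face_eqI[OF gf(1) g'f(1) gf(3) _ _ eq])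
        (rule convex_affine_rel_interior_Int[OF gf(2) affine_hyperplane gf(3)],
         rule convex_affine_rel_interior_Int[OF g'f(2) affine_hyperplane g'f(3)])
  qed
  moreover have "(\<lambda>g. g \<inter> ?H) ` crossing_polygons v \<subseteq> {e \<in> ifaces 1 (P \<inter> ?H). v \<in> e}"
  proof
    fix e assume "e \<in> (\<lambda>g. g \<inter> ?H) ` crossing_polygons v"
    then obtain g where g: "g \<in> crossing_polygons v" "e = g \<inter> ?H" by blast
    note Mg = M[OF g(1)]
    have "e face_of (P \<inter> ?H)"
      unfolding g(2) using Mg by (intro face_of_slice affine_imp_convex affine_hyperplane) auto
    moreover have "aff_dim e = 1" unfolding g(2) using aff_dim_Int_hyperplane[of g c "c \<bullet> v"] Mg by simp
    ultimately show "e \<in> {e \<in> ifaces 1 (P \<inter> ?H). v \<in> e}" using Mg g by (simp add: ifaces_def)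
  qed
  ultimately have "card (crossing_polygons v) \<le> card {e \<in> ifaces 1 (P \<inter> ?H). v \<in> e}"
    using finite_ifaces[OF pS] by (intro card_inj_on_le) auto
  then show ?thesis using two by simp
qed

lemma down_edges_count:
  assumes "v \<in> V"
  shows "2 * card (down_edges v) \<le> 2 * card (top_polygons v) + card (crossing_polygons v)"
proof -
  have disj: "top_polygons v \<inter> crossing_polygons v = {}" by (auto simp: top_polygons_def crossing_polygons_def is_top_def not_less[symmetric])
  have two: "card {g \<in> top_polygons v \<union> crossing_polygons v. e \<subseteq> g} = 2" if e: "e \<in> down_edges v" for e
  proof -
    have e': "e \<in> ifaces 1 P" "is_top e v" using e by (auto simp: down_edges_def)
    \<comment> \<open>A 2-face containing \<open>e\<close> also contains \<open>v\<close> and a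
      point below \<open>v\<close>. So either \<open>v\<close> is its top or it reaches above
      \<open>v\<close> and therefore crosses the level.\<close>
    have "{g \<in> top_polygons v \<union> crossing_polygons v. e \<subseteq> g} = {g \<in> ifaces (Suc 1) P. e \<subseteq> g}"
    proof (intro equalityI subsetI)
      fix g assume g: "g \<in> {g \<in> ifaces (Suc 1) P. e \<subseteq> g}"
      obtain w where w: "w \<in> e" "c \<bullet> w < c \<bullet> v" using down_edge_below[OF e] by blast
      have "v \<in> g" using g e' by (auto simp: is_top_def)
      then have "g \<in> top_polygons v \<or> g \<in> crossing_polygons v"
        using g w assms by (force simp: top_polygons_def crossing_polygons_def is_top_def numeral_2_eq_2 not_le)
      then show "g \<in> {g \<in> top_polygons v \<union> crossing_polygons v. e \<subseteq> g}" using g by blast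
    qed (auto simp: top_polygons_def crossing_polygons_def numeral_2_eq_2)
    then show ?thesis using ridge_two_facets[OF poly _ e'(1)] dim3 by simp
  qed
  have "2 * card (down_edges v) = (\<Sum>e\<in>down_edges v. card {g \<in> top_polygons v \<union> crossing_polygons v. e \<subseteq> g})" using two by simp
  also have "\<dots> = (\<Sum>g\<in>top_polygons v \<union> crossing_polygons v. card {e \<in> down_edges v. e \<subseteq> g})"
    using fin by (intro sum_card_incidences) auto
  also have "\<dots> = (\<Sum>g\<in>top_polygons v. card {e \<in> down_edges v. e \<subseteq> g}) + (\<Sum>g\<in>crossing_polygons v. card {e \<in> down_edges v. e \<subseteq> g})"
    using fin disj by (intro sum.union_disjoint) auto
  also have "\<dots> \<le> 2 * card (top_polygons v) + card (crossing_polygons v)"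
    using sum_mono[of "top_polygons v" "\<lambda>g. card {e \<in> down_edges v. e \<subseteq> g}" "\<lambda>_. 2"] top_polygon_edges_le
      sum_mono[of "crossing_polygons v" "\<lambda>g. card {e \<in> down_edges v. e \<subseteq> g}" "\<lambda>_. 1"] crossing_polygon_edges_le[OF _ assms]
    by (simp add: mult.commute)
  finally show ?thesis .
qed

text \<open>Each vertex has at most one more edge going down than it tops 2-faces. The surplus
  vanishes at two vertices: at the highest no 2-face crosses, and from the lowest no edge goes down.
  These two account for the 2.\<close>

lemma euler: "f_num 1 P + 2 \<le> f_num 0 P + f_num 2 P"
proof -
  have "P face_of P" "P \<noteq> {}" using dim3 convP by (auto simp: face_of_refl)
  then obtain t where t: "is_top P t" using top_exists by blast
  have tV: "t \<in> V" using t by (simp add: is_top_def)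
  have cV: "4 \<le> card V" using f_num_0_ge[OF poly] dim3 by (simp add: f_num_0 V_def)
  then have V: "V \<noteq> {}" by auto
  define m where "m = arg_min_on (\<lambda>v. c \<bullet> v) V"
  have m: "m \<in> V" "\<And>w. w \<in> V \<Longrightarrow> c \<bullet> m \<le> c \<bullet> w"
    unfolding m_def using arg_min_if_finite[OF finV V, of "\<lambda>v. c \<bullet> v"] by (auto simp: not_less)
  have "m \<noteq> t"
  proof
    assume "m = t"
    then have "c \<bullet> w = c \<bullet> t" if "w \<in> V" for w
      using m(2)[OF that] t that by (auto simp: is_top_def V_def extreme_point_of_def intro: antisym)
    then have "V \<subseteq> {t}" using inj tV by (auto simp: inj_on_def V_def)
    then have "card V \<le> card {t}" by (intro card_mono) auto
    then show False using cV by simp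
  qed
  have 1: "card (down_edges v) \<le> card (top_polygons v) + 1" if "v \<in> V" for v
    using down_edges_count[OF that] card_crossing_polygons_le[OF that] by linarith
  have 2: "card (down_edges t) \<le> card (top_polygons t)"
  proof -
    have "crossing_polygons t = {}"
    proof (rule ccontr)
      assume "crossing_polygons t \<noteq> {}"
      then obtain g x where "g face_of P" "x \<in> g" "c \<bullet> t < c \<bullet> x" by (auto simp: crossing_polygons_def ifaces_def)
      then show False using t face_of_imp_subset unfolding is_top_def by fastforce
    qed
    then show ?thesis using down_edges_count[OF tV] by simp
  qed
  have 3: "card (down_edges m) \<le> card (top_polygons m)"
  proof -
    have "down_edges m = {}" using down_edge_below[of _ m] m(2) by (metis equals0I not_less)
    then show ?thesis by simp
  qed
  have "f_num 1 P = (\<Sum>v\<in>V. card (down_edges v))" unfolding down_edges_def by (rule f_num_tops)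
  also have "\<dots> = (\<Sum>v\<in>V - {t, m}. card (down_edges v)) + (card (down_edges t) + card (down_edges m))"
    using sum.subset_diff[of "{t, m}" V "\<lambda>v. card (down_edges v)"] tV m finV \<open>m \<noteq> t\<close> by simp
  also have "\<dots> \<le> (\<Sum>v\<in>V - {t, m}. card (top_polygons v) + 1) + (card (top_polygons t) + card (top_polygons m))"
    using 1 2 3 by (intro add_mono sum_mono) auto
  also have "\<dots> = (\<Sum>v\<in>V. card (top_polygons v)) + card (V - {t, m})"
    using sum.subset_diff[of "{t, m}" V "\<lambda>v. card (top_polygons v)"] tV m finV \<open>m \<noteq> t\<close> by (simp add: sum_Suc)
  also have "(\<Sum>v\<in>V. card (top_polygons v)) = f_num 2 P" unfolding top_polygons_def by (rule f_num_tops[symmetric])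
  also have "card (V - {t, m}) = card V - 2"
    using tV m \<open>m \<noteq> t\<close> finV by (simp add: card_Diff_subset)
  finally show ?thesis using cV by (simp add: f_num_0 V_def)
qed

end

section \<open>Face numbers of 3-polytopes\<close>

lemma polytope3_euler_le:
  fixes P :: "'a::euclidean_space set"
  assumes "polytope P" "aff_dim P = 3"
  shows "f_num 1 P + 2 \<le> f_num 0 P + f_num 2 P"
proof -
  obtain c where "inj_on (\<lambda>v. c \<bullet> v) {v. v extreme_point_of P}"
    using exists_inner_inj_on[OF finite_vertices[OF assms(1)]] by blast
  then have "swept_polytope P c" using assms by (intro swept_polytope.intro)
  then show ?thesis by (rule swept_polytope.euler)
qed

lemma polytope3_faces_edges_sum:
  fixes P :: "'a::euclidean_space set"
  assumes P: "polytope P" "aff_dim P = 3"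
  shows "(\<Sum>g\<in>ifaces 2 P. f_num 1 g) = 2 * f_num 1 P"
proof -
  have "(\<Sum>g\<in>ifaces 2 P. f_num 1 g) = (\<Sum>g\<in>ifaces 2 P. card {e \<in> ifaces 1 P. e \<subseteq> g})"
  proof (rule sum.cong[OF refl])
    fix g assume "g \<in> ifaces 2 P"
    then have "g face_of P" by (simp add: ifaces_def)
    from ifaces_of_face[OF this, of 1] show "f_num 1 g = card {e \<in> ifaces 1 P. e \<subseteq> g}"
      by (simp only: f_num_eq_card)
  qed
  also have "\<dots> = (\<Sum>e\<in>ifaces 1 P. card {g \<in> ifaces 2 P. e \<subseteq> g})"
    by (rule sum_card_incidences[OF finite_ifaces[OF P(1)] finite_ifaces[OF P(1)]])
  also have "\<dots> = (\<Sum>e\<in>ifaces 1 P. 2)"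
    using ridge_two_facets[OF P(1), of 1] P(2) by (intro sum.cong) (auto simp: numeral_2_eq_2)
  finally show ?thesis by (simp add: f_num_eq_card)
qed

lemma polytope3_bounds:
  fixes P :: "'a::euclidean_space set"
  assumes P: "polytope P" "aff_dim P = 3"
  shows "3 * f_num 0 P \<le> 2 * f_num 1 P" "3 * f_num 2 P \<le> 2 * f_num 1 P" "4 \<le> f_num 0 P" "4 \<le> f_num 2 P"
proof -
  show 1: "3 * f_num 0 P \<le> 2 * f_num 1 P" using vertices_edges_le[OF P(1)] P(2) by simp
  show 4: "4 \<le> f_num 0 P" using f_num_0_ge[OF P(1)] P(2) by simp
  have "3 * card (ifaces 2 P) = (\<Sum>g\<in>ifaces 2 P. 3)" by simp
  also have "\<dots> \<le> (\<Sum>g\<in>ifaces 2 P. f_num 1 g)"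
  proof (rule sum_mono)
    fix g assume "g \<in> ifaces 2 P"
    then have "g face_of P" "aff_dim g = 2" by (auto simp: ifaces_def)
    then show "3 \<le> f_num 1 g" using polygon_edges_ge(1) face_of_polytope_polytope[OF P(1)] by blast
  qed
  finally show "3 * f_num 2 P \<le> 2 * f_num 1 P"
    unfolding polytope3_faces_edges_sum[OF P] by (simp add: f_num_eq_card)
  show "4 \<le> f_num 2 P" using polytope3_euler_le[OF P] 1 4 by linarith
qed

text \<open>If all 2-faces had six or more edges, then \<open>3 f_2 <= f_1\<close>. Together with
  \<open>3 f_0 <= 2 f_1\<close> this gives \<open>f_0 + f_2 <= f_1\<close>, against Euler's
  inequality.\<close>

lemma polytope3_small_face:
  fixes P :: "'a::euclidean_space set"
  assumes P: "polytope P" "aff_dim P = 3"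
  obtains g where "g \<in> ifaces 2 P" "f_num 1 g \<le> 5" "f_num 0 g \<le> 5"
proof -
  have "\<exists>g\<in>ifaces 2 P. f_num 1 g \<le> 5"
  proof (rule ccontr)
    assume "\<not> ?thesis"
    then have "6 \<le> f_num 1 g" if "g \<in> ifaces 2 P" for g using that by force
    then have "(\<Sum>g\<in>ifaces 2 P. 6) \<le> (\<Sum>g\<in>ifaces 2 P. f_num 1 g)" by (intro sum_mono)
    then have "6 * f_num 2 P \<le> 2 * f_num 1 P"
      unfolding polytope3_faces_edges_sum[OF P] by (simp add: f_num_eq_card)
    then show False using polytope3_euler_le[OF P] polytope3_bounds(1)[OF P] by linarith
  qed
  then obtain g where g: "g \<in> ifaces 2 P" "f_num 1 g \<le> 5" by blast
  then have "f_num 0 g \<le> f_num 1 g"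
    using polygon_edges_ge(2) face_of_polytope_polytope[OF P(1)] by (auto simp: ifaces_def)
  then show thesis using that g by simp
qed

section \<open>A facet with few vertices or a vertex in few facets\<close>

lemma six_times_choose_3: "6 * (n choose 3) = n * (n - 1) * (n - 2)"
proof -
  have "3 * (n choose 3) = n * ((n - 1) choose 2)"
    using times_binomial_minus1_eq[of 3 n] by simp
  moreover have "2 * ((n - 1) choose 2) = (n - 1) * (n - 2)"
    using times_binomial_minus1_eq[of 2 "n - 1"] by (simp add: numeral_2_eq_2)
  ultimately have "2 * (3 * (n choose 3)) = n * ((n - 1) * (n - 2))"
    by (metis mult.left_commute)
  then show ?thesis by (simp add: mult.assoc)
qed

text \<open>Count triples of \<open>X\<close> with a common neighbour: each has at most two, while
  every neighbourhood contains at least as many triples as the smallest one. As \<open>Y\<close> is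
  at least as large as \<open>X\<close>, a factor \<open>card X\<close> cancels. The relation is
  abstract because vertices and facets appear in both roles.\<close>

lemma K33_free_small_degree:
  assumes fin: "finite X" "finite Y" and le: "card X \<le> card Y" and ne: "X \<noteq> {}"
    and free: "\<And>T. T \<subseteq> X \<Longrightarrow> card T = 3 \<Longrightarrow> card {y \<in> Y. \<forall>x\<in>T. R x y} \<le> 2"
  shows "\<exists>y\<in>Y. card {x \<in> X. R x y} * (card {x \<in> X. R x y} - 1) * (card {x \<in> X. R x y} - 2)
     \<le> 2 * ((card X - 1) * (card X - 2))"
proof -
  let ?k = "\<lambda>y. card {x \<in> X. R x y}" and ?\<T> = "{T. T \<subseteq> X \<and> card T = 3}"
  have "Y \<noteq> {}" using ne le fin by auto
  define y where "y = arg_min_on ?k Y"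
  have y: "y \<in> Y" "\<And>z. z \<in> Y \<Longrightarrow> ?k y \<le> ?k z"
    unfolding y_def using arg_min_if_finite(1)[OF fin(2) \<open>Y \<noteq> {}\<close>, of ?k] arg_min_least[OF fin(2) \<open>Y \<noteq> {}\<close>, of _ ?k]
    by blast+
  have finT: "finite ?\<T>" using fin by simp
  have sub: "card {T \<in> ?\<T>. \<forall>x\<in>T. R x z} = ?k z choose 3" for z
  proof -
    have "{T \<in> ?\<T>. \<forall>x\<in>T. R x z} = {T. T \<subseteq> {x \<in> X. R x z} \<and> card T = 3}" by blast
    then show ?thesis using n_subsets[of "{x \<in> X. R x z}" 3] fin by simp
  qed
  have "card X * (?k y choose 3) \<le> card Y * (?k y choose 3)" using le by simp
  also have "\<dots> = (\<Sum>z\<in>Y. ?k y choose 3)" by simp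
  also have "\<dots> \<le> (\<Sum>z\<in>Y. ?k z choose 3)" using y(2) by (intro sum_mono binomial_right_mono)
  also have "\<dots> = (\<Sum>z\<in>Y. card {T \<in> ?\<T>. \<forall>x\<in>T. R x z})" by (simp only: sub)
  also have "\<dots> = (\<Sum>T\<in>?\<T>. card {z \<in> Y. \<forall>x\<in>T. R x z})"
    by (rule sum_card_incidences[OF fin(2) finT])
  also have "\<dots> \<le> (\<Sum>T\<in>?\<T>. 2)" using free by (intro sum_mono) auto
  also have "\<dots> = 2 * (card X choose 3)" using n_subsets[OF fin(1), of 3] by simp
  finally have "6 * (card X * (?k y choose 3)) \<le> 6 * (2 * (card X choose 3))" by (rule mult_le_mono2)
  then have "card X * (6 * (?k y choose 3)) \<le> 2 * (6 * (card X choose 3))" by simp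
  then have "card X * (?k y * (?k y - 1) * (?k y - 2)) \<le> card X * (2 * ((card X - 1) * (card X - 2)))"
    unfolding six_times_choose_3 by (simp add: ac_simps)
  moreover have "0 < card X" using ne fin by (simp add: card_gt_0_iff)
  ultimately have "?k y * (?k y - 1) * (?k y - 2) \<le> 2 * ((card X - 1) * (card X - 2))" by simp
  then show ?thesis using y by blast
qed

text \<open>With \<open>s = n^(2/3)\<close> and \<open>x = k - 1\<close> the hypothesis yields
  \<open>x^3 - x <= 2 s^3\<close>. The cube of 4/3 is 64/27, so \<open>x > 4/3 s\<close> would leave
  \<open>10/27 s^3 <= 4/3 s\<close>, which fails for \<open>s >= 2\<close>, and
  \<open>n >= 4\<close> ensures that.\<close>

lemma cubic_le_imp_four_thirds_powr:
  fixes n k :: nat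
  assumes n: "4 \<le> n" and k: "k * (k - 1) * (k - 2) \<le> 2 * ((n - 1) * (n - 2))"
  shows "real k \<le> 4 / 3 * real n powr (2 / 3) + 1"
proof (rule ccontr)
  assume c: "\<not> ?thesis"
  define s where "s = real n powr (2 / 3)"
  define x where "x = real k - 1"
  have s0: "s > 0" using n by (simp add: s_def)
  have "s ^ 3 = s powr 3" using s0 by simp
  also have "\<dots> = real n powr 2" by (simp add: s_def powr_powr)
  also have "\<dots> = real n ^ 2" by simp
  finally have s3: "s ^ 3 = real n ^ 2" .
  have s2: "2 \<le> s"
  proof (rule ccontr)
    assume "\<not> 2 \<le> s"
    then have "s ^ 3 < 2 ^ 3" using s0 by (intro power_strict_mono) auto
    moreover have "real n ^ 2 \<ge> 4 ^ 2" using n by (intro power_mono) auto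
    ultimately show False using s3 by simp
  qed
  define t where "t = 4 / 3 * s"
  have xt: "t < x" using c by (simp add: x_def s_def t_def)
  have t1: "2 \<le> t" using s2 by (simp add: t_def)
  have k3: "3 \<le> k" using xt t1 by (simp add: x_def)
  have "real (k * (k - 1) * (k - 2)) = (x + 1) * x * (x - 1)"
    using k3 by (simp add: x_def of_nat_diff)
  moreover have "real (2 * ((n - 1) * (n - 2))) \<le> 2 * real n ^ 2"
  proof -
    have "(n - 1) * (n - 2) \<le> n * n" by (intro mult_le_mono) auto
    then have "real ((n - 1) * (n - 2)) \<le> real (n * n)" by (simp only: of_nat_le_iff)
    then show ?thesis by (simp add: power2_eq_square)
  qed
  ultimately have 1: "(x + 1) * x * (x - 1) \<le> 2 * s ^ 3"
    using k s3 by (metis of_nat_le_iff order_trans)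
  have "(t + 1) * t * (t - 1) \<le> (x + 1) * x * (x - 1)"
    using xt t1 by (intro mult_mono) auto
  with 1 have "(t + 1) * t * (t - 1) \<le> 2 * s ^ 3" by simp
  then have "t ^ 3 - t \<le> 2 * s ^ 3" by (simp add: power3_eq_cube algebra_simps)
  then have "10 / 27 * s ^ 3 \<le> 4 / 3 * s" by (simp add: t_def power_mult_distrib power3_eq_cube)
  then have "s * (10 / 27 * s ^ 2) \<le> s * (4 / 3)" by (simp add: power2_eq_square power3_eq_cube)
  then have "10 / 27 * s ^ 2 \<le> 4 / 3" using s0 by simp
  moreover have "s ^ 2 \<ge> 2 ^ 2" using s2 by (intro power_mono) auto
  ultimately show False by simp
qed

lemma polytope4_no_K33:
  fixes P :: "'a::euclidean_space set"
  assumes P: "polytope P" "aff_dim P = 4"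
    and T: "T \<subseteq> {v. v extreme_point_of P}" "card T = 3"
    and S: "S \<subseteq> ifaces 3 P" "card S = 3" and inc: "\<And>v F. v \<in> T \<Longrightarrow> F \<in> S \<Longrightarrow> v \<in> F"
  shows False
proof -
  have cP: "convex P" using P polytope_imp_convex by blast
  obtain F1 F2 F3 where F: "S = {F1, F2, F3}" "F1 \<noteq> F2" using S(2) by (auto simp: card_3_iff)
  have f: "F face_of P" "aff_dim F = 3" if "F \<in> S" for F using that S(1) by (auto simp: ifaces_def)
  define K where "K = \<Inter>S"
  have Kf: "K face_of P" unfolding K_def using f F by (intro face_of_Inter) auto
  have pK: "polytope K" using face_of_polytope_polytope[OF P(1) Kf] .
  have "T \<subseteq> {v. v extreme_point_of K}"
    using T(1) inc extreme_point_of_face[OF Kf] by (auto simp: K_def)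
  then have c3: "3 \<le> card {v. v extreme_point_of K}"
    using card_mono[OF finite_vertices[OF pK]] T(2) by metis
  have "2 \<le> aff_dim K"
  proof (rule ccontr)
    assume "\<not> 2 \<le> aff_dim K"
    then consider "aff_dim K = 1" | "aff_dim K = 0" | "aff_dim K = -1"
      using aff_dim_geq[of K] by linarith
    then show False
    proof cases
      case 1 then show False using edge_vertices[OF pK] c3 by simp
    next
      case 2
      then obtain x where "K = {x}" by (auto simp: aff_dim_eq_0)
      then have "{v. v extreme_point_of K} = {x}" by auto
      then show False using c3 by simp
    next
      case 3
      then have "K = {}" using aff_dim_empty by blast
      then show False using c3 by simp
    qed
  qed
  moreover have "aff_dim K \<le> 2"
  proof -
    have 1: "F1 \<in> S" "F2 \<in> S" using F by auto
    have "\<not> F1 \<subseteq> F2" using face_of_eq_aff_dim[OF cP f(1)[OF 1(1)] f(1)[OF 1(2)]] f(2)[OF 1(1)] f(2)[OF 1(2)] F(2) by auto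
    then have "K \<noteq> F1" using 1 unfolding K_def by blast
    moreover have "K face_of F1" using face_of_face[OF f(1)[OF 1(1)]] Kf 1 unfolding K_def by blast
    ultimately have "aff_dim K < aff_dim F1"
      using face_of_aff_dim_lt face_of_imp_convex[OF f(1)[OF 1(1)]] by blast
    then show ?thesis using f(2)[OF 1(1)] by simp
  qed
  ultimately have "K \<in> ifaces 2 P" using Kf by (simp add: ifaces_def)
  then have "card {F \<in> ifaces (Suc 2) P. K \<subseteq> F} = 2"
    by (intro ridge_two_facets P(1)) (simp add: P(2))
  moreover have "S \<subseteq> {F \<in> ifaces (Suc 2) P. K \<subseteq> F}"
    using S(1) unfolding K_def by auto
  moreover have "finite {F \<in> ifaces (Suc 2) P. K \<subseteq> F}" using finite_ifaces[OF P(1)] by simp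
  ultimately have "card S \<le> 2" using card_mono[of "{F \<in> ifaces (Suc 2) P. K \<subseteq> F}" S] by simp
  then show False using S(2) by simp
qed

lemma f_num_0_face:
  assumes "F face_of P"
  shows "f_num 0 F = card {v \<in> {v. v extreme_point_of P}. v \<in> F}"
  unfolding f_num_0 using extreme_point_of_face[OF assms] by simp

lemma polytope4_small_facet:
  fixes P :: "'a::euclidean_space set"
  assumes P: "polytope P" "aff_dim P = 4" and le: "f_num 0 P \<le> f_num 3 P"
  obtains F where "F \<in> ifaces 3 P" "real (f_num 0 F) \<le> 4 / 3 * real (f_num 0 P) powr (2 / 3) + 1"
proof -
  let ?V = "{v. v extreme_point_of P}"
  have n: "5 \<le> f_num 0 P" using f_num_0_ge[OF P(1)] P(2) by simp
  have "\<exists>F\<in>ifaces 3 P. card {v \<in> ?V. v \<in> F} * (card {v \<in> ?V. v \<in> F} - 1) * (card {v \<in> ?V. v \<in> F} - 2)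
     \<le> 2 * ((card ?V - 1) * (card ?V - 2))"
  proof (rule K33_free_small_degree)
    show "finite ?V" "finite (ifaces 3 P)" using finite_vertices[OF P(1)] finite_ifaces[OF P(1)] .
    show "card ?V \<le> card (ifaces 3 P)" using le by (simp add: f_num_0 flip: f_num_eq_card)
    show "?V \<noteq> {}" using n unfolding f_num_0 by (metis card.empty not_numeral_le_zero)
    fix T assume T: "T \<subseteq> ?V" "card T = 3"
    show "card {F \<in> ifaces 3 P. \<forall>v\<in>T. v \<in> F} \<le> 2"
    proof (rule ccontr)
      assume "\<not> ?thesis"
      then have "3 \<le> card {F \<in> ifaces 3 P. \<forall>v\<in>T. v \<in> F}" by simp
      then obtain S where "S \<subseteq> {F \<in> ifaces 3 P. \<forall>v\<in>T. v \<in> F}" "card S = 3"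
        by (rule obtain_subset_with_card_n)
      then show False using polytope4_no_K33[OF P T, of S] by blast
    qed
  qed
  then obtain F where F: "F \<in> ifaces 3 P" and k: "f_num 0 F * (f_num 0 F - 1) * (f_num 0 F - 2) \<le> 2 * ((f_num 0 P - 1) * (f_num 0 P - 2))"
    using f_num_0_face[of _ P] by (auto simp: f_num_0[of P] ifaces_def)
  show thesis using that[OF F cubic_le_imp_four_thirds_powr[OF _ k]] n by simp
qed

text \<open>The facets at a vertex are the 2-faces of its vertex figure. The bound provides the
  starting value 4 of the cubic estimate when facets are counted.\<close>

lemma polytope4_facets_ge:
  fixes P :: "'a::euclidean_space set"
  assumes P: "polytope P" "aff_dim P = 4"
  shows "4 \<le> f_num 3 P"
proof -
  have "card {v. v extreme_point_of P} \<noteq> 0" using f_num_0_ge[OF P(1)] P(2) unfolding f_num_0 by simp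
  then have "{v. v extreme_point_of P} \<noteq> {}" by (metis card.empty)
  then obtain v where v: "v extreme_point_of P" by blast
  obtain a b where "vertex_cut P v a b" using exists_vertex_cut[OF P(1) v] .
  then interpret vertex_cut P v a b .
  have "P \<noteq> {v}" using P by auto
  then have "aff_dim (P \<inter> H) = 3" using dims(2) P(2) by simp
  then have "4 \<le> f_num 2 (P \<inter> H)" using polytope3_bounds(4)[OF polytope_slice(1)] by simp
  also have "\<dots> = card {F \<in> ifaces (Suc 2) P. v \<in> F}" by (rule f_num_slice)
  also have "\<dots> \<le> f_num 3 P" unfolding f_num_eq_card using finite_ifaces[OF P(1)] by (intro card_mono) auto
  finally show ?thesis .
qed

lemma polytope4_small_vertex:
  fixes P :: "'a::euclidean_space set"
  assumes P: "polytope P" "aff_dim P = 4" and le: "f_num 3 P \<le> f_num 0 P"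
  obtains v where "v extreme_point_of P"
    "real (card {F \<in> ifaces 3 P. v \<in> F}) \<le> 4 / 3 * real (f_num 3 P) powr (2 / 3) + 1"
proof -
  let ?V = "{v. v extreme_point_of P}"
  have m: "4 \<le> f_num 3 P" using polytope4_facets_ge[OF P] .
  have "\<exists>v\<in>?V. card {F \<in> ifaces 3 P. v \<in> F} * (card {F \<in> ifaces 3 P. v \<in> F} - 1) * (card {F \<in> ifaces 3 P. v \<in> F} - 2)
     \<le> 2 * ((card (ifaces 3 P) - 1) * (card (ifaces 3 P) - 2))"
  proof (rule K33_free_small_degree)
    show "finite ?V" "finite (ifaces 3 P)" using finite_vertices[OF P(1)] finite_ifaces[OF P(1)] .
    show "card (ifaces 3 P) \<le> card ?V" using le by (simp add: f_num_0 flip: f_num_eq_card)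
    show "ifaces 3 P \<noteq> {}" using m unfolding f_num_eq_card by (metis card.empty not_numeral_le_zero)
    fix S assume S: "S \<subseteq> ifaces 3 P" "card S = 3"
    show "card {v \<in> ?V. \<forall>F\<in>S. v \<in> F} \<le> 2"
    proof (rule ccontr)
      assume "\<not> ?thesis"
      then have "3 \<le> card {v \<in> ?V. \<forall>F\<in>S. v \<in> F}" by simp
      then obtain T where T: "T \<subseteq> {v \<in> ?V. \<forall>F\<in>S. v \<in> F}" "card T = 3"
        by (rule obtain_subset_with_card_n)
      then have "T \<subseteq> ?V" by blast
      then show False using polytope4_no_K33[OF P _ T(2) S] T(1) by blast
    qed
  qed
  then obtain v where "v extreme_point_of P" and k: "card {F \<in> ifaces 3 P. v \<in> F} * (card {F \<in> ifaces 3 P. v \<in> F} - 1) * (card {F \<in> ifaces 3 P. v \<in> F} - 2)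
     \<le> 2 * ((f_num 3 P - 1) * (f_num 3 P - 2))"
    unfolding f_num_eq_card by blast
  then show thesis using that cubic_le_imp_four_thirds_powr[OF m k] by blast
qed

text \<open>Brings \<open>f_1\<close> and \<open>f_2\<close> above the smaller of \<open>f_0\<close>
  and \<open>f_3\<close>, in terms of which the size of the chosen facet is bounded. The second part
  counts pairs of a facet and a ridge in it.\<close>

lemma polytope4_edges_ge:
  fixes P :: "'a::euclidean_space set"
  assumes P: "polytope P" "aff_dim P = 4"
  shows "2 * f_num 0 P \<le> f_num 1 P" "2 * f_num 3 P \<le> f_num 2 P"
proof -
  show "2 * f_num 0 P \<le> f_num 1 P" using vertices_edges_le[OF P(1)] P(2) by simp
  have "4 * f_num 3 P \<le> 2 * f_num 2 P"
    unfolding f_num_eq_card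
  proof (rule double_count_le[where R = "\<lambda>F g. g \<subseteq> F"])
    fix F assume "F \<in> ifaces 3 P"
    then have F: "F face_of P" "aff_dim F = 3" by (auto simp: ifaces_def)
    show "4 \<le> card {g \<in> ifaces 2 P. g \<subseteq> F}"
      using polytope3_bounds(4)[OF face_of_polytope_polytope[OF P(1) F(1)] F(2)]
      unfolding f_num_eq_card ifaces_of_face[OF F(1)] .
  next
    fix g assume "g \<in> ifaces 2 P"
    then have "card {F \<in> ifaces (Suc 2) P. g \<subseteq> F} = 2" by (intro ridge_two_facets P(1)) (simp_all add: P(2))
    then show "card {F \<in> ifaces 3 P. g \<subseteq> F} \<le> 2" by simp
  qed (use finite_ifaces[OF P(1)] in auto)
  then show "2 * f_num 3 P \<le> f_num 2 P" by simp
qed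

section \<open>Adapters\<close>

lemma f_num_simplex:
  fixes S :: "'a::euclidean_space set"
  assumes "n simplex S"
  shows "f_num i S = nat (n + 1) choose (i + 1)"
proof -
  obtain C where C: "\<not> affine_dependent C" "int (card C) = n + 1" "S = convex hull C" "finite C"
    using assms by (auto simp: simplex)
  have "ifaces i S = (\<lambda>c. convex hull c) ` {c. c \<subseteq> C \<and> card c = i + 1}"
  proof (intro equalityI subsetI)
    fix T assume "T \<in> ifaces i S"
    then obtain c where c: "c \<subseteq> C" "T = convex hull c" "aff_dim T = int i"
      using face_of_convex_hull_affine_independent[OF C(1)] C(3) by (auto simp: ifaces_def)
    have "\<not> affine_dependent c" using affine_dependent_subset c(1) C(1) by blast
    then have "int (card c) = aff_dim c + 1" by (rule aff_dim_affine_independent)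
    then have "card c = i + 1" using c by (simp add: aff_dim_convex_hull)
    then show "T \<in> (\<lambda>c. convex hull c) ` {c. c \<subseteq> C \<and> card c = i + 1}" using c by blast
  next
    fix T assume "T \<in> (\<lambda>c. convex hull c) ` {c. c \<subseteq> C \<and> card c = i + 1}"
    then obtain c where c: "c \<subseteq> C" "card c = i + 1" "T = convex hull c" by blast
    have "\<not> affine_dependent c" using affine_dependent_subset c(1) C(1) by blast
    then have "aff_dim T = int i" using aff_dim_affine_independent[of c] c by (simp add: aff_dim_convex_hull)
    moreover have "T face_of S" using face_of_convex_hull_affine_independent[OF C(1)] c C(3) by blast
    ultimately show "T \<in> ifaces i S" by (simp add: ifaces_def)
  qed
  moreover have "inj_on (\<lambda>c. convex hull c) {c. c \<subseteq> C \<and> card c = i + 1}"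
  proof (rule inj_onI)
    fix c d assume "c \<in> {c. c \<subseteq> C \<and> card c = i + 1}" "d \<in> {c. c \<subseteq> C \<and> card c = i + 1}"
      and eq: "convex hull c = convex hull d"
    then have "\<not> affine_dependent c" "\<not> affine_dependent d" using affine_dependent_subset C(1) by blast+
    from this[THEN extreme_point_of_convex_hull_affine_independent] have "x \<in> c \<longleftrightarrow> x \<in> d" for x
      using eq by simp
    then show "c = d" by blast
  qed
  ultimately have "f_num i S = card {c. c \<subseteq> C \<and> card c = i + 1}"
    by (simp add: f_num_eq_card card_image)
  also have "\<dots> = card C choose (i + 1)" by (rule n_subsets[OF C(4)])
  also have "card C = nat (n + 1)" using C(2) by simp
  finally show ?thesis .
qed

lemma f_num_self:
  fixes P :: "'a::euclidean_space set"
  assumes "convex P" "aff_dim P = int i"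
  shows "f_num i P = 1"
proof -
  have "ifaces i P = {P}"
    using face_of_aff_dim_lt[OF assms(1)] assms face_of_refl[OF assms(1)] by (force simp: ifaces_def)
  then show ?thesis by (simp add: f_num_eq_card)
qed

lemma facet_of_iff_ifaces: "int (Suc i) = aff_dim P \<Longrightarrow> F facet_of P \<longleftrightarrow> F \<in> ifaces i P"
  by (auto simp: facet_of_def ifaces_def)

section \<open>Facets of pyramids and of simplices\<close>

lemma facet_of_pyramid:
  fixes F :: "'a::euclidean_space set"
  assumes F: "polytope F" and x: "x \<notin> affine hull F" and K: "K facet_of F"
  shows "convex hull (insert x K) facet_of convex hull (insert x F)"
proof -
  have Kf: "K face_of F" "aff_dim K = aff_dim F - 1" using K by (auto simp: facet_of_def)
  have "convex hull (insert x K) face_of convex hull (insert x F)"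
    using pyramid_face_iff[OF F x] Kf by blast
  moreover have "aff_dim (convex hull (insert x K)) = aff_dim (convex hull (insert x F)) - 1"
    using aff_dim_pyramid[OF x face_of_imp_subset[OF Kf(1)]] aff_dim_pyramid[OF x order_refl] Kf(2) by simp
  ultimately show ?thesis by (simp add: facet_of_def)
qed

lemma pyramid_inj:
  fixes F :: "'a::euclidean_space set"
  assumes x: "x \<notin> affine hull F" and K: "K facet_of F" "K' facet_of F"
    and eq: "convex hull (insert x K) = convex hull (insert x K')"
  shows "K = K'"
proof -
  note f = K[THEN facet_of_imp_face_of]
  have 1: "convex hull (insert x K) \<inter> affine hull F = K"
    by (rule pyramid_Int_affine_hull[OF x face_of_imp_subset[OF f(1)] face_of_imp_convex[OF f(1)]])
  have 2: "convex hull (insert x K') \<inter> affine hull F = K'"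
    by (rule pyramid_Int_affine_hull[OF x face_of_imp_subset[OF f(2)] face_of_imp_convex[OF f(2)]])
  show ?thesis using 1 unfolding eq 2 by (rule sym)
qed

lemma pyramid_simplex:
  fixes F :: "'a::euclidean_space set"
  assumes "x \<notin> affine hull F" "K \<subseteq> F" "n simplex K"
  shows "(n + 1) simplex (convex hull (insert x K))"
proof -
  have "x \<notin> affine hull K" using assms(1) hull_mono[OF assms(2), of affine] by blast
  then show ?thesis by (rule simplex_insert_dimplus1[OF assms(3)])
qed

lemma facet_of_simplex:
  fixes S :: "'a::euclidean_space set"
  assumes "n simplex S" "K facet_of S"
  shows "(n - 1) simplex K"
proof -
  obtain C where C: "\<not> affine_dependent C" "int (card C) = n + 1" "S = convex hull C" "finite C"
    using assms by (auto simp: simplex)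
  then obtain u where u: "u \<in> C" "K = convex hull (C - {u})"
    using facet_of_convex_hull_affine_independent[OF C(1), of K] assms(2) by blast
  have "\<not> affine_dependent (C - {u})" using affine_dependent_subset[of "C - {u}" C] C(1) by blast
  moreover have "int (card (C - {u})) = n - 1 + 1" using C u card_Suc_Diff1[OF C(4) u(1)] by linarith
  ultimately show ?thesis using u(2) simplex_convex_hull by blast
qed

text \<open>The cross-section of the pyramid with apex \<open>z\<close> over \<open>S\<close>,
  halfway up, is this homothetic copy of \<open>S\<close>.\<close>

lemma simplex_half_image:
  fixes S :: "'a::euclidean_space set"
  assumes "n simplex S"
  shows "n simplex ((\<lambda>x. midpoint z x) ` S)"
proof -
  obtain C where C: "\<not> affine_dependent C" "int (card C) = n + 1" "S = convex hull C" "finite C"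
    using assms by (auto simp: simplex)
  have eq: "(\<lambda>x. midpoint z x) ` A = (+) ((1/2) *\<^sub>R z) ` (\<lambda>x. (1/2) *\<^sub>R x) ` A" for A
    by (auto simp: midpoint_def image_image scaleR_add_right)
  have lin: "linear (\<lambda>x::'a. (1/2) *\<^sub>R x)" by (rule linear_scaleR)
  have inj: "inj (\<lambda>x::'a. (1/2) *\<^sub>R x)" by (auto simp: inj_on_def)
  have "aff_dim ((\<lambda>x. midpoint z x) ` C) = aff_dim C"
    unfolding eq aff_dim_translation_eq using aff_dim_injective_linear_image[OF lin inj] .
  moreover have card: "card ((\<lambda>x. midpoint z x) ` C) = card C"
    by (intro card_image) (auto simp: inj_on_def midpoint_def)
  ultimately have "\<not> affine_dependent ((\<lambda>x. midpoint z x) ` C)"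
    using C(1,4) aff_dim_affine_independent[OF C(1)] affine_independent_iff_card by fastforce
  moreover have "(\<lambda>x. midpoint z x) ` S = convex hull ((\<lambda>x. midpoint z x) ` C)"
    unfolding eq C(3) convex_hull_translation convex_hull_linear_image[OF lin] ..
  ultimately show ?thesis using C(2) card simplex_convex_hull by metis
qed

text \<open>The hyperplane data \<open>a, b\<close> cuts off \<open>v\<close> in such a way that the new facet is visibly a simplex.\<close>

definition cut_adapter :: "'a::euclidean_space set \<Rightarrow> 'a \<Rightarrow> 'a \<Rightarrow> real \<Rightarrow> bool" where
  "cut_adapter P v a b \<longleftrightarrow> adapter_polytope 4 P \<and> simple_vertex 4 P v \<and> vertex_cut P v a b \<and>
     3 simplex (P \<inter> {x. a \<bullet> x = b})"

text \<open>Over a tetrahedron the facets at the apex are the four pyramids over its triangles, so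
  the apex is simple and has only simplex facets around it. \<open>F'\<close> survives the stacking
  and avoids the apex.\<close>

lemma cut_adapter_stacked:
  fixes P :: "'a::euclidean_space set"
  assumes st: "stacked P F z a b" and dim: "aff_dim P = 4" and F: "3 simplex F"
    and F': "F' facet_of P" "F' \<noteq> F" "3 simplex F'"
  shows "\<exists>b'. cut_adapter (stacked.R P F z) z a b'"
proof -
  interpret stacked P F z a b by (rule st)
  have d: "2 \<le> aff_dim P" using dim by simp
  have dimF: "aff_dim F = 3" using aff_dim_simplex[OF F] .
  have facets_z: "{T. T facet_of R \<and> z \<in> T} = (\<lambda>K. convex hull (insert z K)) ` ifaces 2 F"
  proof -
    have "z \<in> convex hull (insert z K)" for K by (simp add: hull_inc)
    moreover have "z \<notin> T" if "T facet_of P" for T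
      using that x_notin_P facet_of_imp_subset by blast
    moreover have "K facet_of F \<longleftrightarrow> K \<in> ifaces 2 F" for K
      by (rule facet_of_iff_ifaces) (simp add: dimF)
    ultimately show ?thesis unfolding facet_R_iff[OF d] by blast
  qed
  have simp_z: "3 simplex T" if "T \<in> {T. T facet_of R \<and> z \<in> T}" for T
  proof -
    from that have "T \<in> (\<lambda>K. convex hull (insert z K)) ` ifaces 2 F" unfolding facets_z .
    then obtain K where K: "K \<in> ifaces 2 F" "T = convex hull (insert z K)" by blast
    have "K facet_of F" using K(1) facet_of_iff_ifaces[of 2 F K] dimF by simp
    then have "2 simplex K" using facet_of_simplex[OF F] by simp
    then show ?thesis
      using pyramid_simplex[OF x_notin face_of_imp_subset[of K F], of 2] K by (simp add: ifaces_def)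
  qed
  have card4: "card {T. T facet_of R \<and> z \<in> T} = 4"
  proof -
    have "inj_on (\<lambda>K. convex hull (insert z K)) (ifaces 2 F)"
      using pyramid_inj[OF x_notin] facet_of_iff_ifaces[of 2 F] dimF by (intro inj_onI) simp
    then have "card {T. T facet_of R \<and> z \<in> T} = f_num 2 F"
      unfolding facets_z f_num_eq_card by (rule card_image)
    also have "\<dots> = 4 choose 3" using f_num_simplex[OF F, of 2] by simp
    also have "\<dots> = 4" by (simp add: eval_nat_numeral)
    finally show ?thesis .
  qed
  have sv: "simple_vertex 4 R z"
    unfolding simple_vertex_def using apex_extreme card4 by blast
  have "{T. simplex_facet 4 R T \<and> z \<in> T} = {T. T facet_of R \<and> z \<in> T}"
    using simp_z by (auto simp: simplex_facet_def)
  then have c4: "card {T. simplex_facet 4 R T \<and> z \<in> T} = 4" using card4 by simp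
  have "simplex_facet 4 R F'" "z \<notin> F'"
    using facet_R_iff[OF d] F' x_notin_P facet_of_imp_subset[OF F'(1)] by (auto simp: simplex_facet_def)
  then have ad: "adapter_polytope 4 R"
    unfolding adapter_polytope_def d_polytope_def using polyR aff_dim_R dim sv c4 by auto
  \<comment> \<open>Half the height between \<open>F\<close> and the apex: the vertices other than
    \<open>z\<close> stay below this level, and the cut is the half-size copy of
    \<open>F\<close>.\<close>
  define b' where "b' = (b + a \<bullet> z) / 2"
  have b': "b < b'" "b' < a \<bullet> z" using above by (auto simp: b'_def)
  have cut: "vertex_cut R z a b'"
  proof
    show "polytope R" by (rule polyR)
    show "z extreme_point_of R" by (rule apex_extreme)
    show "b' < a \<bullet> z" by (rule b')
    fix w assume w: "w extreme_point_of R" "w \<noteq> z"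
    have "w \<in> P"
    proof (rule ccontr)
      assume "w \<notin> P"
      then have "w \<in> pyr" using w by (auto simp: extreme_point_of_def R_def)
      then have "w extreme_point_of pyr" using w(1) by (auto simp: extreme_point_of_def R_def)
      then have "w \<in> insert z F" unfolding pyr_def by (rule extreme_point_of_convex_hull)
      then show False using w \<open>w \<notin> P\<close> F_eq by blast
    qed
    then show "a \<bullet> w < b'" using below b' by force
  qed
  have "R \<inter> {x. a \<bullet> x = b'} = (\<lambda>x. midpoint z x) ` F"
  proof (intro equalityI subsetI)
    fix y assume y: "y \<in> R \<inter> {x. a \<bullet> x = b'}"
    then have "y \<notin> P" using below b' by force
    then have yp: "y \<in> convex hull (insert z F)" using y by (auto simp: R_def pyr_def)
    have "F \<noteq> {}" using facet by (auto simp: facet_of_def)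
    then obtain u f where f: "0 \<le> u" "u \<le> 1" "f \<in> F" "y = (1 - u) *\<^sub>R z + u *\<^sub>R f"
      using yp by (auto simp: convex_hull_insert_alt hull_same[of convex F] convF)
    have "a \<bullet> f = b" using f(3) F_sub by blast
    then have "b' = (1 - u) * (a \<bullet> z) + u * b" using y f(4) by (auto simp: inner_add_right)
    then have "(a \<bullet> z - b) * (u - 1/2) = 0" by (simp add: b'_def field_simps)
    then have u: "u = 1/2" using above by simp
    have "y = midpoint z f" unfolding f(4) u by (simp add: midpoint_def scaleR_add_right)
    then show "y \<in> (\<lambda>x. midpoint z x) ` F" using f(3) by blast
  next
    fix y assume "y \<in> (\<lambda>x. midpoint z x) ` F"
    then obtain f where f: "f \<in> F" "y = midpoint z f" by blast
    have "z \<in> convex hull (insert z F)" "f \<in> convex hull (insert z F)" using f by (simp_all add: hull_inc)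
    then have "y \<in> convex hull (insert z F)"
      unfolding f(2) using closed_segment_subset[OF _ _ convex_convex_hull] midpoint_in_closed_segment by blast
    moreover have "a \<bullet> y = b'"
      using f F_sub by (auto simp: midpoint_def b'_def inner_add_right)
    ultimately show "y \<in> R \<inter> {x. a \<bullet> x = b'}" by (simp add: R_def pyr_def)
  qed
  then have "3 simplex (R \<inter> {x. a \<bullet> x = b'})" using simplex_half_image[OF F] by simp
  then show ?thesis using ad sv cut unfolding cut_adapter_def by blast
qed

text \<open>The constants add up the contributions of \<open>F\<close>, of the pyramid over
  \<open>g\<close> and of a tetrahedron with face numbers 4, 6, 4. Facets, for example, grow by
  \<open>f_2(F) - 1\<close>, then by \<open>f_1(g)\<close>, then by 3.\<close>

lemma three_stackings:
  fixes P :: "'a::euclidean_space set"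
  assumes D: "DIM('a) = 4" and P: "polytope P" "aff_dim P = 4"
    and F: "F facet_of P" and g: "g facet_of F"
  obtains PA :: "'a set" and v a b where "cut_adapter PA v a b"
    "f_num 0 PA = f_num 0 P + 3"
    "f_num 1 PA = f_num 1 P + f_num 0 F + f_num 0 g + 5"
    "f_num 2 PA = f_num 2 P + f_num 1 F + f_num 0 g + f_num 1 g + 6"
    "f_num 3 PA = f_num 3 P + f_num 2 F + f_num 1 g + 2"
proof -
  have dimF: "aff_dim F = 3" and dimg: "aff_dim g = 2" using F g P(2) by (auto simp: facet_of_def)
  have pF: "polytope F" using face_of_polytope_polytope[OF P(1) facet_of_imp_face_of[OF F]] .
  have pg: "polytope g" using face_of_polytope_polytope[OF pF facet_of_imp_face_of[OF g]] .
  have gF: "g \<subseteq> F" using facet_of_imp_subset[OF g] .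
  obtain x a1 b1 where "stacked P F x a1 b1" using exists_stacked[OF P(1) _ F] P(2) D by auto
  then interpret S1: stacked P F x a1 b1 .
  define F1 where "F1 = convex hull (insert x g)"
  have xg: "x \<notin> affine hull g" using S1.x_notin hull_mono[OF gF] by blast
  have F1: "F1 facet_of S1.R" using S1.facet_R_iff g P(2) unfolding F1_def by auto
  have dR1: "aff_dim S1.R = 4" using S1.aff_dim_R P(2) by simp
  have pF1: "polytope F1" unfolding F1_def by (rule polytope_pyramid[OF pg])
  obtain y a2 b2 where "stacked S1.R F1 y a2 b2" using exists_stacked[OF S1.polyR _ F1] dR1 D by auto
  then interpret S2: stacked S1.R F1 y a2 b2 .
  have dR2: "aff_dim S2.R = 4" using S2.aff_dim_R dR1 by simp
  have "3 \<le> card (ifaces 1 g)" using polygon_edges_ge(1)[OF pg dimg] by (simp add: f_num_eq_card)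
  then obtain E where "E \<subseteq> ifaces 1 g" "card E = 3" by (rule obtain_subset_with_card_n)
  then obtain e e' where e: "e \<in> ifaces 1 g" "e' \<in> ifaces 1 g" "e \<noteq> e'"
    by (auto simp: card_3_iff)
  have eg: "k facet_of g \<longleftrightarrow> k \<in> ifaces 1 g" for k by (rule facet_of_iff_ifaces) (simp add: dimg)
  \<comment> \<open>The tetrahedron on the edge \<open>k\<close> and the two apices \<open>x\<close>
    and \<open>y\<close>. Different edges give different tetrahedra, so \<open>T e'\<close> remains
    a facet when the last apex is put over \<open>T e\<close>.\<close>
  define T where "T k = convex hull (insert y (convex hull (insert x k)))" for k
  have T: "T k facet_of S2.R" "3 simplex (T k)" if k: "k \<in> ifaces 1 g" for k
  proof -
    have kf: "k facet_of g" using k eg by blast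
    have K: "convex hull (insert x k) facet_of F1"
      unfolding F1_def by (rule facet_of_pyramid[OF pg xg kf])
    show "T k facet_of S2.R" unfolding T_def using S2.facet_R_iff K dR1 by auto
    have "polytope k" "aff_dim k = 1"
      using k face_of_polytope_polytope[OF pg] by (auto simp: ifaces_def)
    then obtain n where "n simplex k" using polytope_lowdim_imp_simplex[of k] by auto
    then have "1 simplex k" using aff_dim_simplex[of n k] \<open>aff_dim k = 1\<close> by simp
    then have "2 simplex (convex hull (insert x k))"
      using pyramid_simplex[OF xg facet_of_imp_subset[OF kf]] by fastforce
    then show "3 simplex (T k)"
      unfolding T_def using pyramid_simplex[OF S2.x_notin facet_of_imp_subset[OF K]] by fastforce
  qed
  have neq: "T e' \<noteq> T e"
  proof
    assume "T e' = T e"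
    then have "convex hull (insert x e') = convex hull (insert x e)"
      unfolding T_def
      using pyramid_inj[OF S2.x_notin] facet_of_pyramid[OF pg xg] e eg unfolding F1_def by blast
    then have "e' = e" using pyramid_inj[OF xg] e eg by blast
    then show False using e(3) by simp
  qed
  obtain z a3 b3 where st3: "stacked S2.R (T e) z a3 b3"
    using exists_stacked[OF S2.polyR _ T(1)[OF e(1)]] dR2 D by auto
  interpret S3: stacked S2.R "T e" z a3 b3 by (rule st3)
  obtain b where A: "cut_adapter S3.R z a3 b"
    using cut_adapter_stacked[OF st3 dR2 T(2)[OF e(1)] T(1)[OF e(2)] neq T(2)[OF e(2)]] by blast
  note f1 = S1.f_num_R(1) S1.f_num_R(2)[of 0] S1.f_num_R(2)[of 1] S1.f_num_R(3)[of 2]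
    and f2 = S2.f_num_R(1) S2.f_num_R(2)[of 0] S2.f_num_R(2)[of 1] S2.f_num_R(3)[of 2]
    and f3 = S3.f_num_R(1) S3.f_num_R(2)[of 0] S3.f_num_R(2)[of 1] S3.f_num_R(3)[of 2]
  note fp = f_num_pyramid[OF pg xg, folded F1_def]
  have s: "f_num 0 (T e) = 4" "f_num (Suc 0) (T e) = 6" "f_num 2 (T e) = 4"
    using f_num_simplex[OF T(2)[OF e(1)], of 0] f_num_simplex[OF T(2)[OF e(1)], of 1] f_num_simplex[OF T(2)[OF e(1)], of 2]
    by (simp_all add: eval_nat_numeral)
  have g2: "f_num 2 g = 1" using f_num_self[OF polytope_imp_convex[OF pg], of 2] dimg by simp
  have F1n: "f_num 0 F1 = f_num 0 g + 1" "f_num (Suc 0) F1 = f_num 1 g + f_num 0 g" "f_num 2 F1 = 1 + f_num 1 g"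
    using fp(1) fp(2)[of 0] fp(2)[of 1] g2 by (simp_all add: numeral_2_eq_2)
  have "f_num 0 S3.R = f_num 0 P + 3" using f1(1) f2(1) f3(1) P(2) dR1 dR2 by simp
  moreover have "f_num 1 S3.R = f_num 1 P + f_num 0 F + f_num 0 g + 5"
    using f1(2) f2(2) f3(2) P(2) dR1 dR2 s F1n by simp
  moreover have "f_num 2 S3.R = f_num 2 P + f_num 1 F + f_num 0 g + f_num 1 g + 6"
    using f1(3) f2(3) f3(3) P(2) dR1 dR2 s F1n by (simp add: numeral_2_eq_2)
  moreover have "f_num 3 S3.R = f_num 3 P + f_num 2 F + f_num 1 g + 2"
    using f1(4) f2(4) f3(4) P(2) dR1 dR2 s F1n by (simp add: numeral_3_eq_3 numeral_2_eq_2)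
  ultimately show thesis by (rule that[OF A])
qed

section \<open>Estimates with the exponent 2/3 and the cost of an adapter\<close>

lemma powr_two_thirds_mono: "m \<le> n \<Longrightarrow> real m powr (2/3) \<le> real n powr (2/3)"
  by (rule powr_mono2) auto

text \<open>The cube of 3/2 is 27/8, which is below 4, so 3/2 is at most
  \<open>2^(2/3)\<close>.\<close>

lemma powr_two_thirds_double:
  assumes "2 * m \<le> n"
  shows "3 / 2 * real m powr (2/3) \<le> real n powr (2/3)"
proof -
  have "(3/2 :: real) = ((3/2) ^ 3) powr (1/3)" by (simp add: powr_powr flip: powr_numeral)
  also have "\<dots> \<le> 4 powr (1/3)" by (rule powr_mono2) (auto simp: power3_eq_cube)
  also have "(4::real) = 2 powr 2" by simp
  also have "(2 powr 2) powr (1/3) = (2::real) powr (2/3)" by (simp only: powr_powr) simp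
  finally have "3 / 2 * real m powr (2/3) \<le> 2 powr (2/3) * real m powr (2/3)"
    by (rule mult_right_mono) simp
  also have "\<dots> = real (2 * m) powr (2/3)" by (simp add: powr_mult)
  also have "\<dots> \<le> real n powr (2/3)" using assms by (rule powr_two_thirds_mono)
  finally show ?thesis .
qed

lemma all_le_three_iff: "(\<forall>i\<le>3. Q i) \<longleftrightarrow> Q 0 \<and> Q 1 \<and> Q 2 \<and> Q (3::nat)"
  by (auto simp: le_Suc_eq numeral_3_eq_3 numeral_2_eq_2)

lemma exists_cut_adapter:
  fixes P :: "'a::euclidean_space set"
  assumes D: "DIM('a) = 4" and P: "d_polytope 4 P"
  obtains PA :: "'a set" and v a b where "cut_adapter PA v a b"
    "\<forall>i\<le>3. f_num i P < f_num i PA"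
    "\<forall>i\<le>3. real (f_num i PA) - real (f_num i P) \<le> 6 * real (f_num i P) powr (2/3) + 16"
proof -
  have pP: "polytope P" and dP: "aff_dim P = 4" using P by (auto simp: d_polytope_def)
  note ge = polytope4_edges_ge[OF pP dP]
  have fac3: "F facet_of Q \<longleftrightarrow> F \<in> ifaces 3 Q" if "aff_dim Q = 4" for F Q :: "'a set"
    by (rule facet_of_iff_ifaces) (simp add: that)
  have fac2: "g facet_of F \<longleftrightarrow> g \<in> ifaces 2 F" if "aff_dim F = 3" for g F :: "'a set"
    by (rule facet_of_iff_ifaces) (simp add: that)
  show thesis
  proof (cases "f_num 0 P \<le> f_num 3 P")
    case True
    obtain F where F: "F \<in> ifaces 3 P" "real (f_num 0 F) \<le> 4 / 3 * real (f_num 0 P) powr (2 / 3) + 1"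
      using polytope4_small_facet[OF pP dP True] .
    have Ff: "polytope F" "aff_dim F = 3" using F face_of_polytope_polytope[OF pP] by (auto simp: ifaces_def)
    obtain g where g: "g \<in> ifaces 2 F" "f_num 1 g \<le> 5" "f_num 0 g \<le> 5"
      using polytope3_small_face[OF Ff] .
    note b = polytope3_bounds[OF Ff] polytope3_euler_le[OF Ff]
    obtain PA :: "'a set" and v a b where A: "cut_adapter PA v a b"
      "f_num 0 PA = f_num 0 P + 3"
      "f_num 1 PA = f_num 1 P + f_num 0 F + f_num 0 g + 5"
      "f_num 2 PA = f_num 2 P + f_num 1 F + f_num 0 g + f_num 1 g + 6"
      "f_num 3 PA = f_num 3 P + f_num 2 F + f_num 1 g + 2"
      using three_stackings[OF D pP dP] F(1) g(1) fac3[OF dP] fac2[OF Ff(2)] by metis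
    define s where "s = real (f_num 0 P) powr (2/3)"
    have s: "s \<le> real (f_num 1 P) powr (2/3)" "s \<le> real (f_num 2 P) powr (2/3)" "s \<le> real (f_num 3 P) powr (2/3)" "0 \<le> s"
      unfolding s_def using True ge by (auto intro!: powr_two_thirds_mono)
    have k: "real (f_num 0 F) \<le> 4/3 * s + 1" using F(2) by (simp add: s_def)
    \<comment> \<open>Euler's inequality together with \<open>3 f_2 <= 2 f_1\<close>. With
      \<open>k\<close> vertices in \<open>F\<close> the four costs are at most 3,
      \<open>k + 10\<close>, \<open>3k + 10\<close> and \<open>2k + 3\<close>.\<close>
    have k1: "f_num 1 F + 6 \<le> 3 * f_num 0 F" "f_num 2 F + 4 \<le> 2 * f_num 0 F" using b by linarith+
    have "real (f_num 1 F) + 6 \<le> 3 * real (f_num 0 F)" "real (f_num 2 F) + 4 \<le> 2 * real (f_num 0 F)"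
      using k1 by linarith+
    then show thesis
      using that[OF A(1)] A(2-5) g(2,3) s k unfolding all_le_three_iff s_def[symmetric] by simp
  next
    case False
    then obtain v where v: "v extreme_point_of P"
      "real (card {F \<in> ifaces 3 P. v \<in> F}) \<le> 4 / 3 * real (f_num 3 P) powr (2 / 3) + 1"
      using polytope4_small_vertex[OF pP dP] by auto
    obtain a b where "vertex_cut P v a b" using exists_vertex_cut[OF pP v(1)] .
    then interpret vertex_cut P v a b .
    have "P \<noteq> {v}" using dP by auto
    then have d: "aff_dim (P \<inter> Hle) = 4" "aff_dim (P \<inter> H) = 3" using dims dP by auto
    have k2: "f_num 2 (P \<inter> H) = card {F \<in> ifaces 3 P. v \<in> F}" using f_num_slice[of 2] by simp
    have GF: "P \<inter> H facet_of (P \<inter> Hle)" using fac3[OF d(1)] slice_face_of d(2) by (simp add: ifaces_def)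
    obtain g where g: "g \<in> ifaces 2 (P \<inter> H)" "f_num 1 g \<le> 5" "f_num 0 g \<le> 5"
      using polytope3_small_face[OF polytope_slice(1) d(2)] .
    note b = polytope3_bounds[OF polytope_slice(1) d(2)] polytope3_euler_le[OF polytope_slice(1) d(2)]
    have t: "f_num 0 (P \<inter> Hle) + 1 = f_num 0 P + f_num 0 (P \<inter> H)" "f_num 1 (P \<inter> Hle) = f_num 1 P + f_num 1 (P \<inter> H)"
      "f_num 2 (P \<inter> Hle) = f_num 2 P + f_num 2 (P \<inter> H)" "f_num 3 (P \<inter> Hle) = f_num 3 P + 1"
      using f_num_trunc[of 0] f_num_trunc[of 1] f_num_trunc[of 2] f_num_trunc[of 3]
        f_num_self[OF polytope_imp_convex[OF polytope_slice(1)], of 3] d(2) by simp_all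
    obtain PA :: "'a set" and v' a' b' where A: "cut_adapter PA v' a' b'"
      "f_num 0 PA = f_num 0 (P \<inter> Hle) + 3"
      "f_num 1 PA = f_num 1 (P \<inter> Hle) + f_num 0 (P \<inter> H) + f_num 0 g + 5"
      "f_num 2 PA = f_num 2 (P \<inter> Hle) + f_num 1 (P \<inter> H) + f_num 0 g + f_num 1 g + 6"
      "f_num 3 PA = f_num 3 (P \<inter> Hle) + f_num 2 (P \<inter> H) + f_num 1 g + 2"
      using three_stackings[OF D polytope_slice(2) d(1) GF] g(1) fac2[OF d(2)] by metis
    define s where "s = real (f_num 3 P) powr (2/3)"
    \<comment> \<open>Truncation included, the costs for \<open>k\<close> 2-faces of the cut are at
      most \<open>2k - 2\<close>, \<open>5k\<close>, \<open>4k + 10\<close> and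
      \<open>k + 8\<close>. The second one is why \<open>f_1\<close> needs the factor 3/2, available
      from \<open>f_1 >= 2 f_0 >= 2 f_3\<close>.\<close>
    have s: "s \<le> real (f_num 0 P) powr (2/3)" "3/2 * s \<le> real (f_num 1 P) powr (2/3)" "s \<le> real (f_num 2 P) powr (2/3)" "0 \<le> s"
      unfolding s_def using False ge powr_two_thirds_double[of "f_num 3 P" "f_num 1 P"]
      by (auto intro!: powr_two_thirds_mono)
    have k: "real (f_num 2 (P \<inter> H)) \<le> 4/3 * s + 1" using v(2) k2 by (simp add: s_def)
    have k1: "f_num 1 (P \<inter> H) + 6 \<le> 3 * f_num 2 (P \<inter> H)" "f_num 0 (P \<inter> H) + 4 \<le> 2 * f_num 2 (P \<inter> H)" using b by linarith+
    then have k': "real (f_num 1 (P \<inter> H)) + 6 \<le> 3 * real (f_num 2 (P \<inter> H))" "real (f_num 0 (P \<inter> H)) + 4 \<le> 2 * real (f_num 2 (P \<inter> H))"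
      by linarith+
    have t0: "real (f_num 0 (P \<inter> Hle)) + 1 = real (f_num 0 P) + real (f_num 0 (P \<inter> H))" using t(1) by linarith
    have "f_num 0 P < f_num 0 PA" using A(2) t(1) b by linarith
    moreover have "real (f_num 0 PA) - real (f_num 0 P) \<le> 6 * real (f_num 0 P) powr (2/3) + 16"
      using A(2) t0 k k' s by linarith
    ultimately show thesis
      using that[OF A(1)] A(3-5) t(2-4) g(2,3) s k k' unfolding all_le_three_iff s_def[symmetric] by simp
  qed
qed

section \<open>Projective images\<close>

text \<open>Convexity and the face property speak of open segments only, so any injection that maps
  open segments onto open segments respects both. This covers projective maps and changes of ambient
  space.\<close>

lemma segment_image_face_of_iff:
  fixes f :: "'a::euclidean_space \<Rightarrow> 'b::euclidean_space"
  assumes S: "convex S" and inj: "inj_on f S"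
    and seg: "\<And>x y. x \<in> S \<Longrightarrow> y \<in> S \<Longrightarrow> f ` open_segment x y = open_segment (f x) (f y)"
    and K: "K \<subseteq> S"
  shows "f ` K face_of f ` S \<longleftrightarrow> K face_of S"
proof -
  have sub: "open_segment x y \<subseteq> S" if "x \<in> S" "y \<in> S" for x y
    using that S by (simp add: convex_contains_open_segment)
  have "open_segment (f x) (f y) \<subseteq> f ` K \<longleftrightarrow> open_segment x y \<subseteq> K" if "x \<in> K" "y \<in> K" for x y
    using inj_on_image_subset_iff[OF inj sub K, of x y] that K seg[of x y] by auto
  then have 1: "convex (f ` K) \<longleftrightarrow> convex K"
    unfolding convex_contains_open_segment by auto
  have mem: "f x \<in> f ` T \<longleftrightarrow> x \<in> T" if "x \<in> S" "T \<subseteq> S" for x T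
    using inj_on_image_mem_iff[OF inj that] .
  have "f z \<in> open_segment (f x) (f y) \<longleftrightarrow> z \<in> open_segment x y" if "x \<in> S" "y \<in> S" "z \<in> S" for x y z
    using mem[OF that(3) sub[OF that(1,2)]] seg[OF that(1,2)] by simp
  then have 2: "(\<forall>a\<in>f ` S. \<forall>b\<in>f ` S. \<forall>x\<in>f ` K. x \<in> open_segment a b \<longrightarrow> a \<in> f ` K \<and> b \<in> f ` K)
    \<longleftrightarrow> (\<forall>a\<in>S. \<forall>b\<in>S. \<forall>x\<in>K. x \<in> open_segment a b \<longrightarrow> a \<in> K \<and> b \<in> K)"
    using mem K by (simp add: subset_iff)
  show ?thesis unfolding face_of_def 1 2 using K by auto
qed

lemma f_num_segment_image:
  fixes f :: "'a::euclidean_space \<Rightarrow> 'b::euclidean_space"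
  assumes S: "convex S" and inj: "inj_on f S"
    and seg: "\<And>x y. x \<in> S \<Longrightarrow> y \<in> S \<Longrightarrow> f ` open_segment x y = open_segment (f x) (f y)"
    and dim: "\<And>K. K \<subseteq> S \<Longrightarrow> aff_dim (f ` K) = aff_dim K"
  shows "f_num i (f ` S) = f_num i S"
proof -
  note iff = segment_image_face_of_iff[OF S inj seg]
  have "ifaces i (f ` S) = (`) f ` ifaces i S"
  proof (intro equalityI subsetI)
    fix T assume T: "T \<in> ifaces i (f ` S)"
    then have "T \<subseteq> f ` S" using face_of_imp_subset by (auto simp: ifaces_def)
    then obtain K where K: "K \<subseteq> S" "T = f ` K" by (rule subset_imageE)
    then have "K \<in> ifaces i S" using T iff[OF _ _ K(1)] dim[OF K(1)] by (simp add: ifaces_def)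
    then show "T \<in> (`) f ` ifaces i S" using K by blast
  next
    fix T assume "T \<in> (`) f ` ifaces i S"
    then obtain K where K: "K face_of S" "aff_dim K = int i" "T = f ` K" by (auto simp: ifaces_def)
    then show "T \<in> ifaces i (f ` S)"
      using iff[OF _ _ face_of_imp_subset[OF K(1)]] dim[OF face_of_imp_subset[OF K(1)]] by (simp add: ifaces_def)
  qed
  moreover have "inj_on ((`) f) (ifaces i S)"
    by (rule inj_on_subset[OF inj_on_image_Pow[OF inj]]) (auto simp: ifaces_def dest: face_of_imp_subset)
  ultimately show ?thesis unfolding f_num_eq_card by (simp add: card_image)
qed

text \<open>Expressing the affine dimension by a span makes it invariant under the rescaling in
  \<open>projective_map\<close>.\<close>

lemma aff_dim_eq_dim_lift:
  fixes S :: "'a::euclidean_space set"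
  shows "aff_dim S = int (dim ((\<lambda>x. (x, 1::real)) ` S)) - 1"
proof -
  let ?T = "(\<lambda>x. (x, 1::real)) ` S"
  have T: "?T = (+) (0, 1) ` (\<lambda>x. (x, 0)) ` S" by (auto simp: image_image)
  have "linear (\<lambda>x::'a. (x, 0::real))" by (auto intro!: linearI)
  moreover have "inj (\<lambda>x::'a. (x, 0::real))" by (auto simp: inj_on_def)
  ultimately have dT: "aff_dim ?T = aff_dim S"
    unfolding T aff_dim_translation_eq by (rule aff_dim_injective_linear_image)
  have "?T \<subseteq> {z. (0, 1) \<bullet> z = 1}" by (auto simp: inner_prod_def)
  then have "affine hull ?T \<subseteq> {z. (0, 1) \<bullet> z = 1}"
    by (rule hull_minimal) (rule affine_hyperplane)
  then have "0 \<notin> affine hull ?T" by force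
  then have "aff_dim (insert 0 ?T) = aff_dim ?T + 1" by (simp add: aff_dim_insert)
  moreover have "aff_dim (insert 0 ?T) = int (dim (insert 0 ?T))"
    by (intro aff_dim_zero hull_inc) simp
  moreover have "dim (insert 0 ?T) = dim ?T" by (simp add: dim_insert span_zero)
  ultimately show ?thesis using dT by simp
qed

text \<open>On a convex set nonvanishing denominators have a constant sign. Taking it positive makes
  the rescaled weights of a convex combination nonnegative.\<close>

locale positive_projective =
  fixes L :: "'a::euclidean_space \<times> real \<Rightarrow> 'a \<times> real" and S :: "'a set"
  assumes lin: "linear L" and inj: "inj L" and convS: "convex S"
    and pos: "\<And>x. x \<in> S \<Longrightarrow> 0 < snd (L (x, 1))"
begin

abbreviation "\<pi> \<equiv> projective_map L"
definition "w x = snd (L (x, 1))"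

lemma w_pos: "x \<in> S \<Longrightarrow> 0 < w x" using pos by (simp add: w_def)

lemma L_lift: "x \<in> S \<Longrightarrow> L (x, 1) = w x *\<^sub>R (\<pi> x, 1)"
  using pos[of x] by (simp add: projective_map_def w_def prod_eq_iff)

text \<open>Segments go to segments with a changed parameter: the denominators act as masses at the
  end points, and \<open>u\<close> becomes \<open>u * w y / W\<close>.\<close>

lemma comb:
  assumes xy: "x \<in> S" "y \<in> S" and u: "0 \<le> u" "u \<le> 1"
  defines "W \<equiv> (1 - u) * w x + u * w y"
  shows "0 < W" "\<pi> ((1 - u) *\<^sub>R x + u *\<^sub>R y) = (1 - u * w y / W) *\<^sub>R \<pi> x + (u * w y / W) *\<^sub>R \<pi> y"
proof -
  show W: "0 < W"
  proof (cases "u = 0")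
    case True then show ?thesis using w_pos xy by (simp add: W_def)
  next
    case False
    then have "0 < u * w y" using u w_pos xy by simp
    moreover have "0 \<le> (1 - u) * w x" using u w_pos[OF xy(1)] by simp
    ultimately show ?thesis by (simp add: W_def)
  qed
  have "((1 - u) *\<^sub>R x + u *\<^sub>R y, 1::real) = (1 - u) *\<^sub>R (x, 1) + u *\<^sub>R (y, 1)" by simp
  then have "L ((1 - u) *\<^sub>R x + u *\<^sub>R y, 1) = (1 - u) *\<^sub>R L (x, 1) + u *\<^sub>R L (y, 1)"
    by (simp only: linear_add[OF lin] linear_scale[OF lin])
  also have "\<dots> = ((1 - u) * w x) *\<^sub>R (\<pi> x, 1) + (u * w y) *\<^sub>R (\<pi> y, 1)"
    by (simp only: L_lift[OF xy(1)] L_lift[OF xy(2)] scaleR_scaleR)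
  finally have L: "L ((1 - u) *\<^sub>R x + u *\<^sub>R y, 1) = ((1 - u) * w x) *\<^sub>R (\<pi> x, 1) + (u * w y) *\<^sub>R (\<pi> y, 1)" .
  have "\<pi> ((1 - u) *\<^sub>R x + u *\<^sub>R y) = (((1 - u) * w x) *\<^sub>R \<pi> x + (u * w y) *\<^sub>R \<pi> y) /\<^sub>R W"
    by (simp add: projective_map_def[of L "(1 - u) *\<^sub>R x + u *\<^sub>R y"] L W_def)
  also have "\<dots> = ((1 - u) * w x / W) *\<^sub>R \<pi> x + (u * w y / W) *\<^sub>R \<pi> y"
    by (simp add: scaleR_add_right divide_inverse mult.commute)
  also have "(1 - u) * w x / W = 1 - u * w y / W"
  proof -
    have "(1 - u) * w x / W + u * w y / W = 1" using W by (simp add: W_def add_divide_distrib[symmetric])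
    then show ?thesis by linarith
  qed
  finally show "\<pi> ((1 - u) *\<^sub>R x + u *\<^sub>R y) = (1 - u * w y / W) *\<^sub>R \<pi> x + (u * w y / W) *\<^sub>R \<pi> y" .
qed

lemma inj_on_pi: "inj_on \<pi> S"
proof (rule inj_onI)
  fix x y assume xy: "x \<in> S" "y \<in> S" "\<pi> x = \<pi> y"
  have "L (w y *\<^sub>R (x, 1)) = w y *\<^sub>R L (x, 1)" by (rule linear_scale[OF lin])
  also have "\<dots> = w x *\<^sub>R L (y, 1)" using L_lift xy by (simp add: mult.commute)
  also have "\<dots> = L (w x *\<^sub>R (y, 1))" by (rule linear_scale[OF lin, symmetric])
  finally have eq: "w y *\<^sub>R (x, 1::real) = w x *\<^sub>R (y, 1)" using inj by (rule injD[rotated])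
  have 1: "w y = w x" using arg_cong[OF eq, of snd] by simp
  have "w x *\<^sub>R x = w x *\<^sub>R y" using arg_cong[OF eq, of fst] unfolding 1 by simp
  then show "x = y" using w_pos[OF xy(1)] by (metis less_irrefl scaleR_left_imp_eq)
qed

lemma open_segment_image:
  assumes xy: "x \<in> S" "y \<in> S"
  shows "\<pi> ` open_segment x y = open_segment (\<pi> x) (\<pi> y)"
proof (cases "x = y")
  case True then show ?thesis by simp
next
  case False
  then have ne: "\<pi> x \<noteq> \<pi> y" using inj_on_pi xy by (auto simp: inj_on_def)
  have wx: "0 < w x" and wy: "0 < w y" using w_pos xy by auto
  show ?thesis
  proof (intro equalityI subsetI)
    fix z assume "z \<in> \<pi> ` open_segment x y"
    then obtain u where u: "0 < u" "u < 1" "z = \<pi> ((1 - u) *\<^sub>R x + u *\<^sub>R y)" by (auto simp: in_segment)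
    define W where "W = (1 - u) * w x + u * w y"
    have W: "0 < W" "z = (1 - u * w y / W) *\<^sub>R \<pi> x + (u * w y / W) *\<^sub>R \<pi> y"
      using comb[OF xy, of u] u by (simp_all add: W_def)
    have "0 < u * w y / W" using u wy W by simp
    moreover have "u * w y < W" using u wx by (simp add: W_def)
    then have "u * w y / W < 1" using W by simp
    ultimately show "z \<in> open_segment (\<pi> x) (\<pi> y)" using W(2) ne unfolding in_segment by blast
  next
    fix z assume "z \<in> open_segment (\<pi> x) (\<pi> y)"
    then obtain t where t: "0 < t" "t < 1" "z = (1 - t) *\<^sub>R \<pi> x + t *\<^sub>R \<pi> y" by (auto simp: in_segment)
    \<comment> \<open>This \<open>u\<close> solves \<open>u * w y / W = t\<close>, inverting the
      change of parameter.\<close>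
    define D where "D = (1 - t) * w y + t * w x"
    have D: "0 < D" using t wx wy by (simp add: D_def add_pos_pos)
    define u where "u = t * w x / D"
    have "t * w x < D" using t wy by (simp add: D_def)
    then have u: "0 < u" "u < 1" using t wx D by (auto simp: u_def)
    have u1: "1 - u = (1 - t) * w y / D" using D by (simp add: u_def D_def field_simps)
    have W: "(1 - u) * w x + u * w y = w x * w y / D"
      unfolding u1 unfolding u_def using D by (simp add: field_simps)
    have "u * w y / ((1 - u) * w x + u * w y) = t"
      unfolding W unfolding u_def using D wx wy by (simp add: field_simps)
    then have "\<pi> ((1 - u) *\<^sub>R x + u *\<^sub>R y) = z"
      using comb(2)[OF xy, of u] u t(3) by simp
    moreover have "(1 - u) *\<^sub>R x + u *\<^sub>R y \<in> open_segment x y" using u False unfolding in_segment by blast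
    ultimately show "z \<in> \<pi> ` open_segment x y" by blast
  qed
qed

lemma aff_dim_image:
  assumes K: "K \<subseteq> S"
  shows "aff_dim (\<pi> ` K) = aff_dim K"
proof -
  let ?l = "\<lambda>x. (x, 1::real)"
  have "?l ` \<pi> ` K \<subseteq> span (L ` ?l ` K)"
  proof
    fix z assume "z \<in> ?l ` \<pi> ` K"
    then obtain x where x: "x \<in> K" "z = (\<pi> x, 1)" by blast
    then have "z = inverse (w x) *\<^sub>R L (x, 1)" using L_lift[of x] w_pos[of x] K by auto
    then show "z \<in> span (L ` ?l ` K)" using x by (auto intro: span_scale span_base)
  qed
  then have 1: "dim (?l ` \<pi> ` K) \<le> dim (L ` ?l ` K)" by (metis dim_span dim_subset)
  have "L ` ?l ` K \<subseteq> span (?l ` \<pi> ` K)"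
  proof
    fix z assume "z \<in> L ` ?l ` K"
    then obtain x where x: "x \<in> K" "z = w x *\<^sub>R (\<pi> x, 1)" using L_lift K by blast
    then show "z \<in> span (?l ` \<pi> ` K)" by (auto intro: span_scale span_base simp del: scaleR_Pair)
  qed
  then have 2: "dim (L ` ?l ` K) \<le> dim (?l ` \<pi> ` K)" by (metis dim_span dim_subset)
  have "dim (L ` ?l ` K) = dim (?l ` K)"
    using inj by (intro dim_image_eq lin) (auto intro: inj_on_subset)
  then show ?thesis using 1 2 unfolding aff_dim_eq_dim_lift by simp
qed

lemma f_num_image: "f_num i (\<pi> ` S) = f_num i S"
  by (rule f_num_segment_image[OF convS inj_on_pi open_segment_image aff_dim_image])

lemma convex_image:
  assumes "K \<subseteq> S" "convex K"
  shows "convex (\<pi> ` K)"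
  unfolding convex_contains_open_segment
proof (intro ballI)
  fix a b assume "a \<in> \<pi> ` K" "b \<in> \<pi> ` K"
  then obtain x y where "x \<in> K" "y \<in> K" "a = \<pi> x" "b = \<pi> y" by blast
  moreover from this have "\<pi> ` open_segment x y \<subseteq> \<pi> ` K"
    using assms(2) by (intro image_mono) (simp add: convex_contains_open_segment)
  ultimately show "open_segment a b \<subseteq> \<pi> ` K"
    using open_segment_image[of x y] assms(1) by (simp add: subset_iff)
qed

text \<open>For the inclusion from left to right, the points of \<open>S\<close> that are mapped
  into the hull of the image form a convex set containing \<open>X\<close>.\<close>

lemma convex_hull_image:
  assumes X: "X \<subseteq> S"
  shows "\<pi> ` (convex hull X) = convex hull (\<pi> ` X)"
proof (intro equalityI)
  have hS: "convex hull X \<subseteq> S" using X convS by (rule hull_minimal)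
  show "convex hull (\<pi> ` X) \<subseteq> \<pi> ` (convex hull X)"
    by (intro hull_minimal convex_image hS convex_convex_hull image_mono hull_subset)
  have "convex {x \<in> S. \<pi> x \<in> convex hull (\<pi> ` X)}" (is "convex ?M")
  proof (rule convex_contains_open_segment[THEN iffD2], intro ballI)
    fix x y assume x: "x \<in> ?M" and y: "y \<in> ?M"
    have "open_segment x y \<subseteq> S" using x y convS by (auto simp: convex_contains_open_segment)
    moreover have "\<pi> ` open_segment x y \<subseteq> convex hull (\<pi> ` X)"
    proof -
      have "\<pi> ` open_segment x y = open_segment (\<pi> x) (\<pi> y)" using open_segment_image x y by blast
      then show ?thesis
        using x y convex_convex_hull[of "\<pi> ` X"] by (simp add: convex_contains_open_segment)
    qed
    ultimately show "open_segment x y \<subseteq> ?M" by blast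
  qed
  moreover have "X \<subseteq> {x \<in> S. \<pi> x \<in> convex hull (\<pi> ` X)}"
    using X hull_subset[of "\<pi> ` X" convex] by blast
  ultimately have "convex hull X \<subseteq> {x \<in> S. \<pi> x \<in> convex hull (\<pi> ` X)}"
    by (intro hull_minimal)
  then show "\<pi> ` (convex hull X) \<subseteq> convex hull (\<pi> ` X)" by blast
qed

lemma polytope_image:
  assumes "polytope K" "K \<subseteq> S"
  shows "polytope (\<pi> ` K)"
proof -
  obtain X where X: "finite X" "K = convex hull X" using assms by (auto simp: polytope_def)
  then have "X \<subseteq> S" using assms(2) hull_subset[of X convex] by blast
  then show ?thesis using convex_hull_image X polytope_convex_hull[of "\<pi> ` X"] by simp
qed

end

text \<open>Stacking and gluing use interior points, and the two given polytopes may live in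
  different spaces. Translating a point of \<open>P\<close> to the origin and mapping the linear
  span isomorphically onto the target space preserves all face numbers.\<close>

lemma exists_full_dim_copy:
  fixes P :: "'a::euclidean_space set"
  assumes P: "polytope P" "aff_dim P = int DIM('b::euclidean_space)"
  obtains P' :: "'b::euclidean_space set" where "polytope P'" "aff_dim P' = int DIM('b)" "\<And>i. f_num i P' = f_num i P"
proof -
  have "P \<noteq> {}" using P by auto
  then obtain p where p: "p \<in> P" by blast
  define T where "T = span ((\<lambda>x. x - p) ` P)"
  have "int (dim T) = aff_dim P"
    using aff_dim_eq_dim_subtract[of p P] p by (simp add: T_def hull_inc)
  then have "dim T = dim (UNIV :: 'b set)" using P by simp
  then obtain f g where fg: "linear f" "linear g" "f ` T = (UNIV :: 'b set)" "\<And>x. x \<in> T \<Longrightarrow> g (f x) = x"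
    using isometries_subspaces[of T "UNIV :: 'b set"] by (metis T_def subspace_UNIV subspace_span)
  define h where "h x = f (x - p)" for x
  have inT: "x - p \<in> T" if "x \<in> P" for x using that unfolding T_def by (intro span_base) auto
  have gh: "g (h x) = x - p" if "x \<in> P" for x using fg(4)[OF inT[OF that]] by (simp add: h_def)
  have inj: "inj_on h P" using gh by (intro inj_onI) (metis diff_add_cancel)
  have comb: "h ((1 - u) *\<^sub>R x + u *\<^sub>R y) = (1 - u) *\<^sub>R h x + u *\<^sub>R h y" for u x y
  proof -
    have "(1 - u) *\<^sub>R x + u *\<^sub>R y - p = (1 - u) *\<^sub>R (x - p) + u *\<^sub>R (y - p)" by (simp add: algebra_simps)
    then show ?thesis unfolding h_def by (simp only: linear_add[OF fg(1)] linear_scale[OF fg(1)])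
  qed
  have seg: "h ` open_segment x y = open_segment (h x) (h y)" if "x \<in> P" "y \<in> P" for x y
  proof (cases "x = y")
    case True then show ?thesis by simp
  next
    case False
    then have "h x \<noteq> h y" using inj that by (auto simp: inj_on_def)
    then show ?thesis using False by (force simp: in_segment comb image_iff)
  qed
  have dim: "aff_dim (h ` K) = aff_dim K" if "K \<subseteq> P" for K
  proof (rule antisym)
    have 1: "h ` K = f ` (\<lambda>x. x - p) ` K" by (simp add: h_def image_image)
    show "aff_dim (h ` K) \<le> aff_dim K"
      unfolding 1 using aff_dim_linear_image_le[OF fg(1), of "(\<lambda>x. x - p) ` K"] by (simp add: aff_dim_translation_eq_subtract)
    have "g ` h ` K = (\<lambda>x. x - p) ` K" using gh that by (force simp: image_image intro: image_cong)
    then have "aff_dim K = aff_dim (g ` h ` K)" by (simp add: aff_dim_translation_eq_subtract)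
    also have "\<dots> \<le> aff_dim (h ` K)" by (rule aff_dim_linear_image_le[OF fg(2)])
    finally show "aff_dim K \<le> aff_dim (h ` K)" .
  qed
  have "h ` P = f ` (+) (- p) ` P" by (simp add: h_def image_image)
  then have "polytope (h ` P)" using polytope_linear_image[OF fg(1)] P(1) polytope_translation_eq by metis
  moreover have "aff_dim (h ` P) = int DIM('b)" using dim[of P] P by simp
  moreover have "f_num i (h ` P) = f_num i P" for i
    using f_num_segment_image[OF polytope_imp_convex[OF P(1)] inj seg dim] .
  ultimately show thesis using that by blast
qed

section \<open>Connected sums\<close>

text \<open>Passing to homogeneous coordinates raises the dimension by one, so the lifted set has
  exactly as many elements as its dimension.\<close>

lemma independent_lift:
  fixes C :: "'a::euclidean_space set"
  assumes "\<not> affine_dependent C"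
  shows "independent ((\<lambda>x. (x, 1::real)) ` C)"
proof -
  let ?B = "(\<lambda>x. (x, 1::real)) ` C"
  have fin: "finite C" using assms by (rule aff_independent_finite)
  have "int (card C) = aff_dim C + 1" by (rule aff_dim_affine_independent[OF assms])
  then have "card C = dim ?B" using aff_dim_eq_dim_lift[of C] by simp
  moreover have "card ?B = card C" by (intro card_image) (auto simp: inj_on_def)
  ultimately have card: "card ?B = dim ?B" by simp
  obtain B' where B': "B' \<subseteq> ?B" "independent B'" "?B \<subseteq> span B'" "card B' = dim ?B"
    by (rule basis_exists)
  have "B' = ?B" using fin B'(1,4) card by (intro card_subset_eq) auto
  then show ?thesis using B'(2) by simp
qed

lemma span_lift:
  fixes C :: "'a::euclidean_space set"
  assumes "aff_dim C = int DIM('a)"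
  shows "span ((\<lambda>x. (x, 1::real)) ` C) = UNIV"
proof -
  have "dim ((\<lambda>x. (x, 1::real)) ` C) = DIM('a \<times> real)"
    using aff_dim_eq_dim_lift[of C] assms by simp
  then show ?thesis using dim_eq_full by blast
qed

text \<open>The affine map that carries one affine frame to another, written in homogeneous
  coordinates; preservation of the last coordinate is what makes it affine.\<close>

lemma exists_affine_lift:
  fixes C D :: "'a::euclidean_space set"
  assumes C: "\<not> affine_dependent C" "aff_dim C = int DIM('a)"
    and D: "\<not> affine_dependent D" "aff_dim D = int DIM('a)" and \<beta>: "bij_betw \<beta> C D"
  obtains L :: "'a \<times> real \<Rightarrow> 'a \<times> real" where "linear L" "inj L" "\<And>x. x \<in> C \<Longrightarrow> L (x, 1) = (\<beta> x, 1)"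
    "\<And>z. snd (L z) = snd z"
proof -
  let ?l = "\<lambda>x::'a. (x, 1::real)"
  obtain L where L: "linear L" "\<And>z. z \<in> ?l ` C \<Longrightarrow> L z = ?l (\<beta> (fst z))"
    using linear_independent_extend[OF independent_lift[OF C(1)], of "\<lambda>z. ?l (\<beta> (fst z))"] by blast
  have Lx: "L (x, 1) = (\<beta> x, 1)" if "x \<in> C" for x using L(2)[of "(x, 1)"] that by simp
  have "?l ` D \<subseteq> range L"
  proof
    fix z assume "z \<in> ?l ` D"
    then obtain x where "x \<in> C" "z = (\<beta> x, 1)" using \<beta> by (auto simp: bij_betw_def)
    then show "z \<in> range L" using Lx[of x] by (metis rangeI)
  qed
  moreover have "subspace (range L)" by (rule linear_subspace_image[OF L(1) subspace_UNIV])
  ultimately have "span (?l ` D) \<subseteq> range L" by (rule span_minimal)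
  then have "surj L" using span_lift[OF D(2)] by auto
  then have "inj L" using linear_surjective_imp_injective[OF L(1)] by simp
  moreover have "snd (L z) = snd z" for z
  proof (rule linear_eq_on[of "\<lambda>z. snd (L z)" snd z "?l ` C"])
    show "linear (\<lambda>z. snd (L z))" using linear_compose[OF L(1) linear_snd] by (simp add: o_def)
    show "linear (snd :: 'a \<times> real \<Rightarrow> real)" by (rule linear_snd)
    show "z \<in> span (?l ` C)" using span_lift[OF C(2)] by simp
    show "snd (L y) = snd y" if "y \<in> ?l ` C" for y using Lx that by auto
  qed
  ultimately show thesis using that L(1) Lx by blast
qed

lemma facet_insert_independent:
  fixes C :: "'a::euclidean_space set"
  assumes "\<not> affine_dependent C" "int (card C) = int DIM('a)" "q \<notin> affine hull C"
  shows "\<not> affine_dependent (insert q C)" "aff_dim (insert q C) = int DIM('a)"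
proof -
  show 1: "\<not> affine_dependent (insert q C)"
    using assms affine_independent_insert by blast
  show "aff_dim (insert q C) = int DIM('a)"
    using aff_dim_affine_independent[OF assms(1)] assms(2,3) by (simp add: aff_dim_insert)
qed

text \<open>The map is \<open>y \<mapsto> (A y + c \<psi>(y) w) / (1 + c \<psi>(y))\<close> with \<open>A\<close> affine, \<open>A F = G\<close>,
  \<open>\<psi>\<close> the height of \<open>A y\<close> above the cutting hyperplane and \<open>w\<close> inside the cap. It agrees with \<open>A\<close> on \<open>F\<close>
  and tends to \<open>w\<close> elsewhere as \<open>c\<close> grows, so a large \<open>c\<close> works for all vertices.\<close>

lemma exists_gluing_projective:
  fixes P Q F :: "'a::euclidean_space set"
  assumes cut: "vertex_cut P v a b" and dP: "aff_dim P = int DIM('a)"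
    and G: "(int DIM('a) - 1) simplex (P \<inter> {x. a \<bullet> x = b})"
    and Q: "polytope Q" and FQ: "F facet_of Q" and F: "(int DIM('a) - 1) simplex F"
  obtains L where "linear L" "inj L" "\<And>x. x \<in> Q \<Longrightarrow> 0 < snd (L (x, 1))"
    "projective_map L ` F = P \<inter> {x. a \<bullet> x = b}"
    "projective_map L ` (Q - F) \<subseteq> interior P \<inter> {x. b < a \<bullet> x}"
proof -
  interpret vertex_cut P v a b by (rule cut)
  let ?G = "P \<inter> {x. a \<bullet> x = b}" and ?l = "\<lambda>x::'a. (x, 1::real)"
  have cQ: "convex Q" using Q polytope_imp_convex by blast
  obtain n m where nm: "Q \<subseteq> {x. n \<bullet> x \<le> m}" "F = Q \<inter> {x. n \<bullet> x = m}"
    using facet_of_polyhedron[OF polytope_imp_polyhedron[OF Q] FQ] by blast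
  have "F \<noteq> Q" using FQ by auto
  then obtain q where q: "q \<in> Q" "n \<bullet> q < m" using nm by force
  obtain C where C: "\<not> affine_dependent C" "int (card C) = int DIM('a)" "F = convex hull C" "finite C"
    using F by (auto simp: simplex)
  obtain D where D: "\<not> affine_dependent D" "int (card D) = int DIM('a)" "?G = convex hull D" "finite D"
    using G by (auto simp: simplex)
  have CF: "C \<subseteq> {x. n \<bullet> x = m}" using C(3) nm(2) hull_subset[of C convex] by blast
  then have "affine hull C \<subseteq> {x. n \<bullet> x = m}" by (rule hull_minimal) (rule affine_hyperplane)
  then have qC: "q \<notin> affine hull C" using q by auto
  have DG: "D \<subseteq> {x. a \<bullet> x = b}" using D(3) hull_subset[of D convex] by blast
  then have "affine hull D \<subseteq> {x. a \<bullet> x = b}" by (rule hull_minimal) (rule affine_hyperplane)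
  then have vD: "v \<notin> affine hull D" using av by auto
  note C' = facet_insert_independent[OF C(1,2) qC] and D' = facet_insert_independent[OF D(1,2) vD]
  have "card C = card D" using C(2) D(2) by simp
  then obtain \<beta>0 where \<beta>0: "bij_betw \<beta>0 C D" using finite_same_card_bij[OF C(4) D(4)] by blast
  have "q \<notin> C" "v \<notin> D" using qC vD by (auto simp: hull_inc)
  \<comment> \<open>Sending the point \<open>q\<close> of \<open>Q\<close> off \<open>F\<close> to
    \<open>v\<close> puts the image of \<open>Q\<close> on the side of the cap.\<close>
  define \<beta> where "\<beta> = \<beta>0(q := v)"
  have \<beta>C: "bij_betw \<beta> C D"
    using \<beta>0 \<open>q \<notin> C\<close> by (subst bij_betw_cong[of C \<beta> \<beta>0]) (auto simp: \<beta>_def)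
  then have \<beta>: "bij_betw \<beta> (insert q C) (insert v D)"
    using notIn_Un_bij_betw[of q C \<beta> D] \<open>q \<notin> C\<close> \<open>v \<notin> D\<close> by (simp add: \<beta>_def)
  obtain L0 :: "'a \<times> real \<Rightarrow> 'a \<times> real" where L0: "linear L0" "inj L0"
    "\<And>x. x \<in> insert q C \<Longrightarrow> L0 (x, 1) = (\<beta> x, 1)" "\<And>z. snd (L0 z) = snd z"
    using exists_affine_lift[OF C' D' \<beta>] by blast
  \<comment> \<open>The height above the cutting hyperplane, homogenised to a linear
    functional.\<close>
  define h where "h z = a \<bullet> fst z - b * snd z" for z :: "'a \<times> real"
  have linh: "linear h" unfolding h_def
    by (intro linearI) (simp_all add: inner_add_right algebra_simps)
  define \<psi> where "\<psi> z = h (L0 z)" for z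
  have "\<psi> = h \<circ> L0" by (auto simp: \<psi>_def)
  then have lin\<psi>: "linear \<psi>" using linear_compose[OF L0(1) linh] by simp
  define \<phi> where "\<phi> z = m * snd z - n \<bullet> fst z" for z :: "'a \<times> real"
  have lin\<phi>: "linear \<phi>" unfolding \<phi>_def
    by (intro linearI) (simp_all add: inner_add_right algebra_simps)
  \<comment> \<open>Both \<open>\<psi>\<close> and \<open>\<phi>\<close>, the homogenised slack of
    the inequality defining \<open>F\<close>, vanish on the lift of \<open>C\<close>; this factor
    makes them proportional at \<open>q\<close> as well. Hence \<open>\<psi>\<close> is nonnegative
    on \<open>Q\<close> and vanishes there only on \<open>F\<close>.\<close>
  define \<alpha> where "\<alpha> = (a \<bullet> v - b) / (m - n \<bullet> q)"
  have \<alpha>: "0 < \<alpha>" using av q by (simp add: \<alpha>_def)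
  have \<psi>\<phi>: "\<psi> z = \<alpha> * \<phi> z" for z
  proof (rule linear_eq_on[OF lin\<psi> linear_compose_scale_right[OF lin\<phi>], of z "?l ` insert q C" \<alpha>, simplified])
    show "z \<in> span (insert (q, 1) (?l ` C))" using span_lift[OF C'(2)] by simp
    fix y assume "y = (q, 1) \<or> y \<in> ?l ` C"
    then consider "y = (q, 1)" | x where "x \<in> C" "y = (x, 1)" by blast
    then show "\<psi> y = \<alpha> * \<phi> y"
    proof cases
      case 1
      then show ?thesis using L0(3)[of q] q by (simp add: \<psi>_def h_def \<phi>_def \<alpha>_def \<beta>_def)
    next
      case 2
      then have "a \<bullet> \<beta> x = b" using \<beta>C DG by (auto simp: bij_betw_def)
      then show ?thesis using 2 L0(3)[of x] CF by (auto simp: \<psi>_def h_def \<phi>_def)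
    qed
  qed
  have \<psi>Q: "0 \<le> \<psi> (y, 1)" "\<psi> (y, 1) = 0 \<longleftrightarrow> y \<in> F" if "y \<in> Q" for y
    using that nm \<alpha> by (auto simp: \<psi>\<phi> \<phi>_def)
  have Pint: "rel_interior P = interior P" using dP aff_dim_eq_full rel_interior_interior by blast
  have intne: "interior P \<noteq> {}"
    using Pint rel_interior_eq_empty[OF convP] apex_mem by auto
  define U where "U = interior P \<inter> {x. b < a \<bullet> x}"
  have openU: "open U" unfolding U_def by (intro open_Int open_interior open_halfspace_gt)
  have "U \<noteq> {}"
  proof -
    have "\<not> interior P \<subseteq> {x. a \<bullet> x \<le> b}"
    proof
      assume "interior P \<subseteq> {x. a \<bullet> x \<le> b}"
      then have "closure (interior P) \<subseteq> {x. a \<bullet> x \<le> b}" by (rule closure_minimal) (rule closed_halfspace_le)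
      moreover have "v \<in> closure (interior P)"
        using convex_closure_interior[OF convP intne] closure_subset apex_mem by blast
      ultimately show False using av by auto
    qed
    then show ?thesis unfolding U_def by force
  qed
  then obtain w where w: "w \<in> U" by blast
  have hw: "0 < h (w, 1)" using w by (simp add: h_def U_def)
  define A where "A x = fst (L0 (x, 1))" for x
  have L0A: "L0 (x, 1) = (A x, 1)" for x using L0(4)[of "(x, 1)"] by (simp add: A_def prod_eq_iff)
  \<comment> \<open>The point equals \<open>w\<close> plus \<open>A y - w\<close> divided by
    \<open>1 + c * \<psi> (y, 1)\<close>, and the divisor tends to infinity.\<close>
  have lim: "((\<lambda>c. (A y + (c * \<psi> (y, 1)) *\<^sub>R w) /\<^sub>R (1 + c * \<psi> (y, 1))) \<longlongrightarrow> w) at_top"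
    if "0 < \<psi> (y, 1)" for y
  proof -
    let ?p = "\<psi> (y, 1)"
    have "filterlim (\<lambda>c. 1 + c * ?p) at_top at_top"
      using that by (intro filterlim_tendsto_add_at_top[OF tendsto_const] filterlim_at_top_mult_tendsto_pos[OF tendsto_const] filterlim_ident)
        (auto simp: mult.commute)
    then have "((\<lambda>c. inverse (1 + c * ?p)) \<longlongrightarrow> 0) at_top"
      by (rule tendsto_inverse_0_at_top)
    then have "((\<lambda>c. w + inverse (1 + c * ?p) *\<^sub>R (A y - w)) \<longlongrightarrow> w + 0 *\<^sub>R (A y - w)) at_top"
      by (intro tendsto_intros)
    moreover have "\<forall>\<^sub>F c in at_top. w + inverse (1 + c * ?p) *\<^sub>R (A y - w) = (A y + (c * ?p) *\<^sub>R w) /\<^sub>R (1 + c * ?p)"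
    proof (rule eventually_mono[OF eventually_ge_at_top[of 0]])
      fix c :: real assume "0 \<le> c"
      then have p: "0 < 1 + c * ?p" using that by (simp add: add_pos_nonneg)
      have "w = (1 + c * ?p) *\<^sub>R w /\<^sub>R (1 + c * ?p)" using p by simp
      then have "w + inverse (1 + c * ?p) *\<^sub>R (A y - w) = ((1 + c * ?p) *\<^sub>R w + (A y - w)) /\<^sub>R (1 + c * ?p)"
        by (simp only: scaleR_add_right)
      then show "w + inverse (1 + c * ?p) *\<^sub>R (A y - w) = (A y + (c * ?p) *\<^sub>R w) /\<^sub>R (1 + c * ?p)"
        by (simp add: algebra_simps)
    qed
    ultimately show ?thesis by (simp add: tendsto_cong)
  qed
  let ?E = "{y. y extreme_point_of Q}"
  have "\<forall>\<^sub>F c in at_top. \<forall>y\<in>?E - F. (A y + (c * \<psi> (y, 1)) *\<^sub>R w) /\<^sub>R (1 + c * \<psi> (y, 1)) \<in> U"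
  proof (rule eventually_ball_finite)
    show "finite (?E - F)" using finite_vertices[OF Q] by simp
    show "\<forall>y\<in>?E - F. \<forall>\<^sub>F c in at_top. (A y + (c * \<psi> (y, 1)) *\<^sub>R w) /\<^sub>R (1 + c * \<psi> (y, 1)) \<in> U"
    proof
      fix y assume y: "y \<in> ?E - F"
      then have "y \<in> Q" by (simp add: extreme_point_of_def)
      then have "0 < \<psi> (y, 1)" using \<psi>Q[of y] y by (simp add: order.strict_iff_order)
      from topological_tendstoD[OF lim[OF this] openU w]
      show "\<forall>\<^sub>F c in at_top. (A y + (c * \<psi> (y, 1)) *\<^sub>R w) /\<^sub>R (1 + c * \<psi> (y, 1)) \<in> U" .
    qed
  qed
  then have "\<forall>\<^sub>F c in at_top. (\<forall>y\<in>?E - F. (A y + (c * \<psi> (y, 1)) *\<^sub>R w) /\<^sub>R (1 + c * \<psi> (y, 1)) \<in> U) \<and> 0 \<le> c"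
    using eventually_ge_at_top[of 0] by (rule eventually_conj)
  then obtain c where c: "\<forall>y\<in>?E - F. (A y + (c * \<psi> (y, 1)) *\<^sub>R w) /\<^sub>R (1 + c * \<psi> (y, 1)) \<in> U" "0 \<le> c"
    by (metis (no_types, lifting) eventually_at_top_linorder order_refl)
  define L where "L z = L0 z + (c * \<psi> z) *\<^sub>R (w, 1)" for z
  have linL: "linear L"
    by (intro linearI)
      (simp_all only: L_def linear_add[OF L0(1)] linear_scale[OF L0(1)] linear_add[OF lin\<psi>] linear_scale[OF lin\<psi>],
        simp_all add: algebra_simps)
  have injL: "inj L"
  proof (rule linear_injective_0[OF linL, THEN iffD2], intro allI impI)
    \<comment> \<open>Applying \<open>h\<close> gives
      \<open>\<psi> z * (1 + c * h (w, 1)) = 0\<close>. As \<open>w\<close> is strictly above the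
      cut, the second factor is positive, which leaves \<open>L0 z = 0\<close>.\<close>
    fix z assume Lz: "L z = 0"
    have "h (L z) = \<psi> z + (c * \<psi> z) * h (w, 1)"
      unfolding L_def by (simp only: linear_add[OF linh] linear_scale[OF linh] \<psi>_def) simp
    then have "\<psi> z * (1 + c * h (w, 1)) = 0" using Lz linear_0[OF linh] by (simp add: algebra_simps)
    moreover have "0 < 1 + c * h (w, 1)" using c(2) hw by (simp add: add_pos_nonneg)
    ultimately have "\<psi> z = 0" by simp
    then have "L0 z = 0" using Lz by (simp add: L_def flip: zero_prod_def)
    then show "z = 0" using L0(1,2) linear_injective_0 by blast
  qed
  have L1: "L (y, 1) = (A y + (c * \<psi> (y, 1)) *\<^sub>R w, 1 + c * \<psi> (y, 1))" for y
    by (simp add: L_def L0A)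
  have posL: "0 < snd (L (y, 1))" if "y \<in> Q" for y
    using \<psi>Q(1)[OF that] c(2) by (simp add: L1 add_pos_nonneg)
  interpret pr: positive_projective L Q
    by (rule positive_projective.intro[OF linL injL cQ posL])
  have pi: "projective_map L y = (A y + (c * \<psi> (y, 1)) *\<^sub>R w) /\<^sub>R (1 + c * \<psi> (y, 1))" for y
    by (simp add: projective_map_def L1)
  have FsubQ: "F \<subseteq> Q" using FQ by (rule facet_of_imp_subset)
  have CQ: "C \<subseteq> Q" using FsubQ C(3) hull_subset[of C convex] by blast
  have piF: "projective_map L ` F = ?G"
  proof -
    have "projective_map L x = \<beta> x" if "x \<in> C" for x
    proof -
      have "x \<in> F" "x \<in> Q" using that CQ C(3) hull_subset[of C convex] by auto
      then have "\<psi> (x, 1) = 0" using \<psi>Q(2) by blast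
      moreover have "A x = \<beta> x" using L0(3)[of x] that by (simp add: A_def)
      ultimately show ?thesis by (simp add: pi)
    qed
    then have "projective_map L ` C = \<beta> ` C" by (intro image_cong) auto
    also have "\<dots> = D" using \<beta>C by (simp add: bij_betw_def)
    finally show ?thesis using pr.convex_hull_image[OF CQ] C(3) D(3) by simp
  qed
  \<comment> \<open>A convex set containing all vertices of \<open>Q\<close>, which extends the
    choice of \<open>c\<close> from finitely many points to the whole polytope.\<close>
  define M where "M = {y \<in> Q. y \<in> F \<or> projective_map L y \<in> U}"
  have half: "z \<in> M" if x: "x \<in> Q" "projective_map L x \<in> U" and y: "y \<in> M" and z: "z \<in> open_segment x y" for x y z
  proof -
    have yQ: "y \<in> Q" using y by (simp add: M_def)
    have "projective_map L y \<in> P \<and> b \<le> a \<bullet> projective_map L y"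
    proof (cases "y \<in> F")
      case True
      then have "projective_map L y \<in> ?G" using piF by blast
      then show ?thesis by simp
    next
      case False
      then show ?thesis using y interior_subset[of P] by (auto simp: M_def U_def)
    qed
    then have py: "projective_map L y \<in> closure P" "b \<le> a \<bullet> projective_map L y" using closure_subset by auto
    have "projective_map L z \<in> open_segment (projective_map L x) (projective_map L y)"
      using pr.open_segment_image[OF x(1) yQ] z by blast
    moreover have "open_segment (projective_map L x) (projective_map L y) \<subseteq> interior P"
      using in_interior_closure_convex_segment[OF convP _ py(1)] x(2) by (simp add: U_def)
    moreover have "b < a \<bullet> p" if p: "p \<in> open_segment (projective_map L x) (projective_map L y)" for p
    proof -
      obtain u where u: "0 < u" "u < 1" "p = (1 - u) *\<^sub>R projective_map L x + u *\<^sub>R projective_map L y"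
        using p by (auto simp: in_segment)
      have "(1 - u) * b < (1 - u) * (a \<bullet> projective_map L x)" using u x(2) by (simp add: U_def)
      moreover have "u * b \<le> u * (a \<bullet> projective_map L y)" using u py(2) by simp
      moreover have "a \<bullet> p = (1 - u) * (a \<bullet> projective_map L x) + u * (a \<bullet> projective_map L y)"
        by (simp add: u(3) inner_add_right)
      moreover have "b = (1 - u) * b + u * b" by (simp add: algebra_simps)
      ultimately show ?thesis by linarith
    qed
    moreover have "z \<in> Q" using x(1) yQ z cQ by (auto simp: convex_contains_open_segment)
    ultimately show ?thesis by (auto simp: M_def U_def)
  qed
  have "convex M"
  proof (rule convex_contains_open_segment[THEN iffD2], intro ballI subsetI)
    fix x y z assume x: "x \<in> M" and y: "y \<in> M" and z: "z \<in> open_segment x y"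
    show "z \<in> M"
    proof (cases "x \<in> F \<and> y \<in> F")
      case True
      have "convex F" using F convex_simplex by blast
      then have "z \<in> F" using True z by (auto simp: convex_contains_open_segment)
      then show ?thesis using FsubQ by (auto simp: M_def)
    next
      case False
      then have "projective_map L x \<in> U \<or> projective_map L y \<in> U" using x y by (auto simp: M_def)
      moreover have "x \<in> Q" "y \<in> Q" using x y by (auto simp: M_def)
      ultimately show ?thesis
        using half[OF _ _ y z] half[OF _ _ x, of y z] z open_segment_commute[of x y] by auto
    qed
  qed
  moreover have "?E \<subseteq> M"
    using c(1) by (auto simp: M_def pi extreme_point_of_def)
  ultimately have "convex hull ?E \<subseteq> M" by (intro hull_minimal)
  moreover have "Q = convex hull ?E"
    using Q Krein_Milman_Minkowski polytope_imp_compact cQ by blast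
  ultimately have "projective_map L ` (Q - F) \<subseteq> U" by (auto simp: M_def)
  then show thesis using that linL injL posL piF unfolding U_def by blast
qed

lemma exists_connected_sum:
  fixes P Q :: "'a::euclidean_space set"
  assumes D: "DIM('a) = 4" and P: "cut_adapter P v a b" and Q: "adapter_polytope 4 Q"
  obtains R where "d_polytope 4 R" "is_connected_sum 4 P Q R"
    "\<forall>i\<le>3. f_num i R + (if i = 0 \<or> i = 3 then 1 else 0) = f_num i P + f_num i Q"
proof -
  have cut: "vertex_cut P v a b" and sv: "simple_vertex 4 P v" and G: "3 simplex (P \<inter> {x. a \<bullet> x = b})"
    and dpP: "d_polytope 4 P" and dpQ: "d_polytope 4 Q"
    using P Q by (auto simp: cut_adapter_def adapter_polytope_def)
  obtain F where sF: "simplex_facet 4 Q F" using Q by (auto simp: adapter_polytope_def)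
  then have F: "F facet_of Q" "3 simplex F" by (auto simp: simplex_facet_def)
  have dP: "aff_dim P = 4" and dQ: "aff_dim Q = 4" and pQ: "polytope Q" using dpP dpQ by (auto simp: d_polytope_def)
  interpret vertex_cut P v a b by (rule cut)
  let ?G = "P \<inter> {x. a \<bullet> x = b}" and ?Pb = "P \<inter> {x. a \<bullet> x \<le> b}"
  obtain L where L: "linear L" "inj L" "\<And>x. x \<in> Q \<Longrightarrow> 0 < snd (L (x, 1))"
    "projective_map L ` F = ?G" "projective_map L ` (Q - F) \<subseteq> interior P \<inter> {x. b < a \<bullet> x}"
    using exists_gluing_projective[OF cut _ _ pQ F(1)] dP G F(2) D by auto
  interpret pr: positive_projective L Q
    by (rule positive_projective.intro[OF L(1,2) polytope_imp_convex[OF pQ] L(3)])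
  define B where "B = projective_map L ` Q"
  have pB: "polytope B" unfolding B_def by (rule pr.polytope_image[OF pQ order_refl])
  have cB: "convex B" using pB polytope_imp_convex by blast
  have FQ: "F \<subseteq> Q" using facet_of_imp_subset[OF F(1)] .
  then have "Q = F \<union> (Q - F)" by blast
  then have "B = projective_map L ` F \<union> projective_map L ` (Q - F)" unfolding B_def by (metis image_Un)
  then have B: "B = ?G \<union> projective_map L ` (Q - F)" using L(4) by simp
  have BW: "B \<subseteq> P" "B \<subseteq> {x. a \<bullet> x \<ge> b}" "B \<inter> {x. a \<bullet> x = b} = ?G" "B - {x. a \<bullet> x = b} \<subseteq> interior P"
    unfolding B using L(5) interior_subset[of P] by force+
  \<comment> \<open>Here \<open>P\<close> itself, before truncation, plays the part of
    \<open>W\<close>: the image of \<open>Q\<close> lies within \<open>P\<close> and takes the place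
    of the cap.\<close>
  define R where "R = ?Pb \<union> B"
  have cR: "convex R" unfolding R_def by (rule convex_cap_Un[OF convP cB BW(2,3,1)])
  have Pint: "rel_interior P = interior P"
    using dP D aff_dim_eq_full[of P] rel_interior_interior[of P] by simp
  have "P face_of P" using convP by (rule face_of_refl)
  moreover have Pv: "P \<noteq> {v}" using dP by auto
  ultimately obtain g where g: "g \<in> interior P" "a \<bullet> g = b"
    using face_crosses(1)[OF _ apex_mem] Pint by blast
  have proper: "K face_of R" if "K face_of ?G" "K \<noteq> ?G" for K
    unfolding R_def by (rule proper_face_cap_Un[OF convP BW(2,4) g BW(1) that])
  have pR: "polytope R" unfolding R_def
    using polytope_Un_convex[OF polytope_slice(2) pB] cR by (simp add: R_def)
  have slices: "R \<inter> {x. a \<bullet> x \<le> b} = ?Pb" "R \<inter> {x. a \<bullet> x \<ge> b} = B" "R \<inter> {x. a \<bullet> x = b} = ?G"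
  proof -
    have 1: "B \<inter> {x. a \<bullet> x \<le> b} \<subseteq> ?G" using BW(2,3) by force
    then show "R \<inter> {x. a \<bullet> x \<le> b} = ?Pb" unfolding R_def by auto
    have "?Pb \<inter> {x. a \<bullet> x \<ge> b} \<subseteq> B" using BW(3) by force
    then show "R \<inter> {x. a \<bullet> x \<ge> b} = B" using BW(2) unfolding R_def by auto
    show "R \<inter> {x. a \<bullet> x = b} = ?G" using BW(3) unfolding R_def by auto
  qed
  have "\<exists>x0 y0. glued R a x0 y0 b"
  proof -
    obtain x0 where x0: "x0 \<in> P" "a \<bullet> x0 < b" using face_has_below[of P] convP face_of_refl Pv apex_mem by blast
    have "F \<noteq> Q" using F(1) by auto
    then obtain q where "q \<in> Q - F" using FQ by blast
    then have "projective_map L q \<in> B" "b < a \<bullet> projective_map L q" using L(5) by (auto simp: B_def)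
    then have "glued R a x0 (projective_map L q) b"
      using pR x0 proper by unfold_locales (auto simp: slices(3), auto simp: R_def)
    then show ?thesis by blast
  qed
  then obtain x0 y0 where gl: "glued R a x0 y0 b" by blast
  have dR: "aff_dim R = 4" using glued.dims(1)[OF gl] dims(1)[OF Pv] slices(1) dP by simp
  have fB: "f_num i B = f_num i Q" for i unfolding B_def by (rule pr.f_num_image)
  have fG: "f_num 3 ?G = 1" by (rule f_num_self) (use G convex_simplex aff_dim_simplex in auto)
  \<comment> \<open>In low dimensions the faces of the cut gained by truncation are identified again
    by gluing, leaving only the loss of \<open>v\<close>. Among facets truncation gains one and
    gluing loses two.\<close>
  have 1: "i < 3 \<Longrightarrow> f_num i R + f_num i ?G = f_num i ?Pb + f_num i Q" for i
    using glued.f_num_glue[OF gl, of i] slices dR fB by simp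
  have 2: "f_num 3 R + 2 = f_num 3 ?Pb + f_num 3 Q"
    using glued.f_num_glue_facets[OF gl, of 3] slices dR fB by simp
  have count: "f_num i R + (if i = 0 \<or> i = 3 then 1 else 0) = f_num i P + f_num i Q" if "i \<le> 3" for i
  proof (cases "i = 3")
    case True then show ?thesis using 2 f_num_trunc[of 3] fG by simp
  next
    case False
    then have "i < 3" using that by simp
    then show ?thesis using 1[of i] f_num_trunc[of i] by (simp split: if_splits)
  qed
  have dpR: "d_polytope 4 R" using pR dR by (simp add: d_polytope_def)
  have "bij L" using L(1,2) linear_inj_imp_surj unfolding bij_def by blast
  then have adm: "admissible_projective L Q"
    unfolding admissible_projective_def using L(1,3) by force
  have "B \<inter> ?Pb = ?G" using BW by force
  moreover have "\<forall>H. H face_of ?G \<and> H \<noteq> ?G \<longrightarrow> H face_of ?Pb \<union> B" using proper unfolding R_def by blast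
  moreover have "\<forall>w. w extreme_point_of P \<and> w \<noteq> v \<longrightarrow> a \<bullet> w < b" using others by blast
  ultimately have "simple_vertex 4 P v \<and> a \<bullet> v > b \<and> (\<forall>w. w extreme_point_of P \<and> w \<noteq> v \<longrightarrow> a \<bullet> w < b) \<and>
      ?Pb = P \<inter> {x. a \<bullet> x \<le> b} \<and> ?G = P \<inter> {x. a \<bullet> x = b} \<and> simplex_facet 4 Q F \<and>
      admissible_projective L Q \<and> B = projective_map L ` Q \<and> B \<inter> ?Pb = ?G \<and> projective_map L ` F = ?G \<and>
      convex (?Pb \<union> B) \<and> (\<forall>H. H face_of ?G \<and> H \<noteq> ?G \<longrightarrow> H face_of (?Pb \<union> B)) \<and> R = ?Pb \<union> B"
    using sv av sF adm L(4) B_def cR[unfolded R_def] R_def by (intro conjI refl)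
  then have "is_connected_sum 4 P Q R"
    unfolding is_connected_sum_def
    by (intro conjI dpP dpQ, rule_tac exI[of _ v], rule_tac exI[of _ a], rule_tac exI[of _ b], rule_tac exI[of _ F],
        rule_tac exI[of _ L], rule_tac exI[of _ ?Pb], rule_tac exI[of _ ?G], rule_tac exI[of _ B])
  then show thesis using that dpR count by blast
qed

lemma exists_cut_adapter_real4:
  fixes S :: "'a::euclidean_space set"
  assumes "d_polytope 4 S"
  obtains PA :: "(real^4) set" and v a b where "cut_adapter PA v a b"
    "\<forall>i\<le>3. f_num i S < f_num i PA"
    "\<forall>i\<le>3. real (f_num i PA) - real (f_num i S) \<le> 6 * real (f_num i S) powr (2/3) + 16"
proof -
  have "polytope S" "aff_dim S = int DIM(real^4)" using assms by (simp_all add: d_polytope_def)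
  then obtain P :: "(real^4) set" where P: "polytope P" "aff_dim P = int DIM(real^4)" "\<And>i. f_num i P = f_num i S"
    using exists_full_dim_copy by blast
  have D4: "DIM(real^4) = 4" by simp
  have dP: "d_polytope 4 P" using P by (simp add: d_polytope_def)
  show thesis
    by (rule exists_cut_adapter[OF D4 dP]) (rule that, simp_all only: P(3))
qed

lemma cut_adapter_imp_adapter: "cut_adapter P v a b \<Longrightarrow> adapter_polytope 4 P"
  by (simp add: cut_adapter_def)

theorem theorem6p4:
  fixes P' :: "'a::euclidean_space set" and P'' :: "'b::euclidean_space set"
  assumes "d_polytope 4 P'" and "d_polytope 4 P''"
  shows "\<exists>(PA' :: (real^4) set) (PA'' :: (real^4) set) (Q :: (real^4) set).
    adapter_polytope 4 PA' \<and> adapter_polytope 4 PA'' \<and>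
    (\<forall>i\<le>3. \<bar>real (f_num i PA') - real (f_num i P')\<bar>
              \<le> 6 * real (f_num i P') powr (2/3) + 16) \<and>
    (\<forall>i\<le>3. \<bar>real (f_num i PA'') - real (f_num i P'')\<bar>
              \<le> 6 * real (f_num i P'') powr (2/3) + 16) \<and>
    d_polytope 4 Q \<and> is_connected_sum 4 PA' PA'' Q \<and>
    (\<forall>i\<le>3. \<bar>real (f_num i Q) - (real (f_num i P') + real (f_num i P''))\<bar>
              < 12 * real (f_num i Q) powr (2/3) + 33)"
proof -
  obtain PA' :: "(real^4) set" and v' a' b' where PA': "cut_adapter PA' v' a' b'"
    "\<forall>i\<le>3. f_num i P' < f_num i PA'"
    "\<forall>i\<le>3. real (f_num i PA') - real (f_num i P') \<le> 6 * real (f_num i P') powr (2/3) + 16"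
    using exists_cut_adapter_real4[OF assms(1)] .
  obtain PA'' :: "(real^4) set" and v'' a'' b'' where PA'': "cut_adapter PA'' v'' a'' b''"
    "\<forall>i\<le>3. f_num i P'' < f_num i PA''"
    "\<forall>i\<le>3. real (f_num i PA'') - real (f_num i P'') \<le> 6 * real (f_num i P'') powr (2/3) + 16"
    using exists_cut_adapter_real4[OF assms(2)] .
  have D4: "DIM(real^4) = 4" by simp
  obtain R where R: "d_polytope 4 R" "is_connected_sum 4 PA' PA'' R"
    "\<forall>i\<le>3. f_num i R + (if i = 0 \<or> i = 3 then 1 else 0) = f_num i PA' + f_num i PA''"
    using exists_connected_sum[OF D4 PA'(1) cut_adapter_imp_adapter[OF PA''(1)]] .
  have "\<bar>real (f_num i R) - (real (f_num i P') + real (f_num i P''))\<bar> < 12 * real (f_num i R) powr (2/3) + 33"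
    if i: "i \<le> 3" for i
  proof -
    \<comment> \<open>Strict growth in both summands outweighs the possible loss of one face, so the
      difference to be bounded is nonnegative and \<open>f_num i R\<close> dominates
      \<open>f_num i P'\<close> and \<open>f_num i P''\<close>. The additive errors sum to 32, below
      33.\<close>
    have lt: "f_num i P' < f_num i PA'" "f_num i P'' < f_num i PA''" using PA'(2) PA''(2) i by auto
    have "f_num i PA' + f_num i PA'' \<le> f_num i R + 1" "f_num i R \<le> f_num i PA' + f_num i PA''"
      using R(3)[rule_format, OF i] by (simp_all split: if_splits)
    then have *: "f_num i P' + f_num i P'' \<le> f_num i R" "f_num i R \<le> f_num i PA' + f_num i PA''"
      using lt by linarith+
    have "real (f_num i P') powr (2/3) \<le> real (f_num i R) powr (2/3)"
      "real (f_num i P'') powr (2/3) \<le> real (f_num i R) powr (2/3)"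
      using * by (auto intro!: powr_two_thirds_mono)
    then show ?thesis
      using * PA'(3)[rule_format, OF i] PA''(3)[rule_format, OF i] by linarith
  qed
  moreover have "\<bar>real (f_num i PA') - real (f_num i P')\<bar> \<le> 6 * real (f_num i P') powr (2/3) + 16"
    "\<bar>real (f_num i PA'') - real (f_num i P'')\<bar> \<le> 6 * real (f_num i P'') powr (2/3) + 16" if i: "i \<le> 3" for i
    using PA'(2,3) PA''(2,3) i by (auto simp: abs_of_pos)
  ultimately show ?thesis
    using cut_adapter_imp_adapter[OF PA'(1)] cut_adapter_imp_adapter[OF PA''(1)] R(1,2) by blast
qed

end
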